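(* Let $R\ge T\ge1$ be integers, $\bar\gamma>0$, and let $\mathbf{u}\in\mathbb{R}^R$ and $\mathbf{v}\in\mathbb{R}^T$ have positive entries ordered as $u_1>u_2>\cdots>u_R$ and $v_1>v_2>\cdots>v_T$. Let $$\widetilde C_{\mathrm{erg}}(\mathbf{u},\mathbf{v})=\mathbb{E}\left[\log_2\det\left(\mathbf{I}_T+\frac{\bar\gamma}{T}\,\mathrm{diag}(\mathbf{v})\,\mathbf{H}^{*}\,\mathrm{diag}(\mathbf{u})\,\mathbf{H}\right)\right],$$ where $\mathbf{H}\in\mathbb{C}^{R\times T}$ has i.i.d. zero-mean unit-variance circularly symmetric complex Gaussian entries. Then $$\widetilde C_{\mathrm{erg}}(\mathbf{u},\mathbf{v})=-\frac{R-1}{\ln2}+\mathrm{Tr}\left(\widetilde{\mathbf{\Psi}}^{-1}\,\partial\widetilde{\mathbf{\Psi}}\right),$$ where the $R\times R$ matrices $\widetilde{\mathbf{\Psi}}=\begin{bmatrix}\widetilde{\mathbf{\Psi}}_1\\ \mathbf{\Psi}_2\end{bmatrix}$ and $\partial\widetilde{\mathbf{\Psi}}=\begin{bmatrix}\partial\widetilde{\mathbf{\Psi}}_1\\ \partial\mathbf{\Psi}_2\end{bmatrix}$ have the following blocks. For $1\le i\le T$, $1\le j\le R$: $$[\widetilde{\mathbf{\Psi}}_1]_{i,j}=\left(-\tfrac{\bar\gamma u_j}{T}\right)^{R-1}v_i^{T-1}\xi_{R-1}+\sum_{k=R-T}^{R-2}\left(-\tfrac{\bar\gamma u_j}{T}\right)^{k}v_i^{k-R+T}\xi_k,$$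 $$[\partial\widetilde{\mathbf{\Psi}}_1]_{i,j}=-\frac{1}{\ln2}\left(-\tfrac{\bar\gamma u_j}{T}\right)^{R-1}v_i^{T-1}\xi_{R-1}\left[H_{R-1}-e^{\frac{T}{\bar\gamma u_jv_i}}E_1\!\left(\tfrac{T}{\bar\gamma u_jv_i}\right)\right]-\frac{1}{\ln2}\sum_{k=R-T}^{R-2}\left(-\tfrac{\bar\gamma u_j}{T}\right)^{k}v_i^{k-R+T}\xi_kH_k.$$ For $1\le i\le R-T$, $1\le j\le R$: $$[\mathbf{\Psi}_2]_{i,j}=\left(-\tfrac{\bar\gamma u_j}{T}\right)^{i-1}\xi_{i-1},\qquad[\partial\mathbf{\Psi}_2]_{i,j}=-\frac1{\ln2}\left(-\tfrac{\bar\gamma u_j}{T}\right)^{i-1}\xi_{i-1}H_{i-1}.$$ Here $H_k=\sum_{r=1}^{k}\frac{1}{-R+r}$ and $\xi_r=(-R+1)_r$.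
   Context: $(x)_r=x(x+1)\cdots(x+r-1)$ is the Pochhammer symbol (rising factorial), with $(x)_0=1$; empty sums are $0$, so $H_0=0$. $E_1(x)=\int_x^\infty \frac{e^{-s}}{s}\,ds$ for $x>0$ is the exponential integral. $\mathrm{diag}(\cdot)$ places a vector on the diagonal of a diagonal matrix, $^{*}$ is the conjugate transpose, and $\mathbf{I}_T$ is the identity matrix. When $R=T$, the blocks $\mathbf{\Psi}_2,\partial\mathbf{\Psi}_2$ are empty. *)

theory Defs
  imports
    "HOL-Probability.Probability"
    "Jordan_Normal_Form.Schur_Decomposition"
    "Jordan_Normal_Form.Gauss_Jordan_Elimination"
begin

(* Vectors and matrices are those of Jordan_Normal_Form, so every index starts at 0 and
   the dimensions R and T are ordinary natural numbers.  The notation of HOL-Analysis for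
   vectors over a finite index type is switched off. *)
unbundle no vec_syntax

definition exp_integral_E1 :: "real \<Rightarrow> real" where
  "exp_integral_E1 x = (LBINT s:{x..}. exp (- s) / s)"

(* Circularly symmetric complex Gaussian with mean 0 and E|Z|^2 = 1: the real and the
   imaginary part are independent N(0, 1/2).  The second argument of normal_density is the
   standard deviation. *)
definition std_complex_gaussian :: "'a measure \<Rightarrow> ('a \<Rightarrow> complex) \<Rightarrow> bool" where
  "std_complex_gaussian M Z \<longleftrightarrow>
     prob_space.indep_var M borel (\<lambda>\<omega>. Re (Z \<omega>)) borel (\<lambda>\<omega>. Im (Z \<omega>)) \<and>
     distributed M lborel (\<lambda>\<omega>. Re (Z \<omega>)) (\<lambda>x. ennreal (normal_density 0 (sqrt (1 / 2)) x)) \<and>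
     distributed M lborel (\<lambda>\<omega>. Im (Z \<omega>)) (\<lambda>x. ennreal (normal_density 0 (sqrt (1 / 2)) x))"

definition iid_complex_gaussian_mat ::
    "'a measure \<Rightarrow> nat \<Rightarrow> nat \<Rightarrow> ('a \<Rightarrow> complex mat) \<Rightarrow> bool" where
  "iid_complex_gaussian_mat M R T H \<longleftrightarrow>
     (\<forall>\<omega>\<in>space M. H \<omega> \<in> carrier_mat R T) \<and>
     prob_space.indep_vars M (\<lambda>_. borel) (\<lambda>ij \<omega>. H \<omega> $$ ij) ({..<R} \<times> {..<T}) \<and>
     (\<forall>i<R. \<forall>j<T. std_complex_gaussian M (\<lambda>\<omega>. H \<omega> $$ (i, j)))"

definition diag_of_vec :: "real vec \<Rightarrow> complex mat" where
  "diag_of_vec x = mat_diag (dim_vec x) (\<lambda>i. complex_of_real (x $ i))"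

(* The determinant below is a positive real number for positive g, u, v (it equals the one
   with sqrt(diag v) H* (diag u) H sqrt(diag v)); Re only converts its type. *)
definition log_det_capacity ::
    "nat \<Rightarrow> real \<Rightarrow> real vec \<Rightarrow> real vec \<Rightarrow> complex mat \<Rightarrow> real" where
  "log_det_capacity T g u v H =
     log 2 (Re (Determinant.det
       (1\<^sub>m T + complex_of_real (g / real T) \<cdot>\<^sub>m
          (diag_of_vec v * mat_adjoint H * diag_of_vec u * H))))"

definition ergodic_capacity ::
    "'a measure \<Rightarrow> nat \<Rightarrow> real \<Rightarrow> real vec \<Rightarrow> real vec \<Rightarrow> ('a \<Rightarrow> complex mat) \<Rightarrow> real" where
  "ergodic_capacity M T g u v H = prob_space.expectation M (\<lambda>\<omega>. log_det_capacity T g u v (H \<omega>))"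

definition H_sum :: "nat \<Rightarrow> nat \<Rightarrow> real" where
  "H_sum R k = (\<Sum>r=1..k. 1 / (- real R + real r))"

definition xi :: "nat \<Rightarrow> nat \<Rightarrow> real" where
  "xi R r = pochhammer (- real R + 1) r"

(* In the sums below k runs over R-T, ..., R-2, written {R-T..<R-1} because truncated
   subtraction would give R-2 = 0 for R = 1.  Since k >= R-T, the exponent k+T-R is the
   integer k-R+T. *)
definition Psi1 :: "nat \<Rightarrow> nat \<Rightarrow> real \<Rightarrow> real vec \<Rightarrow> real vec \<Rightarrow> real mat" where
  "Psi1 R T g u v = mat T R (\<lambda>(i, j).
     (- (g * u $ j / real T)) ^ (R - 1) * (v $ i) ^ (T - 1) * xi R (R - 1)
     + (\<Sum>k\<in>{R - T..<R - 1}. (- (g * u $ j / real T)) ^ k * (v $ i) ^ (k + T - R) * xi R k))"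

definition dPsi1 :: "nat \<Rightarrow> nat \<Rightarrow> real \<Rightarrow> real vec \<Rightarrow> real vec \<Rightarrow> real mat" where
  "dPsi1 R T g u v = mat T R (\<lambda>(i, j).
     - (1 / ln 2) * (- (g * u $ j / real T)) ^ (R - 1) * (v $ i) ^ (T - 1) * xi R (R - 1)
         * (H_sum R (R - 1)
            - exp (real T / (g * u $ j * v $ i)) * exp_integral_E1 (real T / (g * u $ j * v $ i)))
     - (1 / ln 2) * (\<Sum>k\<in>{R - T..<R - 1}.
         (- (g * u $ j / real T)) ^ k * (v $ i) ^ (k + T - R) * xi R k * H_sum R k))"

(* Row i here is row i+1 when rows are counted from 1, hence the exponent i. *)
definition Psi2 :: "nat \<Rightarrow> nat \<Rightarrow> real \<Rightarrow> real vec \<Rightarrow> real mat" where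
  "Psi2 R T g u = mat (R - T) R (\<lambda>(i, j). (- (g * u $ j / real T)) ^ i * xi R i)"

definition dPsi2 :: "nat \<Rightarrow> nat \<Rightarrow> real \<Rightarrow> real vec \<Rightarrow> real mat" where
  "dPsi2 R T g u = mat (R - T) R (\<lambda>(i, j).
     - (1 / ln 2) * (- (g * u $ j / real T)) ^ i * xi R i * H_sum R i)"

definition Psi :: "nat \<Rightarrow> nat \<Rightarrow> real \<Rightarrow> real vec \<Rightarrow> real vec \<Rightarrow> real mat" where
  "Psi R T g u v = Psi1 R T g u v @\<^sub>r Psi2 R T g u"

definition dPsi :: "nat \<Rightarrow> nat \<Rightarrow> real \<Rightarrow> real vec \<Rightarrow> real vec \<Rightarrow> real mat" where
  "dPsi R T g u v = dPsi1 R T g u v @\<^sub>r dPsi2 R T g u"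

definition mat_trace :: "'a :: comm_monoid_add mat \<Rightarrow> 'a" where
  "mat_trace A = (\<Sum>i<dim_row A. A $$ (i, i))"

end

theory Submission
  imports Defs
begin

text \<open>
Let \<open>D x = det (1 + x diag(v) H\<^sup>* diag(u) H)\<close>, \<open>L x = E ln (D x)\<close> and
\<open>Q x y = E [D y / D x]\<close>. Writing \<open>1 / D x\<close> as the expectation of a Gaussian weight
\<open>exp (- x w\<^sup>* H\<^sup>* diag(u) H w)\<close>, where \<open>w = diag(\<surd>v) z\<close> for a standard complex Gaussian vector
\<open>z\<close>, and exchanging the order of integration, one first averages the weighted determinant over
\<open>H\<close>, one row at a time, and then over \<open>z\<close>, through Laplace transforms and partial fractions.
The result has the form \<open>Q x y = 1 + (y - x) (\<Sum>k<T. y^k * B k x)\<close>. Since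
\<open>1 - 1/r \<le> ln r \<le> r - 1\<close>, the difference quotients of \<open>L\<close> are squeezed between two values of the
last sum, so that \<open>L' x = (\<Sum>k<T. x^k * B k x)\<close>; the right-hand side has an explicit primitive,
a combination of the numbers \<open>exp (1/c) * E\<^sub>1 (1/c)\<close> with \<open>c = x u\<^sub>j v\<^sub>i\<close>.

On the other side, the matrix \<open>Psi\<close> is the product of a matrix depending on \<open>v\<close> and a row-scaled
Vandermonde matrix in \<open>u\<close>. Both are inverted by Lagrange polynomials, and the trace becomes the
same combination.
\<close>

section \<open>Determinants\<close>

text \<open>The obstacle is the denominator: \<open>D'(x) / D(x)\<close> is not polynomial in the
  entries of \<open>H\<close>. Two parameters separate the roles: once the Gaussian weight has
  replaced \<open>1 / D x\<close>, the factor \<open>D y\<close> is a polynomial in independent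
  Gaussian rows, and its weighted mean needs only the second moments of one row at a time. No
  eigenvalue density of the channel enters, and \<open>L\<close> is never differentiated under the
  expectation; the squeeze needs only continuity of the \<open>B k\<close>. The factor
  \<open>y - x\<close>, forced by \<open>Q x x = 1\<close>, comes from telescoping: the coefficient
  of \<open>y^(k+1)\<close> in \<open>Q x y\<close> is \<open>B k x - x * B (k+1) x\<close>, and
  \<open>B T = 0\<close>. Derivatives are taken within \<open>{0..}\<close>, because
  \<open>L 0 = 0\<close> is what fixes the constant of integration. The form with E_1 degenerates at
  0, so the primitive is handled as half-line integrals that stay regular there. The factorials in
  the common combination come from \<open>k\<close>-fold derivatives at 0 on the probabilistic side
  and from quotients of Pochhammer symbols on the trace side.\<close>

definition detf :: "nat \<Rightarrow> (nat \<Rightarrow> nat \<Rightarrow> 'a :: comm_ring_1) \<Rightarrow> 'a" where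
  "detf n A = Determinant.det (mat n n (\<lambda>(i, j). A i j))"

lemma detf_cong: "(\<And>i j. i < n \<Longrightarrow> j < n \<Longrightarrow> A i j = B i j) \<Longrightarrow> detf n A = detf n B"
  unfolding detf_def by (rule arg_cong[where f = Determinant.det]) (auto intro!: eq_matI)

lemma detf_leibniz:
  "detf n A = (\<Sum>p | p permutes {0..<n}. signof p * (\<Prod>i = 0..<n. A i (p i)))"
proof -
  have "(\<Prod>i = 0..<n. mat n n (\<lambda>(i, j). A i j) $$ (i, p i)) = (\<Prod>i = 0..<n. A i (p i))"
    if "p permutes {0..<n}" for p
    using permutes_in_image[OF that] by (intro prod.cong) auto
  thus ?thesis unfolding detf_def by (subst det_def'[of _ n]) (auto intro!: sum.cong)
qed

lemma detf_upper_triangular: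
  fixes A :: "nat \<Rightarrow> nat \<Rightarrow> 'a :: idom"
  assumes "\<And>i j. j < i \<Longrightarrow> i < n \<Longrightarrow> A i j = 0"
  shows "detf n A = (\<Prod>i<n. A i i)"
proof -
  have "upper_triangular (mat n n (\<lambda>(i, j). A i j))"
    using assms by (auto simp: upper_triangular_def)
  thus ?thesis unfolding detf_def
    by (subst det_upper_triangular[of _ n]) (auto simp: prod_list_diag_prod atLeast0LessThan)
qed

lemma detf_lower_triangular:
  fixes A :: "nat \<Rightarrow> nat \<Rightarrow> 'a :: idom"
  assumes "\<And>i j. i < j \<Longrightarrow> j < n \<Longrightarrow> A i j = 0"
  shows "detf n A = (\<Prod>i<n. A i i)"
  unfolding detf_def using assms
  by (subst det_lower_triangular[of n]) (auto simp: prod_list_diag_prod atLeast0LessThan)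

text \<open>Along a permutation the factors \<open>s i\<close> and \<open>1 / s (p i)\<close>
  cancel. With \<open>s\<close> the square roots of \<open>v\<close> this passes between the
  Hermitian form of the channel matrix, to which Gaussian integration applies, and the form with
  \<open>diag(v)\<close> on the left.\<close>

lemma detf_conj_diag:
  fixes A :: "nat \<Rightarrow> nat \<Rightarrow> 'a :: field"
  assumes s: "\<And>i. i < n \<Longrightarrow> s i \<noteq> 0"
  shows "detf n (\<lambda>i j. s i * A i j / s j) = detf n A"
proof -
  have "(\<Prod>i = 0..<n. s i * A i (p i) / s (p i)) = (\<Prod>i = 0..<n. A i (p i))"
    if p: "p permutes {0..<n}" for p
  proof -
    have "(\<Prod>i = 0..<n. s (p i)) = (\<Prod>i = 0..<n. s i)"
      using prod.permute[OF p, of s] by (simp add: o_def)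
    moreover have "(\<Prod>i = 0..<n. s i) \<noteq> 0" using s by auto
    ultimately show ?thesis by (simp add: prod.distrib prod_dividef)
  qed
  thus ?thesis unfolding detf_leibniz by (intro sum.cong) auto
qed

text \<open>Block elimination with the corner entry as pivot: the matrix is a block upper triangular
  one carrying the Schur complement, times a unitriangular one.\<close>

lemma detf_Suc_schur:
  fixes A :: "nat \<Rightarrow> nat \<Rightarrow> 'a :: field"
  assumes p: "A n n \<noteq> 0"
  shows "detf (Suc n) A = A n n * detf n (\<lambda>i j. A i j - A i n * A n j / A n n)"
proof -
  define S where "S = mat n n (\<lambda>(i, j). A i j - A i n * A n j / A n n)"
  define b where "b = mat n 1 (\<lambda>(i, j). A i n)"
  define c where "c = mat 1 n (\<lambda>(i, j). A n j / A n n)"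
  define d where "d = mat 1 1 (\<lambda>(i, j). A n n)"
  define X where "X = four_block_mat S b (0\<^sub>m 1 n) d"
  define Y where "Y = four_block_mat (1\<^sub>m n) (0\<^sub>m n 1) c (1\<^sub>m 1)"
  have [simp]: "S \<in> carrier_mat n n" "b \<in> carrier_mat n (Suc 0)" "c \<in> carrier_mat (Suc 0) n"
    "d \<in> carrier_mat (Suc 0) (Suc 0)"
    by (auto simp: S_def b_def c_def d_def)
  have "X * Y = four_block_mat (S * 1\<^sub>m n + b * c) (S * 0\<^sub>m n 1 + b * 1\<^sub>m 1)
      (0\<^sub>m 1 n * 1\<^sub>m n + d * c) (0\<^sub>m 1 n * 0\<^sub>m n 1 + d * 1\<^sub>m 1)"
    unfolding X_def Y_def by (rule mult_four_block_mat[of _ n n _ 1 _ 1 _ _ n _ 1]) simp_all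
  also have "\<dots> = mat (Suc n) (Suc n) (\<lambda>(i, j). A i j)"
    by (rule eq_matI) (use p in \<open>auto simp: four_block_mat_def Let_def S_def b_def c_def d_def
        scalar_prod_def less_Suc_eq\<close>)
  finally have "detf (Suc n) A = Determinant.det (X * Y)" by (simp add: detf_def)
  also have "\<dots> = Determinant.det X * Determinant.det Y"
    unfolding X_def Y_def by (rule det_mult[of _ "n + 1"]; rule four_block_carrier_mat) simp_all
  also have "Determinant.det X = Determinant.det S * Determinant.det d"
    unfolding X_def by (rule det_four_block_mat_lower_left_zero) auto
  also have "Determinant.det Y = 1"
    unfolding Y_def by (subst det_four_block_mat_upper_right_zero) auto
  also have "Determinant.det d = A n n" by (subst det_single) (auto simp: d_def)
  finally show ?thesis by (simp add: S_def detf_def)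
qed

section \<open>Cofactors as increments, and directional derivatives built from them\<close>

definition bump :: "(nat \<Rightarrow> nat \<Rightarrow> 'a :: comm_ring_1) \<Rightarrow> nat \<Rightarrow> nat \<Rightarrow> nat \<Rightarrow> nat \<Rightarrow> 'a" where
  "bump N a b = (\<lambda>i j. N i j + (if i = a \<and> j = b then 1 else 0))"

text \<open>In the Leibniz sum only the permutations with \<open>p a = b\<close> notice the bump, so
  the increment is the cofactor of the entry \<open>(a, b)\<close>.\<close>

lemma detf_bump_diff:
  assumes "a < n"
  shows "detf n (bump N a b) - detf n N =
    (\<Sum>p | p permutes {0..<n}. signof p * (if p a = b then \<Prod>i\<in>{0..<n} - {a}. N i (p i) else 0))"
proof -
  have "(\<Prod>i = 0..<n. bump N a b i (p i)) - (\<Prod>i = 0..<n. N i (p i)) =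
     (if p a = b then \<Prod>i\<in>{0..<n} - {a}. N i (p i) else 0)" for p
  proof -
    have *: "(\<Prod>i = 0..<n. M i (p i)) = M a (p a) * (\<Prod>i\<in>{0..<n} - {a}. M i (p i))" for M :: "nat \<Rightarrow> nat \<Rightarrow> 'a"
      using assms by (subst prod.remove[of _ a]) auto
    have "(\<Prod>i\<in>{0..<n} - {a}. bump N a b i (p i)) = (\<Prod>i\<in>{0..<n} - {a}. N i (p i))"
      by (intro prod.cong) (auto simp: bump_def)
    thus ?thesis unfolding *[of "bump N a b"] *[of N] by (simp add: bump_def algebra_simps)
  qed
  thus ?thesis
    unfolding detf_leibniz by (simp add: sum_subtractf[symmetric] right_diff_distrib[symmetric])
qed

text \<open>For a polynomial \<open>F\<close> that is affine in every matrix entry, the directional derivative can be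
  written with finite differences; this form survives integration over a parameter.\<close>

definition jdiff :: "nat \<Rightarrow> ((nat \<Rightarrow> nat \<Rightarrow> complex) \<Rightarrow> complex) \<Rightarrow> bool" where
  "jdiff n F \<longleftrightarrow> (\<forall>N K. ((\<lambda>e. F (\<lambda>i j. N i j + e * K i j)) has_field_derivative
     (\<Sum>a<n. \<Sum>b<n. K a b * (F (bump N a b) - F N))) (at 0))"

text \<open>The product rule on the Leibniz sum gives a sum over \<open>p\<close> and
  \<open>a\<close>; regrouping it by the position \<open>(a, p a)\<close> produces the
  cofactors.\<close>

lemma jdiff_detf: "jdiff n (detf n)"
  unfolding jdiff_def
proof (intro allI)
  fix N K :: "nat \<Rightarrow> nat \<Rightarrow> complex"
  let ?PP = "{p. p permutes {0..<n}}"
  define Q where "Q p a = (\<Prod>i\<in>{0..<n} - {a}. N i (p i))" for p a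
  have "((\<lambda>e. \<Prod>i = 0..<n. N i (p i) + e * K i (p i)) has_field_derivative
      (\<Sum>a = 0..<n. K a (p a) * Q p a)) (at 0)" for p
    unfolding Q_def
    by (rule has_field_derivative_prod[THEN DERIV_cong])
       (auto intro!: derivative_eq_intros sum.cong simp: mult.commute)
  hence "((\<lambda>e. detf n (\<lambda>i j. N i j + e * K i j)) has_field_derivative
      (\<Sum>p\<in>?PP. signof p * (\<Sum>a = 0..<n. K a (p a) * Q p a))) (at 0)"
    unfolding detf_leibniz by (intro DERIV_sum DERIV_cmult)
  also have "(\<Sum>p\<in>?PP. signof p * (\<Sum>a = 0..<n. K a (p a) * Q p a)) =
      (\<Sum>p\<in>?PP. \<Sum>a<n. \<Sum>b<n. K a b * (signof p * (if p a = b then Q p a else 0)))"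
  proof (rule sum.cong[OF refl])
    fix p assume "p \<in> ?PP"
    hence "p a < n" if "a < n" for a using permutes_in_image[of p "{0..<n}" a] that by auto
    hence "(\<Sum>b<n. K a b * (signof p * (if p a = b then Q p a else 0))) = signof p * (K a (p a) * Q p a)"
      if "a < n" for a
      using that by (subst sum.remove[of _ "p a"]) (auto intro!: sum.neutral)
    thus "signof p * (\<Sum>a = 0..<n. K a (p a) * Q p a) =
      (\<Sum>a<n. \<Sum>b<n. K a b * (signof p * (if p a = b then Q p a else 0)))"
      by (simp add: sum_distrib_left atLeast0LessThan)
  qed
  also have "\<dots> = (\<Sum>a<n. \<Sum>b<n. K a b * (detf n (bump N a b) - detf n N))"
    unfolding Q_def by (subst sum.swap, intro sum.cong refl, subst sum.swap, intro sum.cong refl)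
       (simp add: detf_bump_diff sum_distrib_left)
  finally show "((\<lambda>e. detf n (\<lambda>i j. N i j + e * K i j)) has_field_derivative
      (\<Sum>a<n. \<Sum>b<n. K a b * (detf n (bump N a b) - detf n N))) (at 0)" .
qed

lemma jdiff_lin:
  assumes "jdiff n F" "jdiff n G"
  shows "jdiff n (\<lambda>N. c * F N + d * G N)"
  unfolding jdiff_def
proof (intro allI)
  fix N K :: "nat \<Rightarrow> nat \<Rightarrow> complex"
  have "((\<lambda>e. c * F (\<lambda>i j. N i j + e * K i j) + d * G (\<lambda>i j. N i j + e * K i j)) has_field_derivative
     c * (\<Sum>a<n. \<Sum>b<n. K a b * (F (bump N a b) - F N)) +
     d * (\<Sum>a<n. \<Sum>b<n. K a b * (G (bump N a b) - G N))) (at 0)"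
    using assms unfolding jdiff_def by (intro DERIV_add DERIV_cmult) auto
  also have "c * (\<Sum>a<n. \<Sum>b<n. K a b * (F (bump N a b) - F N)) +
     d * (\<Sum>a<n. \<Sum>b<n. K a b * (G (bump N a b) - G N)) =
     (\<Sum>a<n. \<Sum>b<n. K a b * (c * F (bump N a b) + d * G (bump N a b) - (c * F N + d * G N)))"
    unfolding sum_distrib_left sum.distrib[symmetric] by (intro sum.cong refl) (simp add: algebra_simps)
  finally show "((\<lambda>e. c * F (\<lambda>i j. N i j + e * K i j) + d * G (\<lambda>i j. N i j + e * K i j)) has_field_derivative
     (\<Sum>a<n. \<Sum>b<n. K a b * (c * F (bump N a b) + d * G (bump N a b) - (c * F N + d * G N)))) (at 0)" .
qed

lemma jdiff_zero: "jdiff n (\<lambda>N. 0)"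
  by (simp add: jdiff_def)

lemma jdiff_sum:
  assumes "finite A" "\<And>a. a \<in> A \<Longrightarrow> jdiff n (F a)"
  shows "jdiff n (\<lambda>N. \<Sum>a\<in>A. c a * F a N)"
  using assms
proof (induction A rule: finite_induct)
  case empty
  then show ?case by (simp add: jdiff_zero)
next
  case (insert a A)
  from jdiff_lin[of n "F a" "\<lambda>N. \<Sum>a\<in>A. c a * F a N" "c a" 1] insert show ?case by simp
qed

text \<open>Adding a row to \<open>mean_det\<close> combines bumped copies of the previous
  functional, and they must stay in the class. The reason is that bumps commute with each other and
  with a shift along \<open>K\<close>.\<close>

lemma jdiff_bump:
  assumes "jdiff n F"
  shows "jdiff n (\<lambda>N. F (bump N a b))"
  unfolding jdiff_def
proof (intro allI)
  fix N K :: "nat \<Rightarrow> nat \<Rightarrow> complex"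
  have 1: "bump (\<lambda>i j. N i j + e * K i j) a b = (\<lambda>i j. bump N a b i j + e * K i j)" for e
    by (auto simp: bump_def fun_eq_iff)
  have 2: "bump (bump N c d) a b = bump (bump N a b) c d" for c d
    by (auto simp: bump_def fun_eq_iff)
  show "((\<lambda>e. F (bump (\<lambda>i j. N i j + e * K i j) a b)) has_field_derivative
     (\<Sum>c<n. \<Sum>d<n. K c d * (F (bump (bump N c d) a b) - F (bump N a b)))) (at 0)"
    unfolding 1 2 using assms unfolding jdiff_def by blast
qed

section \<open>Rank one and rank two perturbations\<close>

lemma detf_rank_one:
  fixes N :: "nat \<Rightarrow> nat \<Rightarrow> complex"
  shows "detf n (\<lambda>i j. N i j + e * (p i * q j)) =
    detf n N + e * (\<Sum>a<n. \<Sum>b<n. p a * q b * (detf n (bump N a b) - detf n N))"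
proof -
  \<comment> \<open>Bordering: \<open>B e\<close> is \<open>N\<close> with last row
    \<open>q\<close>, last column \<open>- e * p\<close> and corner 1. Its Schur complement is the
    perturbed matrix, while \<open>e\<close> occurs in the last column only, so the cofactors of
    that column are free of \<open>e\<close>.\<close>
  define B where "B e i j = (if i < n then if j < n then N i j else - e * p i else if j < n then q j else 1)"
    for e :: complex and i j
  define B' where "B' i j = (if i < n then N i j else q j)" for i j
  define C where "C i = (-1) ^ (i + n) * Determinant.det
      (mat n n (\<lambda>(k, l). B' (if k < i then k else Suc k) l))" for i
  have B': "B e i j = B' i j" if "j < n" for e i j
    using that by (simp add: B_def B'_def)
  have "mat_delete (mat (Suc n) (Suc n) (\<lambda>(i, j). B e i j)) i n =
      mat n n (\<lambda>(k, l). B' (if k < i then k else Suc k) l)" if "i < Suc n" for e i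
    by (rule eq_matI) (use that in \<open>auto simp: mat_delete_def B'\<close>)
  hence cof: "cofactor (mat (Suc n) (Suc n) (\<lambda>(i, j). B e i j)) i n = C i" if "i < Suc n" for e i
    using that by (simp add: C_def cofactor_def)
  have "detf n (\<lambda>i j. N i j + e * (p i * q j)) = detf (Suc n) (B e)" for e
    by (subst detf_Suc_schur) (auto simp: B_def intro!: detf_cong)
  also have "detf (Suc n) (B e) = (\<Sum>i<Suc n. B e i n * C i)" for e
    unfolding detf_def by (subst laplace_expansion_column[of _ "Suc n" n]) (auto simp: cof)
  also have "(\<Sum>i<Suc n. B e i n * C i) = C n - e * (\<Sum>i<n. p i * C i)" for e
    by (simp add: B_def sum_distrib_left mult.assoc sum_negf)
  finally have aff: "detf n (\<lambda>i j. N i j + e * (p i * q j)) = C n - e * (\<Sum>i<n. p i * C i)" for e .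
  \<comment> \<open>The determinant is affine in \<open>e\<close>, so the derivative at 0 supplied
    by \<open>jdiff_detf\<close> is its slope.\<close>
  have "((\<lambda>e. detf n (\<lambda>i j. N i j + e * (p i * q j))) has_field_derivative
      (\<Sum>a<n. \<Sum>b<n. p a * q b * (detf n (bump N a b) - detf n N))) (at 0)"
    using jdiff_detf[of n, unfolded jdiff_def, rule_format, of N "\<lambda>i j. p i * q j"] .
  moreover have "((\<lambda>e. detf n (\<lambda>i j. N i j + e * (p i * q j))) has_field_derivative
      - (\<Sum>i<n. p i * C i)) (at 0)"
    unfolding aff by (auto intro!: derivative_eq_intros)
  ultimately have "(\<Sum>a<n. \<Sum>b<n. p a * q b * (detf n (bump N a b) - detf n N)) = - (\<Sum>i<n. p i * C i)"
    by (rule DERIV_unique)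
  moreover have "detf n N = C n" using aff[of 0] by simp
  ultimately show ?thesis unfolding aff by simp
qed

lemma detf_diag_rank_one:
  fixes d :: "nat \<Rightarrow> complex"
  shows "detf n (\<lambda>i j. (if i = j then d i else 0) + e * (p i * q j)) =
    (\<Prod>i<n. d i) + e * (\<Sum>i<n. p i * q i * (\<Prod>l\<in>{..<n} - {i}. d l))"
proof -
  let ?D = "\<lambda>i j. if i = j then d i else 0"
  have D: "detf n ?D = (\<Prod>i<n. d i)" by (subst detf_upper_triangular) auto
  \<comment> \<open>A bump leaves a diagonal matrix triangular, so only bumps on the diagonal change
    the determinant.\<close>
  have "detf n (bump ?D a b) - detf n ?D = (if a = b then \<Prod>l\<in>{..<n} - {a}. d l else 0)"
    if "a < n" "b < n" for a b
  proof -
    have "detf n (bump ?D a b) = (\<Prod>i<n. bump ?D a b i i)"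
    proof (cases "a \<le> b")
      case True
      thus ?thesis by (intro detf_upper_triangular) (auto simp: bump_def)
    next
      case False
      thus ?thesis by (intro detf_lower_triangular) (auto simp: bump_def)
    qed
    also have "\<dots> = bump ?D a b a a * (\<Prod>i\<in>{..<n} - {a}. bump ?D a b i i)"
      using that by (subst prod.remove[of _ a]) auto
    also have "(\<Prod>i\<in>{..<n} - {a}. bump ?D a b i i) = (\<Prod>i\<in>{..<n} - {a}. d i)"
      by (intro prod.cong) (auto simp: bump_def)
    also have "detf n ?D = d a * (\<Prod>i\<in>{..<n} - {a}. d i)"
      unfolding D using that by (subst prod.remove[of _ a]) auto
    ultimately show ?thesis by (auto simp: bump_def algebra_simps)
  qed
  hence "(\<Sum>a<n. \<Sum>b<n. p a * q b * (detf n (bump ?D a b) - detf n ?D)) =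
     (\<Sum>a<n. \<Sum>b<n. if b = a then p a * q a * (\<Prod>l\<in>{..<n} - {a}. d l) else 0)"
    by (intro sum.cong) auto
  also have "\<dots> = (\<Sum>i<n. p i * q i * (\<Prod>l\<in>{..<n} - {i}. d l))"
    by (intro sum.cong refl) (subst sum.delta, auto)
  finally show ?thesis unfolding detf_rank_one D by simp
qed

lemma detf_2: "detf 2 A = A 0 0 * A 1 1 - A 0 1 * A 1 0"
proof -
  let ?M = "mat 2 2 (\<lambda>(i, j). A i j)"
  have "cofactor ?M 0 0 = A 1 1"
    unfolding cofactor_def by (subst det_single) (auto simp: mat_delete_def)
  moreover have "cofactor ?M 1 0 = - A 0 1"
    unfolding cofactor_def by (subst det_single) (auto simp: mat_delete_def)
  moreover have "detf 2 A = (\<Sum>i<2. ?M $$ (i, 0) * cofactor ?M i 0)"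
    unfolding detf_def by (rule laplace_expansion_column) auto
  ultimately show ?thesis by (simp add: numeral_2_eq_2 mult.commute)
qed

text \<open>Sylvester's identity \<open>det (1 + P Q) = det (1 + Q P)\<close> for an
  \<open>n\<close> by 2 matrix \<open>P\<close> reduces this to a 2 by 2 determinant.\<close>

lemma detf_rank_two:
  fixes p q r s :: "nat \<Rightarrow> 'a :: field"
  shows "detf n (\<lambda>i j. (if i = j then 1 else 0) + p i * q j + r i * s j) =
    (1 + (\<Sum>i<n. p i * q i)) * (1 + (\<Sum>i<n. r i * s i)) - (\<Sum>i<n. r i * q i) * (\<Sum>i<n. p i * s i)"
proof -
  define P where "P = mat n 2 (\<lambda>(i, j). if j = 0 then p i else r i)"
  define Q where "Q = mat 2 n (\<lambda>(i, j). if i = 0 then q j else s j)"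
  define X where "X = four_block_mat (1\<^sub>m n + P * Q) (- P) (0\<^sub>m 2 n) (1\<^sub>m 2)"
  define Y where "Y = four_block_mat (1\<^sub>m n) (0\<^sub>m n 2) Q (1\<^sub>m 2)"
  define Z where "Z = four_block_mat (1\<^sub>m n) (- P) (0\<^sub>m 2 n) (1\<^sub>m 2 + Q * P)"
  have [simp]: "P \<in> carrier_mat n 2" "Q \<in> carrier_mat 2 n"
    "dim_col P = 2" "dim_row P = n" "dim_col Q = n" "dim_row Q = 2" by (auto simp: P_def Q_def)
  have [simp]: "P * Q \<in> carrier_mat n n" "Q * P \<in> carrier_mat 2 2" by (auto simp: P_def Q_def)
  have c1: "(1\<^sub>m m + W) + - W = 1\<^sub>m m" and c2: "- W + (1\<^sub>m m + W) = 1\<^sub>m m"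
    if "W \<in> carrier_mat m m" for W :: "'a mat" and m
    using that by (auto intro!: eq_matI)
  have e1: "(1\<^sub>m n + P * Q) * 1\<^sub>m n + (- P) * Q = 1\<^sub>m n"
    using c1[of "P * Q" n] by (simp add: right_mult_one_mat[of _ n n])
  have e2: "(1\<^sub>m n + P * Q) * 0\<^sub>m n 2 + (- P) * 1\<^sub>m 2 = - P"
    by (simp add: right_mult_zero_mat[of _ n n] right_mult_one_mat[of _ n 2])
  have e3: "0\<^sub>m 2 n * 1\<^sub>m n + 1\<^sub>m 2 * Q = Q" "Q * 1\<^sub>m n + 1\<^sub>m 2 * 0\<^sub>m 2 n = Q"
    by (simp_all add: left_mult_one_mat[of _ 2 n] right_mult_one_mat[of _ 2 n] left_add_zero_mat[of _ 2 n]
        right_add_zero_mat[of _ 2 n])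
  have e4: "0\<^sub>m 2 n * 0\<^sub>m n 2 + 1\<^sub>m 2 * 1\<^sub>m 2 = (1\<^sub>m 2 :: 'a mat)"
     "1\<^sub>m n * 1\<^sub>m n + 0\<^sub>m n 2 * 0\<^sub>m 2 n = (1\<^sub>m n :: 'a mat)"
    by (auto intro!: eq_matI)
  have e5: "1\<^sub>m n * (- P) + 0\<^sub>m n 2 * (1\<^sub>m 2 + Q * P) = - P"
    by (simp add: left_mult_one_mat[of _ n 2] left_mult_zero_mat[of _ 2 2])
  have e6: "Q * (- P) + 1\<^sub>m 2 * (1\<^sub>m 2 + Q * P) = 1\<^sub>m 2"
    using c2[of "Q * P" 2] by (simp add: left_mult_one_mat[of _ 2 2])
  have "X * Y = four_block_mat ((1\<^sub>m n + P * Q) * 1\<^sub>m n + (- P) * Q)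
      ((1\<^sub>m n + P * Q) * 0\<^sub>m n 2 + (- P) * 1\<^sub>m 2)
      (0\<^sub>m 2 n * 1\<^sub>m n + 1\<^sub>m 2 * Q) (0\<^sub>m 2 n * 0\<^sub>m n 2 + 1\<^sub>m 2 * 1\<^sub>m 2)"
    unfolding X_def Y_def by (rule mult_four_block_mat[of _ n n _ 2 _ 2 _ _ n _ 2]) simp_all
  moreover have "Y * Z = four_block_mat (1\<^sub>m n * 1\<^sub>m n + 0\<^sub>m n 2 * 0\<^sub>m 2 n)
      (1\<^sub>m n * (- P) + 0\<^sub>m n 2 * (1\<^sub>m 2 + Q * P))
      (Q * 1\<^sub>m n + 1\<^sub>m 2 * 0\<^sub>m 2 n) (Q * (- P) + 1\<^sub>m 2 * (1\<^sub>m 2 + Q * P))"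
    unfolding Z_def Y_def by (rule mult_four_block_mat[of _ n n _ 2 _ 2 _ _ n _ 2]) simp_all
  \<comment> \<open>Since \<open>Y\<close> is unitriangular, this equation makes the determinants of
    \<open>X\<close> and \<open>Z\<close> equal, and they are the two sides of Sylvester's
    identity.\<close>
  ultimately have "X * Y = Y * Z" unfolding e1 e2 e3 e4 e5 e6 by (rule trans[OF _ sym])
  moreover have "Determinant.det (X * Y) = Determinant.det X * Determinant.det Y"
    by (rule det_mult[of _ "n + 2"]) (auto simp: X_def Y_def)
  moreover have "Determinant.det (Y * Z) = Determinant.det Y * Determinant.det Z"
    by (rule det_mult[of _ "n + 2"]) (auto simp: Z_def Y_def)
  moreover have "Determinant.det Y = 1"
    unfolding Y_def by (subst det_four_block_mat_upper_right_zero) auto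
  moreover have "Determinant.det X = Determinant.det (1\<^sub>m n + P * Q)"
    unfolding X_def by (subst det_four_block_mat_lower_left_zero) auto
  moreover have "Determinant.det Z = Determinant.det (1\<^sub>m 2 + Q * P)"
    unfolding Z_def by (subst det_four_block_mat_lower_left_zero) auto
  ultimately have "Determinant.det (1\<^sub>m n + P * Q) = Determinant.det (1\<^sub>m 2 + Q * P)" by simp
  also have "1\<^sub>m n + P * Q = mat n n (\<lambda>(i, j). (if i = j then 1 else 0) + p i * q j + r i * s j)"
    by (rule eq_matI) (auto simp: P_def Q_def scalar_prod_def numeral_2_eq_2)
  also have "Determinant.det (1\<^sub>m 2 + Q * P) = detf 2 (\<lambda>i j. (1\<^sub>m 2 + Q * P) $$ (i, j))"
    unfolding detf_def by (intro arg_cong[where f = Determinant.det] eq_matI) (auto simp: P_def Q_def)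
  also have "\<dots> = (1\<^sub>m 2 + Q * P) $$ (0, 0) * (1\<^sub>m 2 + Q * P) $$ (1, 1)
     - (1\<^sub>m 2 + Q * P) $$ (0, 1) * (1\<^sub>m 2 + Q * P) $$ (1, 0)"
    by (rule detf_2)
  finally show ?thesis
    by (simp add: detf_def P_def Q_def scalar_prod_def atLeast0LessThan mult.commute)
qed

section \<open>Elementary symmetric polynomials and partial fractions\<close>

hide_const (open) Module.smult

text \<open>The generating polynomial of the elementary symmetric polynomials of the
  \<open>a l\<close>; removing an index means splitting off a linear factor.\<close>

definition esym_poly :: "('b \<Rightarrow> 'a :: comm_ring_1) \<Rightarrow> 'b set \<Rightarrow> 'a poly" where
  "esym_poly a A = (\<Prod>l\<in>A. [:1, a l:])"

definition esym :: "('b \<Rightarrow> 'a :: comm_ring_1) \<Rightarrow> 'b set \<Rightarrow> nat \<Rightarrow> 'a" where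
  "esym a A k = coeff (esym_poly a A) k"

lemma poly_esym_poly: "poly (esym_poly a A) s = (\<Prod>l\<in>A. 1 + a l * s)"
  by (simp add: esym_poly_def poly_prod mult.commute)

lemma degree_esym_poly_le: "finite A \<Longrightarrow> Polynomial.degree (esym_poly a A) \<le> card A"
proof (induction A rule: finite_induct)
  case (insert x A)
  have "Polynomial.degree ([:1, a x:] * esym_poly a A) \<le> 1 + card A"
    using degree_mult_le[of "[:1, a x:]" "esym_poly a A"] insert.IH degree_pCons_le[of 1 "[:a x:]"]
    by (simp add: degree_pCons_eq_if split: if_splits)
  with insert show ?case by (simp add: esym_poly_def)
qed (simp add: esym_poly_def)

lemma esym_eq_0: "finite A \<Longrightarrow> card A < k \<Longrightarrow> esym a A k = 0"
  using degree_esym_poly_le[of A a] by (simp add: esym_def coeff_eq_0)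

lemma esym_poly_insert:
  "finite A \<Longrightarrow> x \<notin> A \<Longrightarrow> esym_poly a (insert x A) = [:1, a x:] * esym_poly a A"
  by (simp add: esym_poly_def)

lemma esym_poly_remove:
  "finite A \<Longrightarrow> x \<in> A \<Longrightarrow> esym_poly a A = [:1, a x:] * esym_poly a (A - {x})"
  by (simp add: esym_poly_def prod.remove)

lemma coeff_linear_mult:
  fixes p :: "'a :: comm_ring_1 poly"
  shows "coeff ([:1, c:] * p) k = coeff p k + (if k = 0 then 0 else c * coeff p (k - 1))"
  by (cases k) simp_all

lemma esym_0: "finite A \<Longrightarrow> esym a A 0 = 1"
  by (induction A rule: finite_induct) (simp_all add: esym_def esym_poly_def coeff_mult)

lemma esym_remove_Suc:
  "finite A \<Longrightarrow> x \<in> A \<Longrightarrow> esym a A (Suc k) = esym a (A - {x}) (Suc k) + a x * esym a (A - {x}) k"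
  unfolding esym_def by (subst esym_poly_remove[of A x]) (auto simp: coeff_linear_mult)

lemma esym_insert_Suc:
  "finite A \<Longrightarrow> x \<notin> A \<Longrightarrow> esym a (insert x A) (Suc k) = esym a A (Suc k) + a x * esym a A k"
  using esym_remove_Suc[of "insert x A" x a k] by simp

lemma esym_scale: "finite A \<Longrightarrow> esym (\<lambda>l. c * a l) A k = c ^ k * esym a A k"
proof (induction A arbitrary: k rule: finite_induct)
  case empty
  show ?case by (cases k) (simp_all add: esym_def esym_poly_def)
next
  case (insert x A)
  show ?case
    by (cases k) (use insert in \<open>simp_all add: esym_0 esym_insert_Suc algebra_simps\<close>)
qed

lemma esym_of_real:
  "finite A \<Longrightarrow> esym (\<lambda>l. of_real (a l) :: complex) A k = of_real (esym a A k)"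
proof (induction A arbitrary: k rule: finite_induct)
  case empty
  show ?case by (cases k) (simp_all add: esym_def esym_poly_def)
next
  case (insert x A)
  show ?case
    by (cases k) (use insert in \<open>simp_all add: esym_0 esym_insert_Suc\<close>)
qed

lemma pderiv_esym_poly:
  fixes a :: "'b \<Rightarrow> 'a :: idom"
  assumes "finite A"
  shows "pderiv (esym_poly a A) = (\<Sum>j\<in>A. smult (a j) (esym_poly a (A - {j})))"
  unfolding esym_poly_def
  by (subst pderiv_prod) (auto intro!: sum.cong simp: pderiv_pCons mult.commute)

text \<open>Coefficient comparison in the derivative of the generating polynomial; combinatorially,
  each (k+1)-subset is counted once for each of its elements.\<close>

lemma esym_Suc_sum:
  fixes a :: "'b \<Rightarrow> 'a :: idom"
  assumes "finite A"
  shows "of_nat (Suc k) * esym a A (Suc k) = (\<Sum>j\<in>A. a j * esym a (A - {j}) k)"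
  using arg_cong[OF pderiv_esym_poly[OF assms, of a], of "\<lambda>p. coeff p k"]
  by (simp add: coeff_pderiv esym_def coeff_sum)

section \<open>Partial fractions of a product with distinct simple poles\<close>

locale distinct_scales =
  fixes a :: "nat \<Rightarrow> real" and n :: nat
  assumes pos: "i < n \<Longrightarrow> 0 < a i"
    and inj: "inj_on a {..<n}"
begin

text \<open>The weights in the expansion of \<open>1 / P s\<close> into the fractions
  \<open>alpha j / (1 + a j * s)\<close>; distinctness of the scales keeps the denominators away
  from 0.\<close>

definition alpha :: "nat \<Rightarrow> real" where
  "alpha j = (\<Prod>l\<in>{..<n} - {j}. a j / (a j - a l))"

definition P :: "real \<Rightarrow> real" where
  "P s = (\<Prod>l<n. 1 + a l * s)"

definition er :: "nat \<Rightarrow> nat \<Rightarrow> real" where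
  "er k j = esym a ({..<n} - {j}) k"

definition e :: "nat \<Rightarrow> real" where
  "e k = esym a {..<n} k"

text \<open>For \<open>s > 0\<close> this is obtained by repeated division by \<open>s\<close>:
  \<open>f 0 s\<close> is \<open>(1 - 1 / P s) / s\<close>, and \<open>f (Suc k) s\<close> is
  \<open>(f k s - e (Suc k) / P s) / s\<close>. The partial fraction form stays regular at
  \<open>s = 0\<close>.\<close>

definition f :: "nat \<Rightarrow> real \<Rightarrow> real" where
  "f k s = (\<Sum>j<n. alpha j * er k j * a j / (1 + a j * s))"

definition f' :: "nat \<Rightarrow> real \<Rightarrow> real" where
  "f' k s = - (\<Sum>j<n. alpha j * er k j * (a j)\<^sup>2 / (1 + a j * s)\<^sup>2)"

text \<open>Averaging the weighted determinant over the rows of \<open>H\<close> produces this sum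
  for the scales \<open>u\<close>, at \<open>s = x * S z\<close>; averaging over \<open>z\<close>
  reproduces it for the scales \<open>v\<close>, at \<open>s = x * r\<close>.\<close>

definition d :: "nat \<Rightarrow> real \<Rightarrow> real" where
  "d k s = (\<Sum>j<n. (a j)\<^sup>2 * er k j / ((1 + a j * s) * P s))"

lemma e_Suc: "j < n \<Longrightarrow> e (Suc k) = er (Suc k) j + a j * er k j"
  unfolding e_def er_def by (rule esym_remove_Suc) auto

lemma e_0: "e 0 = 1" and er_0: "er 0 j = 1"
  by (simp_all add: e_def er_def esym_0)

lemma er_eq_0: "j < n \<Longrightarrow> n \<le> k \<Longrightarrow> er k j = 0"
  unfolding er_def by (rule esym_eq_0) (auto simp: card_Diff_singleton_if)

lemma one_plus_pos: "j < n \<Longrightarrow> 0 \<le> s \<Longrightarrow> 0 < 1 + a j * s"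
  using pos[of j] by (simp add: add_pos_nonneg)

lemma P_pos: "0 \<le> s \<Longrightarrow> 0 < P s"
  unfolding P_def by (intro prod_pos) (auto intro: one_plus_pos)

text \<open>Interpolation at the nodes \<open>- 1 / a i\<close>: both sides have degree below
  \<open>n\<close> and equal 1 at all \<open>n\<close> nodes, since every summand but the
  \<open>i\<close>-th vanishes at the node of \<open>i\<close>.\<close>

lemma lagrange: 
  assumes "0 < n"
  shows "(\<Sum>j<n. smult (alpha j) (esym_poly a ({..<n} - {j}))) = 1"
proof (rule poly_eqI_degree[where A = "(\<lambda>i. - (1 / a i)) ` {..<n}"])
  have inj': "inj_on (\<lambda>i. - (1 / a i)) {..<n}"
    using inj pos by (force simp: inj_on_def)
  hence card: "card ((\<lambda>i. - (1 / a i)) ` {..<n}) = n" by (simp add: card_image)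
  have "Polynomial.degree (smult (alpha j) (esym_poly a ({..<n} - {j}))) \<le> n - 1" if "j < n" for j
    using degree_esym_poly_le[of "{..<n} - {j}" a] that
    by (intro order.trans[OF degree_smult_le]) (auto simp: card_Diff_singleton_if)
  hence "Polynomial.degree (\<Sum>j<n. smult (alpha j) (esym_poly a ({..<n} - {j}))) \<le> n - 1"
    by (intro degree_sum_le) auto
  thus "Polynomial.degree (\<Sum>j<n. smult (alpha j) (esym_poly a ({..<n} - {j}))) < card ((\<lambda>i. - (1 / a i)) ` {..<n})"
    unfolding card using assms by simp
  show "Polynomial.degree (1 :: real poly) < card ((\<lambda>i. - (1 / a i)) ` {..<n})"
    unfolding card using assms by simp
  fix x assume "x \<in> (\<lambda>i. - (1 / a i)) ` {..<n}"
  then obtain i where i: "i < n" "x = - (1 / a i)" by auto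
  have "poly (smult (alpha j) (esym_poly a ({..<n} - {j}))) x = (if j = i then 1 else 0)" if "j < n" for j
  proof (cases "j = i")
    case True
    have ne: "a i - a l \<noteq> 0" if "l \<in> {..<n} - {i}" for l
      using inj that i by (auto simp: inj_on_def)
    have "poly (smult (alpha j) (esym_poly a ({..<n} - {j}))) x =
       (\<Prod>l\<in>{..<n} - {i}. (a i / (a i - a l)) * (1 + a l * x))"
      using True by (simp only: poly_smult poly_esym_poly alpha_def prod.distrib)
    also have "\<dots> = (\<Prod>l\<in>{..<n} - {i}. 1)"
    proof (rule prod.cong[OF refl])
      fix l assume "l \<in> {..<n} - {i}"
      hence "a i - a l \<noteq> 0" by (rule ne)
      moreover have "1 + a l * x = (a i - a l) / a i"
        unfolding i(2) using pos[OF i(1)] by (simp add: field_simps)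
      ultimately show "(a i / (a i - a l)) * (1 + a l * x) = 1" using pos[OF i(1)] by simp
    qed
    finally show ?thesis using True by simp
  next
    case False
    hence "poly (esym_poly a ({..<n} - {j})) x = 0"
      using i pos[OF i(1)] by (auto simp: poly_esym_poly intro!: bexI[of _ i])
    thus ?thesis using False by simp
  qed
  thus "poly (\<Sum>j<n. smult (alpha j) (esym_poly a ({..<n} - {j}))) x = poly 1 x"
    using i by (simp add: poly_sum)
qed

text \<open>These are the coefficients of \<open>lagrange\<close>; they return as the initial values
  \<open>G k 0\<close>, that is, as the boundary terms of the integrations by parts.\<close>

lemma sum_alpha_er:
  assumes "0 < n"
  shows "(\<Sum>j<n. alpha j * er k j) = (if k = 0 then 1 else 0)"
  using arg_cong[OF lagrange[OF assms], of "\<lambda>p. coeff p k"] by (simp add: coeff_sum er_def esym_def)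

lemma inverse_P:
  assumes "0 < n" "0 \<le> s"
  shows "1 / P s = (\<Sum>j<n. alpha j / (1 + a j * s))"
proof -
  have "(\<Sum>j<n. alpha j * (\<Prod>l\<in>{..<n} - {j}. 1 + a l * s)) = 1"
    using arg_cong[OF lagrange[OF assms(1)], of "\<lambda>p. poly p s"] by (simp add: poly_sum poly_esym_poly)
  moreover have "alpha j * (\<Prod>l\<in>{..<n} - {j}. 1 + a l * s) = P s * (alpha j / (1 + a j * s))"
    if "j < n" for j
    using one_plus_pos[OF that assms(2)] that by (simp add: P_def prod.remove[of _ j])
  ultimately have "P s * (\<Sum>j<n. alpha j / (1 + a j * s)) = 1"
    by (simp add: sum_distrib_left)
  thus ?thesis using P_pos[OF assms(2)] by (simp add: field_simps)
qed

lemma f_0: 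
  assumes "0 < n" "0 \<le> s"
  shows "s * f 0 s = 1 - 1 / P s"
proof -
  have "s * f 0 s = (\<Sum>j<n. alpha j * er 0 j - alpha j / (1 + a j * s))"
    unfolding f_def sum_distrib_left
  proof (intro sum.cong refl)
    fix j assume "j \<in> {..<n}"
    hence "1 + a j * s \<noteq> 0" using one_plus_pos[of j s] assms(2) by simp
    thus "s * (alpha j * er 0 j * a j / (1 + a j * s)) = alpha j * er 0 j - alpha j / (1 + a j * s)"
      by (simp add: er_0 divide_simps) (simp add: algebra_simps)
  qed
  thus ?thesis unfolding inverse_P[OF assms] by (simp add: sum_subtractf sum_alpha_er[OF assms(1)])
qed

lemma f_Suc:
  assumes "0 < n" "0 \<le> s"
  shows "s * f (Suc k) s = f k s - e (Suc k) / P s"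
proof -
  have "s * f (Suc k) s - f k s + e (Suc k) * (1 / P s) = (\<Sum>j<n. alpha j * er (Suc k) j)"
    unfolding f_def inverse_P[OF assms] sum_distrib_left sum_subtractf[symmetric] sum.distrib[symmetric]
  proof (intro sum.cong refl)
    fix j assume "j \<in> {..<n}"
    hence j: "j < n" by simp
    show "s * (alpha j * er (Suc k) j * a j / (1 + a j * s)) - alpha j * er k j * a j / (1 + a j * s) +
         e (Suc k) * (alpha j / (1 + a j * s)) = alpha j * er (Suc k) j"
      using one_plus_pos[OF j assms(2)] unfolding e_Suc[OF j]
      by (simp add: add_divide_distrib[symmetric] diff_divide_distrib[symmetric] divide_eq_eq)
         (simp add: algebra_simps)
  qed
  thus ?thesis by (simp add: sum_alpha_er[OF assms(1)])
qed

lemma DERIV_f: "0 \<le> s \<Longrightarrow> (f k has_real_derivative f' k s) (at s)"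
  unfolding f_def f'_def
  by (rule derivative_eq_intros refl | use one_plus_pos in force)+
     (auto simp: sum_negf[symmetric] power2_eq_square intro!: sum.cong)

text \<open>\<open>w = P' / P\<^sup>2\<close> is minus the derivative of \<open>1 / P\<close>.\<close>

definition w :: "real \<Rightarrow> real" where
  "w s = (\<Sum>j<n. a j / ((1 + a j * s) * P s))"

text \<open>Both sides are minus the derivative of \<open>1 / P\<close>: the left one from the
  product, the right one from its partial fractions.\<close>

lemma w_partial_fractions:
  assumes "0 < n" "0 \<le> s"
  shows "w s = (\<Sum>j<n. alpha j * a j / (1 + a j * s)\<^sup>2)"
proof -
  have D1: "(P has_real_derivative w s * (P s)\<^sup>2) (at s)"
  proof -
    have "(P has_real_derivative (\<Sum>j<n. a j * (\<Prod>l\<in>{..<n} - {j}. 1 + a l * s))) (at s)"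
      unfolding P_def
      by (rule has_field_derivative_prod[THEN DERIV_cong]) (auto intro!: derivative_eq_intros sum.cong simp: mult.commute)
    also have "(\<Sum>j<n. a j * (\<Prod>l\<in>{..<n} - {j}. 1 + a l * s)) = w s * (P s)\<^sup>2"
      unfolding w_def sum_distrib_right
    proof (intro sum.cong refl)
      fix j assume "j \<in> {..<n}"
      hence j: "j < n" by simp
      have 1: "P s = (1 + a j * s) * (\<Prod>l\<in>{..<n} - {j}. 1 + a l * s)"
        unfolding P_def using j by (subst prod.remove[of _ j]) auto
      have "a j / ((1 + a j * s) * P s) * (P s)\<^sup>2 = a j * P s / (1 + a j * s)"
        using P_pos[OF assms(2)] by (simp add: power2_eq_square)
      also have "\<dots> = a j * (\<Prod>l\<in>{..<n} - {j}. 1 + a l * s)"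
        unfolding 1 using one_plus_pos[OF j assms(2)] by simp
      finally show "a j * (\<Prod>l\<in>{..<n} - {j}. 1 + a l * s) = a j / ((1 + a j * s) * P s) * (P s)\<^sup>2" ..
    qed
    finally show ?thesis .
  qed
  have D2: "((\<lambda>s. 1 / P s) has_real_derivative - w s) (at s)"
    using P_pos[OF assms(2)] by (auto intro!: derivative_eq_intros D1 simp: power2_eq_square)
  have D3: "((\<lambda>s. \<Sum>j<n. alpha j / (1 + a j * s)) has_real_derivative
      - (\<Sum>j<n. alpha j * a j / (1 + a j * s)\<^sup>2)) (at s)"
    by (rule derivative_eq_intros refl | use one_plus_pos assms(2) in force)+
       (auto simp: sum_negf[symmetric] power2_eq_square intro!: sum.cong)
  \<comment> \<open>The expansion \<open>inverse_P\<close> is available for \<open>s \<ge> 0\<close>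
    only, hence uniqueness of the derivative within \<open>{0..}\<close>, which covers
    \<open>s = 0\<close> as well.\<close>
  have "((\<lambda>s. 1 / P s) has_real_derivative - w s) (at s within {0..})"
       "((\<lambda>s. 1 / P s) has_real_derivative - (\<Sum>j<n. alpha j * a j / (1 + a j * s)\<^sup>2)) (at s within {0..})"
    using D2 has_field_derivative_transform_within[OF DERIV_subset[OF D3, of "{0..}"], of 1]
      inverse_P[OF assms(1)] assms(2)
    by (auto intro: DERIV_subset)
  moreover have "at_right s \<le> at s within {0..}" using assms(2) by (intro at_le) auto
  hence "at s within {0..} \<noteq> bot" using trivial_limit_at_right_real[of s] by (metis bot.extremum_uniqueI)
  ultimately have "- w s = - (\<Sum>j<n. alpha j * a j / (1 + a j * s)\<^sup>2)"
    unfolding has_field_derivative_iff using tendsto_unique by blast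
  thus ?thesis by simp
qed

text \<open>This is \<open>f_Suc\<close> differentiated in \<open>s\<close>, with \<open>w\<close>
  as minus the derivative of \<open>1 / P\<close>; it is verified summand by summand through
  \<open>e_Suc\<close>.\<close>

lemma f'_rec:
  assumes "0 < n" "0 \<le> s"
  shows "f (Suc k) s + s * f' (Suc k) s = f' k s + e (Suc k) * w s"
proof -
  have "f (Suc k) s + s * f' (Suc k) s - f' k s - e (Suc k) * w s = (\<Sum>j<n. 0)"
    unfolding f_def f'_def w_partial_fractions[OF assms] sum_negf[symmetric] sum_distrib_left sum_subtractf[symmetric]
      sum.distrib[symmetric]
  proof (intro sum.cong refl)
    fix j assume "j \<in> {..<n}"
    hence j: "j < n" by simp
    have nz: "1 + a j * s \<noteq> 0" using one_plus_pos[OF j assms(2)] by simp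
    show "alpha j * er (Suc k) j * a j / (1 + a j * s) +
         s * - (alpha j * er (Suc k) j * (a j)\<^sup>2 / (1 + a j * s)\<^sup>2) -
         - (alpha j * er k j * (a j)\<^sup>2 / (1 + a j * s)\<^sup>2) -
         e (Suc k) * (alpha j * a j / (1 + a j * s)\<^sup>2) = 0"
      unfolding e_Suc[OF j] using nz
      by (simp add: divide_simps) (simp add: algebra_simps power2_eq_square)
  qed
  thus ?thesis by simp
qed

lemma f'_0_rec:
  assumes "0 < n" "0 \<le> s"
  shows "f 0 s + s * f' 0 s = w s"
proof -
  have "f 0 s + s * f' 0 s - w s = (\<Sum>j<n. 0)"
    unfolding f_def f'_def w_partial_fractions[OF assms] sum_negf[symmetric] sum_distrib_left sum_subtractf[symmetric]
      sum.distrib[symmetric]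
  proof (intro sum.cong refl)
    fix j assume "j \<in> {..<n}"
    hence nz: "1 + a j * s \<noteq> 0" using one_plus_pos[of j s] assms(2) by simp
    thus "alpha j * er 0 j * a j / (1 + a j * s) +
         s * - (alpha j * er 0 j * (a j)\<^sup>2 / (1 + a j * s)\<^sup>2) - alpha j * a j / (1 + a j * s)\<^sup>2 = 0"
      by (simp add: divide_simps er_0) (simp add: algebra_simps power2_eq_square)
  qed
  thus ?thesis by simp
qed

text \<open>Splitting \<open>e (Suc k)\<close> by \<open>e_Suc\<close> clears the factor
  \<open>1 + a j * s\<close> from the denominators of what remains, and the remainder is summed by
  \<open>esym_Suc_sum\<close>.\<close>

lemma d_rec:
  assumes "0 < n" "0 \<le> s"
  shows "s * d (Suc k) s - d k s = real (Suc (Suc k)) * e (Suc (Suc k)) / P s - e (Suc k) * w s"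
    and "s * d 0 s = e (Suc 0) / P s - w s"
proof -
  have sm: "(\<Sum>j<n. a j * er k j) = real (Suc k) * e (Suc k)" for k
    unfolding e_def er_def using esym_Suc_sum[of "{..<n}" k a] by simp
  have "s * d (Suc k) s - d k s - (\<Sum>j<n. a j * er (Suc k) j) / P s + e (Suc k) * w s = (\<Sum>j<n. 0)"
    unfolding d_def w_def sum_distrib_left sum_divide_distrib sum_subtractf[symmetric] sum.distrib[symmetric]
  proof (intro sum.cong refl)
    fix j assume "j \<in> {..<n}"
    hence j: "j < n" by simp
    have nz: "1 + a j * s \<noteq> 0" "P s \<noteq> 0" using one_plus_pos[OF j assms(2)] P_pos[OF assms(2)] by auto
    show "s * ((a j)\<^sup>2 * er (Suc k) j / ((1 + a j * s) * P s)) - (a j)\<^sup>2 * er k j / ((1 + a j * s) * P s) -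
         a j * er (Suc k) j / P s + e (Suc k) * (a j / ((1 + a j * s) * P s)) = 0"
      unfolding e_Suc[OF j] using nz
      by (simp add: divide_simps) (simp add: algebra_simps power2_eq_square)
  qed
  thus "s * d (Suc k) s - d k s = real (Suc (Suc k)) * e (Suc (Suc k)) / P s - e (Suc k) * w s"
    unfolding sm by simp
  have "s * d 0 s - (\<Sum>j<n. a j * er 0 j) / P s + w s = (\<Sum>j<n. 0)"
    unfolding d_def w_def sum_distrib_left sum_divide_distrib sum_subtractf[symmetric] sum.distrib[symmetric]
  proof (intro sum.cong refl)
    fix j assume "j \<in> {..<n}"
    hence j: "j < n" by simp
    have nz: "1 + a j * s \<noteq> 0" "P s \<noteq> 0" using one_plus_pos[OF j assms(2)] P_pos[OF assms(2)] by auto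
    thus "s * ((a j)\<^sup>2 * er 0 j / ((1 + a j * s) * P s)) - a j * er 0 j / P s + a j / ((1 + a j * s) * P s) = 0"
      by (simp add: divide_simps er_0) (simp add: algebra_simps power2_eq_square)
  qed
  thus "s * d 0 s = e (Suc 0) / P s - w s"
    unfolding sm by simp
qed

text \<open>Multiplied by \<open>s\<close>, both sides obey the same recursion in \<open>k\<close>,
  and for \<open>s > 0\<close> this determines them. The point of the identity is that its right
  side is visibly a Laplace transform.\<close>

lemma d_eq_pos:
  assumes "0 < n" "0 < s"
  shows "d k s = - (real (Suc k) * f (Suc k) s + f' k s)"
proof (induction k)
  case 0
  have "s * d 0 s = s * - (f (Suc 0) s + f' 0 s)"
    using d_rec(2)[of s] f'_0_rec[of s] f_Suc[of s 0] assms by (simp add: algebra_simps)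
  thus ?case using assms by simp
next
  case (Suc k)
  have 1: "s * (real (Suc (Suc k)) * f (Suc (Suc k)) s) =
      real (Suc (Suc k)) * (f (Suc k) s - e (Suc (Suc k)) / P s)"
    using f_Suc[of s "Suc k"] assms by (simp add: mult.left_commute)
  have "s * d (Suc k) s = s * - (real (Suc (Suc k)) * f (Suc (Suc k)) s + f' (Suc k) s)"
    using d_rec(1)[of s k] f'_rec[of s k] 1 assms Suc.IH by (simp add: algebra_simps)
  thus ?case using assms by simp
qed

text \<open>The recursion says nothing at \<open>s = 0\<close>, so the identity is extended there by
  continuity from the right.\<close>

lemma d_eq:
  assumes "0 < n" "0 \<le> s"
  shows "d k s = - (real (Suc k) * f (Suc k) s + f' k s)"
proof (cases "s = 0")
  case True
  have nz: "1 + a j * x \<noteq> 0" "P x \<noteq> 0" if "j < n" "x \<in> {0..}" for j x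
    using one_plus_pos[OF that(1), of x] P_pos[of x] that(2) by auto
  have "continuous_on {0..} (d k)" 
    unfolding d_def P_def using nz(1) nz(2)[unfolded P_def]
    by (intro continuous_intros) auto
  hence "(d k \<longlongrightarrow> d k 0) (at_right 0)"
    by (auto simp: continuous_on intro: tendsto_within_subset)
  moreover have "continuous_on {0..} (\<lambda>s. - (real (Suc k) * f (Suc k) s + f' k s))"
    unfolding f_def f'_def using nz by (intro continuous_intros) auto
  hence "((\<lambda>s. - (real (Suc k) * f (Suc k) s + f' k s)) \<longlongrightarrow> - (real (Suc k) * f (Suc k) 0 + f' k 0)) (at_right 0)"
    by (auto simp: continuous_on intro: tendsto_within_subset)
  hence "(d k \<longlongrightarrow> - (real (Suc k) * f (Suc k) 0 + f' k 0)) (at_right 0)"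
    by (rule Lim_transform_eventually)
       (use d_eq_pos[OF assms(1)] in \<open>auto simp: eventually_at_right_less eventually_at_filter\<close>)
  ultimately show ?thesis using True tendsto_unique[of "at_right (0::real)"] by auto
qed (use d_eq_pos assms in auto)

end

section \<open>Gaussian integrals\<close>

abbreviation half_normal :: "real measure" where
  "half_normal \<equiv> density lborel (\<lambda>x. ennreal (normal_density 0 (sqrt (1 / 2)) x))"

definition cgauss :: "complex measure" where
  "cgauss = distr (half_normal \<Otimes>\<^sub>M half_normal) borel (\<lambda>(p, q). Complex p q)"

lemma measurable_Complex [measurable]: "(\<lambda>(p, q). Complex p q) \<in> borel \<Otimes>\<^sub>M borel \<rightarrow>\<^sub>M borel"
proof -
  have "(\<lambda>(p, q). Complex p q) = (\<lambda>x. of_real (fst x) + \<i> * of_real (snd x))"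
    by (auto simp: complex_eq_iff)
  thus ?thesis by simp
qed

lemma prob_space_half_normal: "prob_space half_normal"
  by (rule prob_space_normal_density) simp

interpretation half_normal: prob_space half_normal by (rule prob_space_half_normal)

lemma measurable_cnj [measurable]: "cnj \<in> borel \<rightarrow>\<^sub>M borel"
  by (rule borel_measurable_continuous_onI) (rule continuous_on_cnj[OF continuous_on_id])

lemma sets_cgauss [measurable_cong, simp]: "sets cgauss = sets borel"
  and space_cgauss [simp]: "space cgauss = UNIV"
  by (simp_all add: cgauss_def)

lemma prob_space_cgauss: "prob_space cgauss"
proof -
  interpret pair_prob_space half_normal half_normal
    by (intro pair_prob_space.intro pair_sigma_finite.intro prob_space_half_normal
        prob_space_imp_sigma_finite)
  show ?thesis unfolding cgauss_def by (intro prob_space_distr) measurable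
qed

interpretation cgauss: prob_space cgauss by (rule prob_space_cgauss)

interpretation cgauss_product: product_sigma_finite "\<lambda>_. cgauss" ..

lemma prob_space_PiM_cgauss: "prob_space (PiM I (\<lambda>_. cgauss))"
  by (intro prob_space_PiM prob_space_cgauss)

text \<open>Completing the square leaves a multiple of the normal density with mean
  \<open>- b / (1 + a)\<close> and variance \<open>1 / (2 * (1 + a))\<close>. Negative
  \<open>a\<close> is included because \<open>a = - 1 / 2\<close> later bounds all moments.\<close>

lemma nn_integral_half_normal_exp:
  assumes "- 1 < a"
  shows "(\<integral>\<^sup>+x. ennreal (exp (- a * x\<^sup>2 - 2 * x * b)) \<partial>half_normal) = ennreal (exp (b\<^sup>2 / (1 + a)) / sqrt (1 + a))"
proof -
  define c where "c = exp (b\<^sup>2 / (1 + a)) / sqrt (1 + a)"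
  have a: "0 < 1 + a" and c: "0 \<le> c" using assms by (auto simp: c_def)
  have "normal_density 0 (sqrt (1 / 2)) x * exp (- a * x\<^sup>2 - 2 * x * b) =
      c * normal_density (- b / (1 + a)) (sqrt (1 / (2 * (1 + a)))) x" for x
  proof -
    have "(x + b / A)\<^sup>2 * A = x\<^sup>2 * A + 2 * x * b + b\<^sup>2 / A" if "0 < A" for A
      using that by (simp add: power2_eq_square field_simps)
    from this[OF a] have "- (x + b / (1 + a))\<^sup>2 * (1 + a) + b\<^sup>2 / (1 + a) = - x\<^sup>2 + (- a * x\<^sup>2 - 2 * x * b)"
      by (simp add: algebra_simps)
    hence "exp (- (x\<^sup>2)) * exp (- a * x\<^sup>2 - 2 * x * b) = exp (b\<^sup>2 / (1 + a)) * exp (- (x + b / (1 + a))\<^sup>2 * (1 + a))"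
      by (simp add: exp_add[symmetric] add.commute)
    moreover have "normal_density 0 (sqrt (1 / 2)) x = exp (- (x\<^sup>2)) / sqrt pi"
      by (simp add: normal_density_def)
    moreover have "normal_density (- b / A) (sqrt (1 / (2 * A))) x = sqrt A * exp (- (x + b / A)\<^sup>2 * A) / sqrt pi"
      if "0 < A" for A
    proof -
      have "(sqrt (1 / (2 * A)))\<^sup>2 = 1 / (2 * A)" using that by (intro real_sqrt_pow2) simp
      thus ?thesis using that unfolding normal_density_def
        by (simp only:) (simp add: real_sqrt_divide)
    qed
    from this[OF a] have "c * normal_density (- b / (1 + a)) (sqrt (1 / (2 * (1 + a)))) x =
        exp (b\<^sup>2 / (1 + a)) * exp (- (x + b / (1 + a))\<^sup>2 * (1 + a)) / sqrt pi"
      using a by (simp add: c_def)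
    ultimately show ?thesis by (metis times_divide_eq_left)
  qed
  hence "(\<integral>\<^sup>+x. ennreal (exp (- a * x\<^sup>2 - 2 * x * b)) \<partial>half_normal) =
      (\<integral>\<^sup>+x. ennreal c * ennreal (normal_density (- b / (1 + a)) (sqrt (1 / (2 * (1 + a)))) x) \<partial>lborel)"
    using c by (subst nn_integral_density) (auto simp: ennreal_mult'[symmetric])
  also have "\<dots> = ennreal c"
    using a by (subst nn_integral_cmult) (auto simp: nn_integral_eq_integral)
  finally show ?thesis by (simp add: c_def)
qed

lemma nn_integral_cgauss_exp:
  assumes "- 1 < a"
  shows "(\<integral>\<^sup>+z. ennreal (exp (- a * (cmod z)\<^sup>2 - 2 * Re (cnj z * \<beta>))) \<partial>cgauss) =
     ennreal (exp ((cmod \<beta>)\<^sup>2 / (1 + a)) / (1 + a))"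
proof -
  interpret pair_prob_space half_normal half_normal
    by (intro pair_prob_space.intro pair_sigma_finite.intro prob_space_half_normal
        prob_space_imp_sigma_finite)
  have a: "0 < 1 + a" using assms by simp
  have "(\<integral>\<^sup>+z. ennreal (exp (- a * (cmod z)\<^sup>2 - 2 * Re (cnj z * \<beta>))) \<partial>cgauss) =
     (\<integral>\<^sup>+p. \<integral>\<^sup>+q. ennreal (exp (- a * p\<^sup>2 - 2 * p * Re \<beta>)) * ennreal (exp (- a * q\<^sup>2 - 2 * q * Im \<beta>))
        \<partial>half_normal \<partial>half_normal)"
    unfolding cgauss_def
    by (subst nn_integral_distr, measurable, subst half_normal.nn_integral_fst[symmetric], measurable)
       (simp add: cmod_power2 ennreal_mult'[symmetric] exp_add[symmetric] algebra_simps)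
  also have "\<dots> = ennreal (exp ((Re \<beta>)\<^sup>2 / (1 + a)) / sqrt (1 + a)) * ennreal (exp ((Im \<beta>)\<^sup>2 / (1 + a)) / sqrt (1 + a))"
    by (subst nn_integral_cmult, measurable, subst nn_integral_multc, measurable)
       (simp only: nn_integral_half_normal_exp[OF assms])
  also have "\<dots> = ennreal (exp ((cmod \<beta>)\<^sup>2 / (1 + a)) / (1 + a))"
    using a by (subst ennreal_mult'[symmetric]) (auto simp: cmod_power2 add_divide_distrib exp_add)
  finally show ?thesis .
qed

text \<open>Products of integrable functions need not be integrable, but finiteness of all absolute
  moments is inherited by sums and products. Hence every polynomial in the Gaussian entries and
  their conjugates, in particular a determinant, is integrable without an estimate.\<close>

definition moments :: "'b measure \<Rightarrow> ('b \<Rightarrow> complex) \<Rightarrow> bool" where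
  "moments M f \<longleftrightarrow> f \<in> borel_measurable M \<and> (\<forall>k. integrable M (\<lambda>x. norm (f x) ^ k))"

lemma moments_measurable [measurable_dest]: "moments M f \<Longrightarrow> f \<in> borel_measurable M"
  by (simp add: moments_def)

lemma moments_integrable: "moments M f \<Longrightarrow> integrable M f"
  unfolding moments_def
  by (auto dest!: spec[of _ 1] simp: integrable_norm_iff)

lemma (in finite_measure) moments_const: "moments M (\<lambda>_. c)"
  by (simp add: moments_def)

lemma moments_cnj: "moments M f \<Longrightarrow> moments M (\<lambda>x. cnj (f x))"
  unfolding moments_def by (auto intro: measurable_compose[OF _ measurable_cnj])

lemma moments_mult:
  assumes "moments M f" "moments M g"
  shows "moments M (\<lambda>x. f x * g x)"
proof -
  note [measurable] = assms[THEN moments_measurable]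
  have "integrable M (\<lambda>x. norm (f x * g x) ^ k)" for k
  proof (rule Bochner_Integration.integrable_bound)
    show "integrable M (\<lambda>x. norm (f x) ^ (2 * k) + norm (g x) ^ (2 * k))"
      using assms unfolding moments_def by auto
    have "norm (f x * g x) ^ k \<le> norm (f x) ^ (2 * k) + norm (g x) ^ (2 * k)" for x
    proof -
      have "p * q \<le> p\<^sup>2 + q\<^sup>2" if "0 \<le> p" "0 \<le> q" for p q :: real
        using sum_squares_bound[of p q] mult_nonneg_nonneg[OF that] by linarith
      from this[of "norm (f x) ^ k" "norm (g x) ^ k"] show ?thesis
        by (simp add: norm_mult power_mult_distrib power_mult[symmetric] mult.commute)
    qed
    thus "AE x in M. norm (norm (f x * g x) ^ k) \<le> norm (norm (f x) ^ (2 * k) + norm (g x) ^ (2 * k))"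
      by (intro AE_I2) simp
  qed measurable
  thus ?thesis unfolding moments_def by auto
qed

lemma moments_add:
  assumes "moments M f" "moments M g"
  shows "moments M (\<lambda>x. f x + g x)"
proof -
  note [measurable] = assms[THEN moments_measurable]
  have "integrable M (\<lambda>x. norm (f x + g x) ^ k)" for k
  proof (rule Bochner_Integration.integrable_bound)
    show "integrable M (\<lambda>x. 2 ^ k * (norm (f x) ^ k + norm (g x) ^ k))"
      using assms unfolding moments_def by auto
    have "norm (f x + g x) ^ k \<le> 2 ^ k * (norm (f x) ^ k + norm (g x) ^ k)" for x
    proof -
      have "norm (f x + g x) ^ k \<le> (2 * max (norm (f x)) (norm (g x))) ^ k"
        using norm_triangle_ineq[of "f x" "g x"] by (intro power_mono) auto
      also have "\<dots> \<le> 2 ^ k * (norm (f x) ^ k + norm (g x) ^ k)"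
        by (auto simp: power_mult_distrib max_def)
      finally show ?thesis .
    qed
    thus "AE x in M. norm (norm (f x + g x) ^ k) \<le> norm (2 ^ k * (norm (f x) ^ k + norm (g x) ^ k))"
      by (intro AE_I2) simp
  qed measurable
  thus ?thesis unfolding moments_def by auto
qed

lemma (in finite_measure) moments_sum:
  "(\<And>i. i \<in> A \<Longrightarrow> moments M (f i)) \<Longrightarrow> moments M (\<lambda>x. \<Sum>i\<in>A. f i x)"
proof (induction A rule: infinite_finite_induct)
  case (insert i A)
  thus ?case by (simp add: moments_add)
qed (simp_all add: moments_const)

lemma (in finite_measure) moments_prod:
  "(\<And>i. i \<in> A \<Longrightarrow> moments M (f i)) \<Longrightarrow> moments M (\<lambda>x. \<Prod>i\<in>A. f i x)"
proof (induction A rule: infinite_finite_induct)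
  case (insert i A)
  thus ?case by (simp add: moments_mult)
qed (simp_all add: moments_const)

lemma (in finite_measure) moments_detf:
  assumes "\<And>i j. i < n \<Longrightarrow> j < n \<Longrightarrow> moments M (\<lambda>x. A x i j)"
  shows "moments M (\<lambda>x. detf n (A x))"
  unfolding detf_leibniz
proof (intro moments_sum moments_mult moments_const moments_prod)
  fix p i assume "p \<in> {p. p permutes {0..<n}}" "i \<in> {0..<n}"
  thus "moments M (\<lambda>x. A x i (p i))" using permutes_in_image[of p "{0..<n}" i] by (intro assms) auto
qed

lemma moments_bounded_mult_integrable:
  assumes "moments M f" "g \<in> borel_measurable M" "\<And>x. norm (g x) \<le> 1"
  shows "integrable M (\<lambda>x. g x * f x :: complex)"
proof (rule Bochner_Integration.integrable_bound)
  show "integrable M f" by (rule moments_integrable[OF assms(1)])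
  show "AE x in M. norm (g x * f x) \<le> norm (f x)"
    using assms(3) by (intro AE_I2) (auto simp: norm_mult intro: mult_left_le_one_le)
qed (use assms in \<open>auto simp: moments_def\<close>)

lemma moments_cgauss: "moments cgauss (\<lambda>z. z)"
  unfolding moments_def
proof (intro conjI allI)
  fix k
  have e: "integrable cgauss (\<lambda>z. exp ((cmod z)\<^sup>2 / 2))"
  proof (rule integrableI_nonneg)
    show "(\<integral>\<^sup>+z. ennreal (exp ((cmod z)\<^sup>2 / 2)) \<partial>cgauss) < \<infinity>"
      using nn_integral_cgauss_exp[of "- 1 / 2" 0] by simp
  qed auto
  show "integrable cgauss (\<lambda>z. cmod z ^ k)"
  proof (rule Bochner_Integration.integrable_bound)
    show "integrable cgauss (\<lambda>z. fact k * exp (1 / 2) * exp ((cmod z)\<^sup>2 / 2))"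
      using e by simp
    \<comment> \<open>A single term of the exponential series bounds \<open>|z|^k\<close> by
      \<open>k! * exp |z|\<close>, and \<open>2 * |z| \<le> 1 + |z|^2\<close> reduces this to the
      integrable function above.\<close>
    have "cmod z ^ k \<le> fact k * exp (1 / 2) * exp ((cmod z)\<^sup>2 / 2)" for z
    proof -
      have "(\<Sum>i\<in>{k}. cmod z ^ i /\<^sub>R fact i) \<le> exp (cmod z)"
        unfolding exp_def by (intro sum_le_suminf summable_exp_generic) auto
      hence "cmod z ^ k \<le> fact k * exp (cmod z)" by (simp add: field_simps)
      also have "cmod z \<le> 1 / 2 + (cmod z)\<^sup>2 / 2"
        using zero_le_power2[of "cmod z - 1"] by (simp add: power2_eq_square algebra_simps)
      hence "fact k * exp (cmod z) \<le> fact k * exp (1 / 2 + (cmod z)\<^sup>2 / 2)" by simp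
      finally show ?thesis by (simp add: exp_add)
    qed
    thus "AE z in cgauss. norm (cmod z ^ k) \<le> norm (fact k * exp (1 / 2) * exp ((cmod z)\<^sup>2 / 2))"
      by (intro AE_I2) simp
  qed auto
qed simp

lemma moments_PiM_cgauss:
  assumes "i \<in> I"
  shows "moments (PiM I (\<lambda>_. cgauss)) (\<lambda>z. z i)"
proof -
  have [measurable]: "(\<lambda>z. z i) \<in> PiM I (\<lambda>_. cgauss) \<rightarrow>\<^sub>M cgauss"
    by (rule measurable_component_singleton[OF assms])
  have d: "distr (PiM I (\<lambda>_. cgauss)) cgauss (\<lambda>z. z i) = cgauss"
    by (rule distr_PiM_component[OF prob_space_cgauss assms])
  have "integrable (PiM I (\<lambda>_. cgauss)) (\<lambda>z. norm (z i) ^ k)" for k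
    using moments_cgauss unfolding moments_def
    by (subst integrable_distr_eq[of "\<lambda>z. z i" _ cgauss "\<lambda>z. norm z ^ k", symmetric]) (auto simp: d)
  moreover have "(\<lambda>z. z i) \<in> borel_measurable (PiM I (\<lambda>_. cgauss))"
    using measurable_component_singleton[OF assms, of "\<lambda>_. cgauss"] by (simp cong: measurable_cong_sets)
  ultimately show ?thesis unfolding moments_def by blast
qed

section \<open>Gaussian integrals of Hermitian forms\<close>

definition qform :: "nat \<Rightarrow> (nat \<Rightarrow> nat \<Rightarrow> complex) \<Rightarrow> (nat \<Rightarrow> complex) \<Rightarrow> real" where
  "qform n Q z = Re (\<Sum>a<n. \<Sum>b<n. cnj (z a) * Q a b * z b)"

lemma measurable_qform [measurable]: "qform n Q \<in> borel_measurable (PiM {..<n} (\<lambda>_. cgauss))"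
proof -
  have [measurable]: "(\<lambda>z. z a) \<in> borel_measurable (PiM {..<n} (\<lambda>_. cgauss))" if "a \<in> {..<n}" for a
    by (rule moments_measurable[OF moments_PiM_cgauss[OF that]])
  show ?thesis unfolding qform_def by measurable
qed

text \<open>Hermitian symmetry merges the two cross terms into twice one real part, the shape in
  which \<open>nn_integral_cgauss_exp\<close> integrates out the last variable.\<close>

lemma qform_Suc:
  assumes "\<And>a b. Q b a = cnj (Q a b)"
  shows "qform (Suc n) Q (z(n := y)) =
    qform n Q z + Re (Q n n) * (cmod y)\<^sup>2 + 2 * Re (cnj y * (\<Sum>b<n. Q n b * z b))"
proof -
  have "Im (Q n n) = 0" using assms[of n n] by (metis complex_cnj_cancel_iff Reals_cnj_iff complex_is_Real_iff)
  hence 1: "Re (cnj y * Q n n * y) = Re (Q n n) * (cmod y)\<^sup>2"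
    unfolding cmod_power2 by (simp add: power2_eq_square algebra_simps)
  have 2: "Re (\<Sum>b<n. cnj y * Q n b * z b) = Re (cnj y * (\<Sum>b<n. Q n b * z b))"
    by (simp add: sum_distrib_left mult.assoc)
  have "(\<Sum>a<n. cnj (z a) * Q a n * y) = cnj (cnj y * (\<Sum>b<n. Q n b * z b))"
    unfolding assms[of _ n] by (simp add: sum_distrib_left mult_ac)
  hence 3: "Re (\<Sum>a<n. cnj (z a) * Q a n * y) = Re (cnj y * (\<Sum>b<n. Q n b * z b))"
    by (metis complex_cnj(1) cnj.simps(1))
  have "(\<Sum>a<Suc n. \<Sum>b<Suc n. cnj ((z(n := y)) a) * Q a b * (z(n := y)) b) =
     (\<Sum>a<n. \<Sum>b<n. cnj (z a) * Q a b * z b) + (\<Sum>a<n. cnj (z a) * Q a n * y) +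
     (\<Sum>b<n. cnj y * Q n b * z b) + cnj y * Q n n * y"
    by (simp add: sum.distrib)
  thus ?thesis unfolding qform_def using 1 2 3 by simp
qed

text \<open>Induction on the dimension: integrating out the last variable completes a square, which
  replaces the form by its Schur complement.\<close>

lemma gaussian_integral:
  assumes herm: "\<And>a b. Q b a = cnj (Q a b)"
    and psd: "\<And>z. 0 \<le> qform n Q z"
  shows "\<exists>D>0. detf n (\<lambda>a b. (if a = b then 1 else 0) + Q a b) = complex_of_real D \<and>
    (\<integral>\<^sup>+z. ennreal (exp (- qform n Q z)) \<partial>PiM {..<n} (\<lambda>_. cgauss)) = ennreal (1 / D)"
  using assms
proof (induction n arbitrary: Q)
  case 0
  have "detf 0 A = 1" for A :: "nat \<Rightarrow> nat \<Rightarrow> complex" by (simp add: detf_def)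
  thus ?case by (intro exI[of _ 1]) (simp add: qform_def PiM_empty nn_integral_count_space_finite)
next
  case (Suc n)
  define q where "q = Re (Q n n)"
  define \<beta> where "\<beta> z = (\<Sum>b<n. Q n b * z b)" for z
  \<comment> \<open>\<open>1 + Q'\<close> is the Schur complement of \<open>1 + Q\<close> at the
    last diagonal entry \<open>1 + q\<close>.\<close>
  define Q' where "Q' a b = Q a b - Q a n * Q n b / (1 + q)" for a b
  have "Im (Q n n) = 0" using Suc.prems(1)[of n n]
    by (metis Reals_cnj_iff complex_is_Real_iff)
  hence q: "Q n n = complex_of_real q" by (simp add: q_def complex_eq_iff)
  have q0: "0 \<le> q"
    using Suc.prems(2)[of "(\<lambda>_. 0)(n := 1)"] by (subst (asm) qform_Suc[OF Suc.prems(1)]) (simp add: q_def qform_def)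
  have herm': "Q' b a = cnj (Q' a b)" for a b
    unfolding Q'_def by (simp add: Suc.prems(1)[of a b] Suc.prems(1)[of n b] Suc.prems(1)[of a n])
  have Q': "qform n Q' z = qform n Q z - (cmod (\<beta> z))\<^sup>2 / (1 + q)" for z
  proof -
    have "(\<Sum>a<n. \<Sum>b<n. cnj (z a) * Q' a b * z b) =
      (\<Sum>a<n. \<Sum>b<n. cnj (z a) * Q a b * z b) - (\<Sum>a<n. cnj (z a) * Q a n) * \<beta> z / (1 + q)"
      unfolding Q'_def \<beta>_def sum_product
      by (simp add: algebra_simps sum_subtractf sum_divide_distrib)
    also have "(\<Sum>a<n. cnj (z a) * Q a n) = cnj (\<beta> z)"
      unfolding \<beta>_def by (subst Suc.prems(1)[of n]) (simp add: mult.commute)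
    also have "cnj (\<beta> z) * \<beta> z / (1 + q) = complex_of_real ((cmod (\<beta> z))\<^sup>2 / (1 + q))"
      using complex_norm_square[of "\<beta> z"] by (simp add: mult.commute)
    finally show ?thesis by (simp add: qform_def)
  qed
  have psd': "0 \<le> qform n Q' z" for z
  proof -
    define B where "B = (cmod (\<beta> z))\<^sup>2"
    \<comment> \<open>This last coordinate minimises the form plus its own squared modulus. Because
      of the added square it exists for \<open>q = 0\<close> too.\<close>
    have "0 \<le> qform (Suc n) Q (z(n := - \<beta> z / (1 + q)))" by (rule Suc.prems(2))
    also have "\<dots> = qform n Q z + q * (B / (1 + q)\<^sup>2) + 2 * Re (cnj (- \<beta> z / (1 + q)) * \<beta> z)"
      using q0 unfolding qform_Suc[OF Suc.prems(1)]
      by (simp add: q_def[symmetric] \<beta>_def[symmetric] norm_divide power_divide B_def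
          norm_of_real[of "1 + q", simplified])
    also have "cnj (- \<beta> z / (1 + q)) * \<beta> z = complex_of_real (- (B / (1 + q)))"
      using complex_norm_square[of "\<beta> z"] by (simp add: mult.commute B_def)
    finally have "0 \<le> qform n Q z + q * (B / (1 + q)\<^sup>2) - 2 * (B / (1 + q))" by simp
    moreover have "q / (1 + q) * (B / (1 + q)) \<le> B / (1 + q)"
      using q0 by (intro mult_left_le_one_le) (auto simp: B_def)
    hence "q * (B / (1 + q)\<^sup>2) \<le> B / (1 + q)" by (simp add: power2_eq_square)
    ultimately show ?thesis unfolding Q' B_def[symmetric] by simp
  qed
  obtain D where D: "0 < D" "detf n (\<lambda>a b. (if a = b then 1 else 0) + Q' a b) = complex_of_real D"
    "(\<integral>\<^sup>+z. ennreal (exp (- qform n Q' z)) \<partial>PiM {..<n} (\<lambda>_. cgauss)) = ennreal (1 / D)"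
    using Suc.IH[of Q', OF herm' psd'] by blast
  have nz: "1 + complex_of_real q \<noteq> 0" using q0 by (simp add: complex_eq_iff)
  have "detf (Suc n) (\<lambda>a b. (if a = b then 1 else 0) + Q a b) = (1 + q) * complex_of_real D"
    using nz by (subst detf_Suc_schur) (auto simp: q D(2)[symmetric] Q'_def intro!: detf_cong)
  moreover have "(\<integral>\<^sup>+z. ennreal (exp (- qform (Suc n) Q z)) \<partial>PiM {..<Suc n} (\<lambda>_. cgauss)) = ennreal (1 / ((1 + q) * D))"
  proof -
    have "(\<integral>\<^sup>+z. ennreal (exp (- qform (Suc n) Q z)) \<partial>PiM {..<Suc n} (\<lambda>_. cgauss)) =
      (\<integral>\<^sup>+z. \<integral>\<^sup>+y. ennreal (exp (- qform (Suc n) Q (z(n := y)))) \<partial>cgauss \<partial>PiM {..<n} (\<lambda>_. cgauss))"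
      unfolding lessThan_Suc by (subst cgauss_product.product_nn_integral_insert) (auto simp: lessThan_Suc[symmetric])
    also have "\<dots> = (\<integral>\<^sup>+z. ennreal (1 / (1 + q)) * ennreal (exp (- qform n Q' z)) \<partial>PiM {..<n} (\<lambda>_. cgauss))"
    proof (rule nn_integral_cong)
      fix z
      have "(\<integral>\<^sup>+y. ennreal (exp (- qform (Suc n) Q (z(n := y)))) \<partial>cgauss) =
        (\<integral>\<^sup>+y. ennreal (exp (- qform n Q z)) * ennreal (exp (- q * (cmod y)\<^sup>2 - 2 * Re (cnj y * \<beta> z))) \<partial>cgauss)"
      proof (rule nn_integral_cong)
        fix y
        have "- (x + q * c + 2 * r) = - x + (- q * c - 2 * r)" for x c r by simp
        thus "ennreal (exp (- qform (Suc n) Q (z(n := y)))) =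
          ennreal (exp (- qform n Q z)) * ennreal (exp (- q * (cmod y)\<^sup>2 - 2 * Re (cnj y * \<beta> z)))"
          unfolding qform_Suc[OF Suc.prems(1)] q_def[symmetric] \<beta>_def[symmetric]
          by (simp only: exp_add ennreal_mult' exp_ge_zero)
      qed
      also have "\<dots> = ennreal (exp (- qform n Q z)) * ennreal (exp ((cmod (\<beta> z))\<^sup>2 / (1 + q)) / (1 + q))"
        using q0 by (subst nn_integral_cmult, simp, subst nn_integral_cgauss_exp) auto
      also have "\<dots> = ennreal (1 / (1 + q)) * ennreal (exp (- qform n Q' z))"
      proof -
        have "exp (- (x - t)) = exp (- x) * exp t" for x t :: real by (simp add: exp_add[symmetric])
        thus ?thesis using q0 by (simp only: Q') (simp add: ennreal_mult'[symmetric])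
      qed
      finally show "(\<integral>\<^sup>+y. ennreal (exp (- qform (Suc n) Q (z(n := y)))) \<partial>cgauss) =
        ennreal (1 / (1 + q)) * ennreal (exp (- qform n Q' z))" .
    qed
    also have "\<dots> = ennreal (1 / ((1 + q) * D))"
      using D q0 by (subst nn_integral_cmult) (auto simp: ennreal_mult'[symmetric])
    finally show ?thesis .
  qed
  ultimately show ?case using D(1) q0 by (intro exI[of _ "(1 + q) * D"]) auto
qed

lemma gaussian_expectation:
  assumes "\<And>a b. Q b a = cnj (Q a b)" "\<And>z. 0 \<le> qform n Q z"
    and "detf n (\<lambda>a b. (if a = b then 1 else 0) + Q a b) = complex_of_real D"
  shows "0 < D" "integrable (PiM {..<n} (\<lambda>_. cgauss)) (\<lambda>z. exp (- qform n Q z))"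
    "(LINT z|PiM {..<n} (\<lambda>_. cgauss). exp (- qform n Q z)) = 1 / D"
proof -
  from gaussian_integral[of Q n, OF assms(1,2)] assms(3)
  have D: "0 < D" "(\<integral>\<^sup>+z. ennreal (exp (- qform n Q z)) \<partial>PiM {..<n} (\<lambda>_. cgauss)) = ennreal (1 / D)"
    by auto
  show "0 < D" by fact
  have "has_bochner_integral (PiM {..<n} (\<lambda>_. cgauss)) (\<lambda>z. exp (- qform n Q z)) (1 / D)"
    using D by (intro has_bochner_integral_nn_integral) auto
  thus "integrable (PiM {..<n} (\<lambda>_. cgauss)) (\<lambda>z. exp (- qform n Q z))"
    "(LINT z|PiM {..<n} (\<lambda>_. cgauss). exp (- qform n Q z)) = 1 / D"
    by (auto simp: has_bochner_integral_iff)
qed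

lemma qform_add_rank_one:
  "qform n (\<lambda>a b. Q a b + of_real e * (cnj (l a) * l b)) z = qform n Q z + e * (cmod (\<Sum>a<n. l a * z a))\<^sup>2"
proof -
  have "(\<Sum>a<n. \<Sum>b<n. cnj (z a) * (Q a b + of_real e * (cnj (l a) * l b)) * z b) =
    (\<Sum>a<n. \<Sum>b<n. cnj (z a) * Q a b * z b) + of_real e * (cnj (\<Sum>a<n. l a * z a) * (\<Sum>a<n. l a * z a))"
    unfolding cnj_sum sum_product by (simp add: sum.distrib algebra_simps sum_distrib_left)
  also have "cnj (\<Sum>a<n. l a * z a) * (\<Sum>a<n. l a * z a) = complex_of_real ((cmod (\<Sum>a<n. l a * z a))\<^sup>2)"
    using complex_norm_square[of "\<Sum>a<n. l a * z a"] by (simp add: mult.commute)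
  finally show ?thesis by (simp add: qform_def)
qed

lemma measurable_component_cgauss: "a \<in> A \<Longrightarrow> (\<lambda>z. z a) \<in> borel_measurable (PiM A (\<lambda>_. cgauss))"
  by (rule moments_measurable[OF moments_PiM_cgauss])

text \<open>Derivative of \<open>gaussian_integral\<close> in the direction of a rank one perturbation.\<close>

lemma gaussian_second_moment:
  assumes herm: "\<And>a b. Q b a = cnj (Q a b)" and psd: "\<And>z. 0 \<le> qform n Q z"
    and det: "\<And>e. 0 \<le> e \<Longrightarrow> detf n (\<lambda>a b. (if a = b then 1 else 0) + (Q a b + of_real e * (cnj (l a) * l b))) =
      complex_of_real (D0 + e * D1)"
  shows "(LINT z|PiM {..<n} (\<lambda>_. cgauss). (cmod (\<Sum>a<n. l a * z a))\<^sup>2 * exp (- qform n Q z)) = D1 / D0\<^sup>2"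
proof -
  let ?M = "PiM {..<n} (\<lambda>_. cgauss)"
  interpret prob_space ?M by (rule prob_space_PiM_cgauss)
  note [measurable] = measurable_component_cgauss
  define X where "X z = (cmod (\<Sum>a<n. l a * z a))\<^sup>2" for z
  define eps where "eps m = 1 / real (Suc m)" for m
  have eps: "0 < eps m" for m by (simp add: eps_def)
  have eps_lim: "eps \<longlonglongrightarrow> 0" unfolding eps_def by (rule LIMSEQ_Suc[OF lim_1_over_n])
  define Qe where "Qe e = (\<lambda>a b. Q a b + of_real e * (cnj (l a) * l b))" for e
  have Qe: "qform n (Qe e) z = qform n Q z + e * X z" for e z
    unfolding Qe_def X_def by (rule qform_add_rank_one)
  have ex: "0 < D0 + e * D1" "integrable ?M (\<lambda>z. exp (- qform n (Qe e) z))"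
    "(LINT z|?M. exp (- qform n (Qe e) z)) = 1 / (D0 + e * D1)" if "0 \<le> e" for e
  proof -
    have h: "Qe e b a = cnj (Qe e a b)" for a b
      unfolding Qe_def using herm[of a b] by (simp add: mult.commute)
    have p: "0 \<le> qform n (Qe e) z" for z
      using psd[of z] that by (simp add: Qe X_def)
    have "detf n (\<lambda>a b. (if a = b then 1 else 0) + Qe e a b) = complex_of_real (D0 + e * D1)"
      unfolding Qe_def by (rule det[OF that])
    note g = gaussian_expectation[of "Qe e" n "D0 + e * D1", OF h p this]
    show "0 < D0 + e * D1" "integrable ?M (\<lambda>z. exp (- qform n (Qe e) z))"
      "(LINT z|?M. exp (- qform n (Qe e) z)) = 1 / (D0 + e * D1)"
      using g by auto
  qed
  have Q0: "Qe 0 = Q" by (simp add: Qe_def)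
  have [measurable]: "X \<in> borel_measurable ?M" unfolding X_def by measurable
  have X_int: "integrable ?M X"
  proof -
    have "moments ?M (\<lambda>z. \<Sum>a<n. l a * z a)"
      by (intro moments_sum moments_mult moments_const moments_PiM_cgauss) auto
    thus ?thesis unfolding moments_def X_def by auto
  qed
  \<comment> \<open>The difference quotients of the weight are dominated by \<open>X\<close>,
    because \<open>1 - exp (- t) \<le> t\<close> and the form is nonnegative.\<close>
  have lim1: "(\<lambda>m. LINT z|?M. (exp (- qform n (Qe 0) z) - exp (- qform n (Qe (eps m)) z)) / eps m)
     \<longlonglongrightarrow> (LINT z|?M. X z * exp (- qform n Q z))"
  proof (rule integral_dominated_convergence[where w = X])
    show "integrable ?M X" by (rule X_int)
    show "AE z in ?M. (\<lambda>m. (exp (- qform n (Qe 0) z) - exp (- qform n (Qe (eps m)) z)) / eps m)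
        \<longlonglongrightarrow> X z * exp (- qform n Q z)"
    proof (rule AE_I2)
      fix z
      have "((\<lambda>e. exp (- qform n (Qe e) z)) has_real_derivative - (X z * exp (- qform n Q z))) (at 0)"
        unfolding Qe by (auto intro!: derivative_eq_intros)
      hence "((\<lambda>e. (exp (- qform n (Qe e) z) - exp (- qform n (Qe 0) z)) / e) \<longlongrightarrow>
          - (X z * exp (- qform n Q z))) (at 0)"
        by (simp add: DERIV_def)
      moreover have "\<forall>m. eps m \<in> UNIV - {0}" using eps by (simp add: less_imp_neq[symmetric])
      ultimately have "((\<lambda>e. (exp (- qform n (Qe e) z) - exp (- qform n (Qe 0) z)) / e) \<circ> eps) \<longlonglongrightarrow>
          - (X z * exp (- qform n Q z))"
        using eps_lim unfolding tendsto_at_iff_sequentially by blast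
      hence "(\<lambda>m. (exp (- qform n (Qe (eps m)) z) - exp (- qform n (Qe 0) z)) / eps m) \<longlonglongrightarrow>
          - (X z * exp (- qform n Q z))" by (simp add: o_def)
      from tendsto_minus[OF this] show "(\<lambda>m. (exp (- qform n (Qe 0) z) - exp (- qform n (Qe (eps m)) z)) / eps m)
        \<longlonglongrightarrow> X z * exp (- qform n Q z)"
        by (simp add: minus_divide_left)
    qed
    show "AE z in ?M. norm ((exp (- qform n (Qe 0) z) - exp (- qform n (Qe (eps m)) z)) / eps m) \<le> X z" for m
    proof (rule AE_I2)
      fix z
      have X0: "0 \<le> X z" by (simp add: X_def)
      have "1 - exp (- (eps m * X z)) \<le> eps m * X z"
        using exp_ge_add_one_self[of "- (eps m * X z)"] by simp
      moreover have "0 \<le> 1 - exp (- (eps m * X z))" using X0 eps[of m] by simp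
      moreover have "exp (- qform n Q z) \<le> 1" using psd[of z] by simp
      ultimately have "exp (- qform n Q z) * (1 - exp (- (eps m * X z))) \<le> 1 * (eps m * X z)"
        by (intro mult_mono) auto
      moreover have "exp (- qform n (Qe 0) z) - exp (- qform n (Qe (eps m)) z) =
          exp (- qform n Q z) * (1 - exp (- (eps m * X z)))"
        unfolding Qe by (simp add: algebra_simps exp_add[symmetric])
      ultimately show "norm ((exp (- qform n (Qe 0) z) - exp (- qform n (Qe (eps m)) z)) / eps m) \<le> X z"
        using \<open>0 \<le> 1 - exp (- (eps m * X z))\<close> eps[of m]
        by (simp only:) (simp add: abs_mult pos_divide_le_eq mult.commute del: diff_ge_0_iff_ge one_le_exp_iff)
    qed
  qed measurable
  \<comment> \<open>The same quotients in closed form: each integral is the reciprocal of a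
    determinant that is affine in the perturbation.\<close>
  have "(LINT z|?M. (exp (- qform n (Qe 0) z) - exp (- qform n (Qe (eps m)) z)) / eps m) = D1 / (D0 * (D0 + eps m * D1))" for m
  proof -
    have "(LINT z|?M. (exp (- qform n (Qe 0) z) - exp (- qform n (Qe (eps m)) z)) / eps m) =
       (1 / D0 - 1 / (D0 + eps m * D1)) / eps m"
      using ex[of 0] ex[of "eps m"] eps[of m] by simp
    thus ?thesis using ex(1)[of 0] ex(1)[of "eps m"] eps[of m] by (simp add: divide_simps) 
  qed
  moreover have "(\<lambda>m. D1 / (D0 * (D0 + eps m * D1))) \<longlonglongrightarrow> D1 / (D0 * (D0 + 0 * D1))"
    using ex(1)[of 0] by (intro tendsto_intros eps_lim) auto
  ultimately show ?thesis
    using LIMSEQ_unique[OF lim1] by (simp add: X_def power2_eq_square)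
qed

text \<open>Polarisation: testing with the sum of the unit vector at \<open>a\<close> and
  \<open>s\<close> times the one at \<open>b\<close>, for \<open>s\<close> among 0, 1, -1 and the
  imaginary unit, isolates the entry.\<close>

lemma hermitian_form_eq_0:
  fixes X :: "nat \<Rightarrow> nat \<Rightarrow> complex"
  assumes "\<And>l. (\<Sum>a<n. \<Sum>b<n. cnj (l a) * l b * X a b) = 0" "a < n" "b < n"
  shows "X a b = 0"
proof -
  define L where "L s a' = (if a' = a then 1 else 0) + (if a' = b then s else 0)" for s :: complex and a'
  have *: "(\<Sum>a'<n. \<Sum>b'<n. cnj (L s a') * L s b' * X a' b') = X a a + s * X a b + cnj s * X b a + cnj s * s * X b b" for s
  proof -
    have 1: "(\<Sum>b'<n. L s b' * Y b') = Y a + s * Y b" for Y s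
    proof -
      have "(\<Sum>b'<n. L s b' * Y b') = (\<Sum>b'<n. (if b' = a then Y b' else 0) + (if b' = b then s * Y b' else 0))"
        by (intro sum.cong refl) (simp add: L_def algebra_simps)
      also have "\<dots> = Y a + s * Y b" using assms(2,3) by (simp add: sum.distrib)
      finally show ?thesis .
    qed
    have 2: "(\<Sum>b'<n. cnj (L s b') * Y b') = Y a + cnj s * Y b" for Y
    proof -
      have "cnj (L s b') = L (cnj s) b'" for b' by (simp add: L_def)
      thus ?thesis using 1[of "cnj s" Y] by simp
    qed
    have "(\<Sum>a'<n. \<Sum>b'<n. cnj (L s a') * L s b' * X a' b') = (\<Sum>a'<n. cnj (L s a') * (\<Sum>b'<n. L s b' * X a' b'))"
      by (simp add: sum_distrib_left mult.assoc)
    thus ?thesis unfolding 1 2 by (simp add: algebra_simps)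
  qed
  have 0: "X a a + s * X a b + cnj s * X b a + cnj s * s * X b b = 0" for s
    using *[of s] assms(1)[of "L s"] by simp
  have "X a a = 0" using 0[of 0] by simp
  define t where "t = X a b + X b a"
  have t: "X b b + t = 0" "X b b - t = 0"
    using 0[of 1] 0[of "-1"] \<open>X a a = 0\<close> by (auto simp: algebra_simps t_def)
  have "2 * t = (X b b + t) - (X b b - t)" by simp
  hence "t = 0" unfolding t by simp
  hence "X b a = - X a b" "X b b = 0" using t by (auto simp: t_def eq_neg_iff_add_eq_0 add.commute)
  moreover have "\<i> * X a b - \<i> * X b a + X b b = 0" using 0[of \<i>] \<open>X a a = 0\<close> by (simp add: algebra_simps)
  ultimately show ?thesis by simp
qed

text \<open>Under the weight the vector is Gaussian with inverse covariance the identity plus a rank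
  one term: \<open>Z\<close> is the total mass, and the bracket is the inverse of that matrix, up to
  transposition, by the Sherman-Morrison formula.\<close>

lemma gaussian_row:
  fixes n :: nat and w :: "nat \<Rightarrow> complex" and \<kappa> :: real
  assumes "0 \<le> \<kappa>"
  defines "Z \<equiv> 1 / (1 + \<kappa> * (\<Sum>a<n. (cmod (w a))\<^sup>2))"
  defines "\<phi> \<equiv> \<lambda>z. exp (- \<kappa> * (cmod (\<Sum>b<n. z b * w b))\<^sup>2)"
  shows "(LINT z|PiM {..<n} (\<lambda>_. cgauss). \<phi> z) = Z"
    and "a < n \<Longrightarrow> b < n \<Longrightarrow> (LINT z|PiM {..<n} (\<lambda>_. cgauss). of_real (\<phi> z) * (cnj (z a) * z b)) =
      of_real Z * ((if a = b then 1 else 0) - of_real (\<kappa> * Z) * (w a * cnj (w b)))"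
proof -
  let ?M = "PiM {..<n} (\<lambda>_. cgauss)"
  interpret prob_space ?M by (rule prob_space_PiM_cgauss)
  note [measurable] = measurable_component_cgauss
  define W where "W = (\<Sum>a<n. (cmod (w a))\<^sup>2)"
  define Q where "Q a b = of_real \<kappa> * (cnj (w a) * w b)" for a b
  have W0: "0 \<le> W" by (simp add: W_def sum_nonneg)
  have pos: "0 < 1 + \<kappa> * W" using W0 assms(1) by (simp add: add_pos_nonneg)
  have herm: "Q b a = cnj (Q a b)" for a b by (simp add: Q_def mult.commute)
  have qf: "qform n Q z = \<kappa> * (cmod (\<Sum>b<n. z b * w b))\<^sup>2" for z
    using qform_add_rank_one[of n "\<lambda>_ _. 0" \<kappa> w z] by (simp add: Q_def qform_def mult.commute)
  have psd: "0 \<le> qform n Q z" for z unfolding qf using assms(1) by simp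
  have sq: "(\<Sum>i<n. cnj (x i) * x i) = of_real (\<Sum>i<n. (cmod (x i))\<^sup>2)" for x :: "nat \<Rightarrow> complex"
    by (simp add: complex_norm_square mult.commute del: of_real_power)
  have \<phi>: "\<phi> z = exp (- qform n Q z)" for z by (simp add: \<phi>_def qf)
  \<comment> \<open>The weight and the test vector \<open>l\<close> contribute one rank one term
    each, so \<open>detf_rank_two\<close> applies; the result is affine in \<open>e\<close>, as
    \<open>gaussian_second_moment\<close> requires.\<close>
  have det: "detf n (\<lambda>a b. (if a = b then 1 else 0) + (Q a b + of_real e * (cnj (l a) * l b))) =
     complex_of_real ((1 + \<kappa> * W) + e * ((1 + \<kappa> * W) * (\<Sum>a<n. (cmod (l a))\<^sup>2) -
       \<kappa> * (cmod (\<Sum>a<n. cnj (w a) * l a))\<^sup>2))" for e l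
  proof -
    have 1: "(\<Sum>i<n. (of_real e * cnj (l i)) * w i) = of_real e * cnj (\<Sum>i<n. cnj (w i) * l i)"
      by (simp add: sum_distrib_left mult_ac)
    have 2: "(\<Sum>i<n. (of_real \<kappa> * cnj (w i)) * l i) = of_real \<kappa> * (\<Sum>i<n. cnj (w i) * l i)"
      by (simp add: sum_distrib_left mult_ac)
    have 3: "(\<Sum>i<n. (of_real \<kappa> * cnj (w i)) * w i) = of_real (\<kappa> * W)"
      unfolding mult.assoc sum_distrib_left[symmetric] sq W_def by simp
    have 4: "(\<Sum>i<n. (of_real e * cnj (l i)) * l i) = of_real (e * (\<Sum>a<n. (cmod (l a))\<^sup>2))"
      unfolding mult.assoc sum_distrib_left[symmetric] sq by simp
    have 5: "cnj (\<Sum>i<n. cnj (w i) * l i) * (\<Sum>i<n. cnj (w i) * l i) = of_real ((cmod (\<Sum>i<n. cnj (w i) * l i))\<^sup>2)"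
      using complex_norm_square[of "\<Sum>i<n. cnj (w i) * l i"] by (simp add: mult.commute)
    have "detf n (\<lambda>a b. (if a = b then 1 else 0) + (Q a b + of_real e * (cnj (l a) * l b))) =
      detf n (\<lambda>i j. (if i = j then 1 else 0) + (of_real \<kappa> * cnj (w i)) * w j + (of_real e * cnj (l i)) * l j)"
      by (rule detf_cong) (simp add: Q_def)
    also have "\<dots> = (1 + of_real (\<kappa> * W)) * (1 + of_real (e * (\<Sum>a<n. (cmod (l a))\<^sup>2))) -
       of_real e * of_real \<kappa> * (cnj (\<Sum>i<n. cnj (w i) * l i) * (\<Sum>i<n. cnj (w i) * l i))"
      unfolding detf_rank_two 1 2 3 4 by (simp only: mult_ac)
    finally show ?thesis unfolding 5 by (simp add: algebra_simps)
  qed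
  have Z: "Z = 1 / (1 + \<kappa> * W)" by (simp add: Z_def W_def)
  show "(LINT z|?M. \<phi> z) = Z"
    unfolding \<phi> Z by (rule gaussian_expectation(3)[OF herm psd]) (use det[of 0 "\<lambda>_. 0"] in simp)
  define c where "c = \<kappa> * Z"
  have sm: "(LINT z|?M. (cmod (\<Sum>a<n. l a * z a))\<^sup>2 * \<phi> z) =
     Z * ((\<Sum>a<n. (cmod (l a))\<^sup>2) - c * (cmod (\<Sum>a<n. cnj (w a) * l a))\<^sup>2)" for l
  proof -
    have "(LINT z|?M. (cmod (\<Sum>a<n. l a * z a))\<^sup>2 * \<phi> z) = ((1 + \<kappa> * W) * (\<Sum>a<n. (cmod (l a))\<^sup>2) -
       \<kappa> * (cmod (\<Sum>a<n. cnj (w a) * l a))\<^sup>2) / (1 + \<kappa> * W)\<^sup>2"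
      unfolding \<phi> by (rule gaussian_second_moment[OF herm psd]) (rule det)
    thus ?thesis using pos unfolding Z c_def by (simp add: divide_simps) (simp add: power2_eq_square algebra_simps)
  qed
  have \<phi>_le: "\<phi> z \<le> 1" for z using psd[of z] by (simp add: \<phi>)
  have [measurable]: "\<phi> \<in> borel_measurable ?M" unfolding \<phi>_def by measurable
  have int: "integrable ?M (\<lambda>z. of_real (\<phi> z) * (cnj (z a) * z b))" if "a < n" "b < n" for a b
    by (rule moments_bounded_mult_integrable)
       (use that \<phi>_le in \<open>auto intro!: moments_mult moments_cnj moments_PiM_cgauss simp: \<phi>_def\<close>)
  \<comment> \<open>The difference of the two sides. Moments of linear forms only show that its
    Hermitian form vanishes at every \<open>l\<close>; polarisation recovers the entries.\<close>
  define X where "X a b = (LINT z|?M. of_real (\<phi> z) * (cnj (z a) * z b)) -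
      of_real Z * ((if a = b then 1 else 0) - of_real c * (w a * cnj (w b)))" for a b
  have "X a b = 0" if "a < n" "b < n"
  proof (rule hermitian_form_eq_0[OF _ that])
    fix l :: "nat \<Rightarrow> complex"
    have "(\<Sum>a<n. \<Sum>b<n. cnj (l a) * l b * (LINT z|?M. of_real (\<phi> z) * (cnj (z a) * z b))) =
       (LINT z|?M. (\<Sum>a<n. \<Sum>b<n. cnj (l a) * l b * (of_real (\<phi> z) * (cnj (z a) * z b))))"
      by (subst Bochner_Integration.integral_sum, use int in force,
          intro sum.cong refl, subst Bochner_Integration.integral_sum, use int in force, use int in auto)
    also have "\<dots> = (LINT z|?M. complex_of_real ((cmod (\<Sum>a<n. l a * z a))\<^sup>2 * \<phi> z))"
    proof (rule Bochner_Integration.integral_cong[OF refl])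
      fix z
      have "(\<Sum>a<n. \<Sum>b<n. cnj (l a) * l b * (of_real (\<phi> z) * (cnj (z a) * z b))) =
        of_real (\<phi> z) * (cnj (\<Sum>a<n. l a * z a) * (\<Sum>a<n. l a * z a))"
        unfolding cnj_sum sum_product by (simp add: sum_distrib_left mult_ac)
      also have "cnj (\<Sum>a<n. l a * z a) * (\<Sum>a<n. l a * z a) = of_real ((cmod (\<Sum>a<n. l a * z a))\<^sup>2)"
        using complex_norm_square[of "\<Sum>a<n. l a * z a"] by (simp add: mult.commute)
      finally show "(\<Sum>a<n. \<Sum>b<n. cnj (l a) * l b * (of_real (\<phi> z) * (cnj (z a) * z b))) =
        complex_of_real ((cmod (\<Sum>a<n. l a * z a))\<^sup>2 * \<phi> z)" by simp
    qed
    also have "\<dots> = of_real (LINT z|?M. (cmod (\<Sum>a<n. l a * z a))\<^sup>2 * \<phi> z)"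
      by (rule integral_complex_of_real)
    also have "\<dots> = of_real Z * ((\<Sum>a<n. cnj (l a) * l a) - of_real c *
        (cnj (\<Sum>a<n. cnj (w a) * l a) * (\<Sum>a<n. cnj (w a) * l a)))"
      unfolding sm sq using complex_norm_square[of "\<Sum>a<n. cnj (w a) * l a"] by (simp add: mult.commute)
    also have "\<dots> = of_real Z * ((\<Sum>a<n. \<Sum>b<n. cnj (l a) * l b * (if a = b then 1 else 0)) -
       (\<Sum>a<n. \<Sum>b<n. cnj (l a) * l b * (of_real c * (w a * cnj (w b)))))"
      unfolding cnj_sum sum_product
      by (simp add: if_distrib[of "\<lambda>x. _ * x"] sum_distrib_left mult_ac cong: if_cong)
    finally show "(\<Sum>a<n. \<Sum>b<n. cnj (l a) * l b * X a b) = 0"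
      unfolding X_def by (simp add: right_diff_distrib sum_subtractf sum_distrib_left mult_ac)
  qed
  thus "a < n \<Longrightarrow> b < n \<Longrightarrow> (LINT z|?M. of_real (\<phi> z) * (cnj (z a) * z b)) =
      of_real Z * ((if a = b then 1 else 0) - of_real (\<kappa> * Z) * (w a * cnj (w b)))"
    by (simp add: X_def c_def)
qed

section \<open>Averaging a weighted determinant over the rows\<close>

text \<open>The differential operator \<open>E(d/dt)\<close> applied to \<open>p\<close>. Each row
  of \<open>H\<close> will contribute a linear factor \<open>1 + k r * t\<close> to
  \<open>E\<close>.\<close>

definition diff_op :: "complex poly \<Rightarrow> complex poly \<Rightarrow> complex poly" where
  "diff_op E p = (\<Sum>k\<le>Polynomial.degree E. Polynomial.smult (coeff E k) ((pderiv ^^ k) p))"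

lemma diff_op_bound:
  "Polynomial.degree E \<le> N \<Longrightarrow> diff_op E p = (\<Sum>k\<le>N. Polynomial.smult (coeff E k) ((pderiv ^^ k) p))"
  unfolding diff_op_def by (intro sum.mono_neutral_left) (auto simp: coeff_eq_0)

lemma diff_op_1 [simp]: "diff_op 1 p = p"
  by (simp add: diff_op_def)

lemma diff_op_linear_mult:
  "diff_op ([:1, c:] * E) p = diff_op E p + Polynomial.smult c (pderiv (diff_op E p))"
proof -
  let ?N = "Polynomial.degree E"
  let ?q = "\<lambda>k. (pderiv ^^ k) p"
  have "Polynomial.degree ([:1, c:] * E) \<le> Suc ?N"
    using degree_mult_le[of "[:1, c:]" E] by (simp add: degree_pCons_eq_if split: if_splits)
  hence "diff_op ([:1, c:] * E) p = (\<Sum>k\<le>Suc ?N. Polynomial.smult (coeff ([:1, c:] * E) k) (?q k))"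
    by (rule diff_op_bound)
  also have "\<dots> = (\<Sum>k\<le>Suc ?N. Polynomial.smult (coeff E k) (?q k)) +
     (\<Sum>k\<le>Suc ?N. Polynomial.smult (if k = 0 then 0 else c * coeff E (k - 1)) (?q k))"
    unfolding coeff_linear_mult by (simp only: smult_add_left sum.distrib)
  also have "(\<Sum>k\<le>Suc ?N. Polynomial.smult (coeff E k) (?q k)) = diff_op E p"
    by (rule diff_op_bound[symmetric]) simp
  also have "(\<Sum>k\<le>Suc ?N. Polynomial.smult (if k = 0 then 0 else c * coeff E (k - 1)) (?q k)) =
     Polynomial.smult c (pderiv (diff_op E p))"
    unfolding diff_op_def by (subst sum.atMost_Suc_shift) (simp add: pderiv_sum pderiv_smult smult_sum2)
  finally show ?thesis .
qed

text \<open>The factorials of the final formula originate here: the \<open>k\<close>-th derivative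
  at 0 is \<open>k!\<close> times a coefficient.\<close>

lemma poly_diff_op_0:
  assumes "Polynomial.degree E \<le> N"
  shows "poly (diff_op E p) 0 = (\<Sum>k\<le>N. coeff E k * fact k * coeff p k)"
proof -
  have "coeff ((pderiv ^^ k) p) 0 = fact k * coeff p k" for k
    using coeff_higher_pderiv[of k p 0] by (simp add: pochhammer_fact)
  thus ?thesis unfolding diff_op_bound[OF assms] by (simp add: poly_0_coeff_0 coeff_sum mult.assoc)
qed

lemma integral_double_sum:
  fixes F :: "nat \<Rightarrow> nat \<Rightarrow> 'b \<Rightarrow> complex"
  assumes "integrable M f" "\<And>a b. a < n \<Longrightarrow> b < n \<Longrightarrow> integrable M (F a b)"
  shows "(LINT x|M. f x + (\<Sum>a<n. \<Sum>b<n. c a b * F a b x)) =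
    (LINT x|M. f x) + (\<Sum>a<n. \<Sum>b<n. c a b * (LINT x|M. F a b x))"
proof -
  have 1: "integrable M (\<lambda>x. \<Sum>b<n. c a b * F a b x)" if "a < n" for a
    using assms(2) that by (intro Bochner_Integration.integrable_sum integrable_mult_right) auto
  have "(LINT x|M. (\<Sum>a<n. \<Sum>b<n. c a b * F a b x)) = (\<Sum>a<n. (LINT x|M. (\<Sum>b<n. c a b * F a b x)))"
    using 1 by (intro Bochner_Integration.integral_sum) auto
  also have "\<dots> = (\<Sum>a<n. \<Sum>b<n. (LINT x|M. c a b * F a b x))"
    using assms(2) by (intro sum.cong refl Bochner_Integration.integral_sum integrable_mult_right) auto
  finally have 2: "(LINT x|M. (\<Sum>a<n. \<Sum>b<n. c a b * F a b x)) = (\<Sum>a<n. \<Sum>b<n. c a b * (LINT x|M. F a b x))"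
    by simp
  have "integrable M (\<lambda>x. \<Sum>a<n. \<Sum>b<n. c a b * F a b x)"
    by (rule Bochner_Integration.integrable_sum) (use 1 in auto)
  thus ?thesis unfolding 2[symmetric] by (rule Bochner_Integration.integral_add[OF assms(1)])
qed

section \<open>Recursion over the rows of the channel matrix\<close>

context
  fixes n :: nat and v \<kappa> k :: "nat \<Rightarrow> real" and w :: "nat \<Rightarrow> complex"
begin

text \<open>In the application \<open>w\<close> is \<open>diag(\<surd>v) z\<close> for a fixed
  \<open>z\<close>; below \<open>R\<close>, \<open>\<kappa> j\<close> is \<open>x * u j\<close>,
  coming from \<open>1 / D x\<close>, and \<open>k j\<close> is \<open>y * u j\<close>, coming from
  \<open>D y\<close>.\<close>

definition row_weight :: "(nat \<Rightarrow> complex) \<Rightarrow> nat \<Rightarrow> real" where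
  "row_weight z j = exp (- \<kappa> j * (cmod (\<Sum>b<n. z b * w b))\<^sup>2)"

definition weight :: "nat set \<Rightarrow> (nat \<times> nat \<Rightarrow> complex) \<Rightarrow> real" where
  "weight J h = (\<Prod>j\<in>J. row_weight (\<lambda>b. h (j, b)) j)"

definition shifted :: "nat set \<Rightarrow> (nat \<Rightarrow> nat \<Rightarrow> complex) \<Rightarrow> (nat \<times> nat \<Rightarrow> complex) \<Rightarrow> nat \<Rightarrow> nat \<Rightarrow> complex" where
  "shifted J N h a b = N a b + (\<Sum>j\<in>J. of_real (k j) * (of_real (v a) * cnj (h (j, a)) * h (j, b)))"

text \<open>The matrix \<open>N\<close> is kept free: integrating out one row leaves means of the
  same kind over the remaining rows, at \<open>N\<close> and at its bumps.\<close>

definition mean_det :: "nat set \<Rightarrow> (nat \<Rightarrow> nat \<Rightarrow> complex) \<Rightarrow> complex" where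
  "mean_det J N = (LINT h|PiM (J \<times> {..<n}) (\<lambda>_. cgauss). of_real (weight J h) * detf n (shifted J N h))"

definition Zr :: "nat \<Rightarrow> real" where
  "Zr j = 1 / (1 + \<kappa> j * (\<Sum>a<n. (cmod (w a))\<^sup>2))"

lemma weight_bounds:
  assumes \<kappa>: "\<And>j. 0 \<le> \<kappa> j"
  shows "0 \<le> weight J h" "weight J h \<le> 1" "0 \<le> row_weight z j" "row_weight z j \<le> 1"
proof -
  have 1: "0 \<le> row_weight z j \<and> row_weight z j \<le> 1" for z j
    using \<kappa>[of j] by (simp add: row_weight_def)
  thus "0 \<le> row_weight z j" "row_weight z j \<le> 1" by auto
  show "0 \<le> weight J h" unfolding weight_def using 1 by (intro prod_nonneg) auto
  show "weight J h \<le> 1" unfolding weight_def using 1 by (intro prod_le_1) auto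
qed

lemma measurable_weight [measurable]: "weight J \<in> borel_measurable (PiM (J \<times> {..<n}) (\<lambda>_. cgauss))"
proof -
  have [measurable]: "(\<lambda>h. h (j, b)) \<in> borel_measurable (PiM (J \<times> {..<n}) (\<lambda>_. cgauss))"
    if "j \<in> J" "b \<in> {..<n}" for j b
    by (rule measurable_component_cgauss) (use that in auto)
  show ?thesis unfolding weight_def row_weight_def by measurable
qed

lemma moments_detf_shifted:
  assumes "J \<subseteq> J'"
  shows "moments (PiM (J' \<times> {..<n}) (\<lambda>_. cgauss)) (\<lambda>h. detf n (shifted J N h))"
proof -
  interpret prob_space "PiM (J' \<times> {..<n}) (\<lambda>_. cgauss)" by (rule prob_space_PiM_cgauss)
  show ?thesis unfolding shifted_def
    by (intro moments_detf moments_add moments_sum moments_mult moments_const moments_cnj moments_PiM_cgauss)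
       (use assms in auto)
qed

lemma integrable_weight_detf:
  assumes \<kappa>: "\<And>j. 0 \<le> \<kappa> j"
  shows "integrable (PiM (J \<times> {..<n}) (\<lambda>_. cgauss)) (\<lambda>h. of_real (weight J h) * detf n (shifted J N h))"
  by (rule moments_bounded_mult_integrable[OF moments_detf_shifted]) (auto simp: weight_bounds[OF \<kappa>])

text \<open>By \<open>detf_rank_one\<close> the integrand is the weight times a polynomial of degree
  two in the row and its conjugate, so the total mass and the second moments of
  \<open>gaussian_row\<close> suffice.\<close>

lemma integral_row:
  fixes N :: "nat \<Rightarrow> nat \<Rightarrow> complex"
  assumes \<kappa>: "\<And>j. 0 \<le> \<kappa> j"
  shows "(LINT y|PiM ({r} \<times> {..<n}) (\<lambda>_. cgauss). of_real (row_weight (\<lambda>b. y (r, b)) r) *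
      detf n (\<lambda>a b. N a b + of_real (k r) * (of_real (v a) * cnj (y (r, a)) * y (r, b)))) =
    of_real (Zr r) * (detf n N + of_real (k r) * (\<Sum>a<n. \<Sum>b<n. of_real (v a) *
      ((if a = b then 1 else 0) - of_real (\<kappa> r * Zr r) * (w a * cnj (w b))) * (detf n (bump N a b) - detf n N)))"
proof -
  let ?M = "PiM {..<n} (\<lambda>_. cgauss)" and ?M' = "PiM ({r} \<times> {..<n}) (\<lambda>_. cgauss)"
  interpret prob_space ?M by (rule prob_space_PiM_cgauss)
  note [measurable] = measurable_component_cgauss
  let ?g = "\<lambda>z. of_real (row_weight z r) * detf n (\<lambda>a b. N a b + of_real (k r) * ((of_real (v a) * cnj (z a)) * z b))"
  let ?D = "\<lambda>a b. detf n (bump N a b) - detf n N"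
  have mom: "moments ?M (\<lambda>z. detf n (\<lambda>a b. N a b + of_real (k r) * ((of_real (v a) * cnj (z a)) * z b)))"
    by (intro moments_detf moments_add moments_mult moments_const moments_cnj moments_PiM_cgauss) auto
  have w_meas [measurable]: "(\<lambda>z. row_weight z r) \<in> borel_measurable ?M" unfolding row_weight_def by measurable
  have "(\<lambda>z. complex_of_real (row_weight z r)) \<in> borel_measurable ?M" by measurable
  hence g_meas: "?g \<in> borel_measurable ?M"
    by (intro borel_measurable_times moments_measurable[OF mom])
  \<comment> \<open>Only a change of the index set, from the pairs \<open>(r, b)\<close> to the
    \<open>b\<close> used in \<open>gaussian_row\<close>.\<close>
  have "distr ?M' ?M (\<lambda>y. \<lambda>b\<in>{..<n}. y (r, b)) = ?M"
    by (rule distr_PiM_reindex) (auto simp: prob_space_cgauss inj_on_def)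
  hence "(LINT z|?M. ?g z) = (LINT z|distr ?M' ?M (\<lambda>y. \<lambda>b\<in>{..<n}. y (r, b)). ?g z)" by simp
  also have "\<dots> = (LINT y|?M'. ?g (\<lambda>b\<in>{..<n}. y (r, b)))"
  proof (rule integral_distr[OF _ g_meas])
    show "(\<lambda>y. \<lambda>b\<in>{..<n}. y (r, b)) \<in> ?M' \<rightarrow>\<^sub>M ?M"
      by (rule measurable_restrict) (auto intro: measurable_component_singleton)
  qed
  also have "\<dots> = (LINT y|?M'. of_real (row_weight (\<lambda>b. y (r, b)) r) *
      detf n (\<lambda>a b. N a b + of_real (k r) * (of_real (v a) * cnj (y (r, a)) * y (r, b))))"
    by (intro Bochner_Integration.integral_cong refl arg_cong2[where f = "(*)"] detf_cong) (auto simp: row_weight_def)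
  finally have *: "(LINT y|?M'. of_real (row_weight (\<lambda>b. y (r, b)) r) *
      detf n (\<lambda>a b. N a b + of_real (k r) * (of_real (v a) * cnj (y (r, a)) * y (r, b)))) = (LINT z|?M. ?g z)" ..
  have int0: "integrable ?M (\<lambda>z. row_weight z r)"
    by (rule integrable_const_bound[where B = 1]) (auto simp: weight_bounds[OF \<kappa>])
  have int: "integrable ?M (\<lambda>z. of_real (row_weight z r) * (cnj (z a) * z b))" if "a < n" "b < n" for a b
    by (rule moments_bounded_mult_integrable)
       (use that in \<open>auto intro!: moments_mult moments_cnj moments_PiM_cgauss simp: weight_bounds[OF \<kappa>]\<close>)
  have g: "?g z = of_real (row_weight z r) * detf n N +
      (\<Sum>a<n. \<Sum>b<n. (of_real (k r) * of_real (v a) * ?D a b) * (of_real (row_weight z r) * (cnj (z a) * z b)))" for z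
    unfolding detf_rank_one by (simp add: distrib_left sum_distrib_left mult_ac)
  have "(LINT z|?M. ?g z) = (LINT z|?M. of_real (row_weight z r) * detf n N) +
     (\<Sum>a<n. \<Sum>b<n. (of_real (k r) * of_real (v a) * ?D a b) * (LINT z|?M. of_real (row_weight z r) * (cnj (z a) * z b)))"
    unfolding g by (rule integral_double_sum[OF _ int]) (intro integrable_mult_left integrable_of_real int0)
  also have "(LINT z|?M. of_real (row_weight z r) * detf n N) = of_real (Zr r) * detf n N"
    using gaussian_row(1)[OF \<kappa>[of r], where n = n and w = w] unfolding row_weight_def Zr_def by simp
  also have "(\<Sum>a<n. \<Sum>b<n. (of_real (k r) * of_real (v a) * ?D a b) * (LINT z|?M. of_real (row_weight z r) * (cnj (z a) * z b))) =
     (\<Sum>a<n. \<Sum>b<n. (of_real (k r) * of_real (v a) * ?D a b) * (of_real (Zr r) *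
      ((if a = b then 1 else 0) - of_real (\<kappa> r * Zr r) * (w a * cnj (w b)))))"
    using gaussian_row(2)[OF \<kappa>[of r], where n = n and w = w] unfolding row_weight_def Zr_def
    by (intro sum.cong refl) simp
  finally show ?thesis unfolding * by (simp add: distrib_left sum_distrib_left mult_ac)
qed

text \<open>Fubini splits off row \<open>r\<close>. A bump of the shifted matrix is the shift of the
  bumped \<open>N\<close>, so the increments of the determinant integrate to increments of
  \<open>mean_det\<close>.\<close>

lemma mean_det_insert:
  assumes \<kappa>: "\<And>j. 0 \<le> \<kappa> j" and J: "finite J" "r \<notin> J"
  shows "mean_det (insert r J) N = of_real (Zr r) * (mean_det J N + of_real (k r) * (\<Sum>a<n. \<Sum>b<n. of_real (v a) *
      ((if a = b then 1 else 0) - of_real (\<kappa> r * Zr r) * (w a * cnj (w b))) * (mean_det J (bump N a b) - mean_det J N)))"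
proof -
  let ?I = "J \<times> {..<n}" and ?K = "{r} \<times> {..<n}"
  let ?M = "PiM ?I (\<lambda>_. cgauss)"
  have U: "insert r J \<times> {..<n} = ?I \<union> ?K" by auto
  let ?F = "\<lambda>h. of_real (weight (insert r J) h) * detf n (shifted (insert r J) N h)"
  have "mean_det (insert r J) N = (LINT x|?M. LINT y|PiM ?K (\<lambda>_. cgauss). ?F (merge ?I ?K (x, y)))"
    unfolding mean_det_def U
    by (rule cgauss_product.product_integral_fold)
       (use assms integrable_weight_detf[OF \<kappa>, of "insert r J" N, unfolded U] in auto)
  also have "\<dots> = (LINT x|?M. of_real (weight J x) * (of_real (Zr r) * (detf n (shifted J N x) +
      of_real (k r) * (\<Sum>a<n. \<Sum>b<n. of_real (v a) *
      ((if a = b then 1 else 0) - of_real (\<kappa> r * Zr r) * (w a * cnj (w b))) *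
      (detf n (shifted J (bump N a b) x) - detf n (shifted J N x))))))"
  proof (rule Bochner_Integration.integral_cong[OF refl])
    fix x
    have 1: "weight (insert r J) (merge ?I ?K (x, y)) = row_weight (\<lambda>b. y (r, b)) r * weight J x" for y
    proof -
      have "weight J (merge ?I ?K (x, y)) = weight J x"
        unfolding weight_def row_weight_def by (intro prod.cong refl) (simp add: merge_def)
      moreover have "row_weight (\<lambda>b. merge ?I ?K (x, y) (r, b)) r = row_weight (\<lambda>b. y (r, b)) r"
        using assms by (simp add: row_weight_def merge_def)
      ultimately show ?thesis using assms by (simp add: weight_def)
    qed
    have 2: "detf n (shifted (insert r J) N (merge ?I ?K (x, y))) =
        detf n (\<lambda>a b. shifted J N x a b + of_real (k r) * (of_real (v a) * cnj (y (r, a)) * y (r, b)))" for y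
    proof (rule detf_cong)
      fix a b assume ab: "a < n" "b < n"
      have "(\<Sum>j\<in>J. of_real (k j) * (of_real (v a) * cnj (merge ?I ?K (x, y) (j, a)) * merge ?I ?K (x, y) (j, b))) =
        (\<Sum>j\<in>J. of_real (k j) * (of_real (v a) * cnj (x (j, a)) * x (j, b)))"
        using ab by (intro sum.cong refl) (simp add: merge_def)
      thus "shifted (insert r J) N (merge ?I ?K (x, y)) a b =
        shifted J N x a b + of_real (k r) * (of_real (v a) * cnj (y (r, a)) * y (r, b))"
        unfolding shifted_def using assms ab by (simp add: merge_def)
    qed
    have 3: "bump (shifted J N x) a b = shifted J (bump N a b) x" for a b
      by (auto simp: shifted_def bump_def fun_eq_iff)
    have "(LINT y|PiM ?K (\<lambda>_. cgauss). ?F (merge ?I ?K (x, y))) =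
      of_real (weight J x) * (LINT y|PiM ?K (\<lambda>_. cgauss). of_real (row_weight (\<lambda>b. y (r, b)) r) *
      detf n (\<lambda>a b. shifted J N x a b + of_real (k r) * (of_real (v a) * cnj (y (r, a)) * y (r, b))))"
      unfolding 1 2 integral_mult_right_zero[symmetric] by (simp add: mult_ac)
    thus "(LINT y|PiM ?K (\<lambda>_. cgauss). ?F (merge ?I ?K (x, y))) =
      of_real (weight J x) * (of_real (Zr r) * (detf n (shifted J N x) +
      of_real (k r) * (\<Sum>a<n. \<Sum>b<n. of_real (v a) *
      ((if a = b then 1 else 0) - of_real (\<kappa> r * Zr r) * (w a * cnj (w b))) *
      (detf n (shifted J (bump N a b) x) - detf n (shifted J N x)))))"
      unfolding integral_row[OF \<kappa>] 3 .
  qed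
  also have "\<dots> = (LINT x|?M. of_real (Zr r) * (of_real (weight J x) * detf n (shifted J N x)) +
      (\<Sum>a<n. \<Sum>b<n. of_real (Zr r) * (of_real (k r) * (of_real (v a) *
      ((if a = b then 1 else 0) - of_real (\<kappa> r * Zr r) * (w a * cnj (w b))))) *
      (of_real (weight J x) * detf n (shifted J (bump N a b) x) - of_real (weight J x) * detf n (shifted J N x))))"
    by (intro Bochner_Integration.integral_cong refl) (simp add: sum_distrib_left algebra_simps)
  also have "\<dots> = (LINT x|?M. of_real (Zr r) * (of_real (weight J x) * detf n (shifted J N x))) +
      (\<Sum>a<n. \<Sum>b<n. of_real (Zr r) * (of_real (k r) * (of_real (v a) *
      ((if a = b then 1 else 0) - of_real (\<kappa> r * Zr r) * (w a * cnj (w b))))) *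
      (LINT x|?M. of_real (weight J x) * detf n (shifted J (bump N a b) x) - of_real (weight J x) * detf n (shifted J N x)))"
    by (rule integral_double_sum) (intro integrable_mult_right Bochner_Integration.integrable_diff integrable_weight_detf[OF \<kappa>])+
  also have "\<dots> = of_real (Zr r) * mean_det J N +
      (\<Sum>a<n. \<Sum>b<n. of_real (Zr r) * (of_real (k r) * (of_real (v a) *
      ((if a = b then 1 else 0) - of_real (\<kappa> r * Zr r) * (w a * cnj (w b))))) *
      (mean_det J (bump N a b) - mean_det J N))"
    unfolding mean_det_def Bochner_Integration.integral_diff[OF integrable_weight_detf[OF \<kappa>] integrable_weight_detf[OF \<kappa>]]
      integral_mult_right_zero ..
  finally show ?thesis by (simp add: distrib_left sum_distrib_left mult_ac)
qed

text \<open>On the matrices \<open>1 + \<tau> diag(v) - \<sigma> diag(v) w w\<^sup>*\<close> the recursion of \<open>mean_det_insert\<close> closes: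
by \<open>jdiff\<close>, its double sum is the derivative along \<open>(\<tau> + e, \<sigma> + \<kappa> r * Zr r * e)\<close>.\<close>

definition base :: "complex \<Rightarrow> complex \<Rightarrow> nat \<Rightarrow> nat \<Rightarrow> complex" where
  "base \<tau> \<sigma> a b = (if a = b then 1 + of_real (v a) * \<tau> else 0) + - \<sigma> * (of_real (v a) * w a * cnj (w b))"

abbreviation vp :: "nat set \<Rightarrow> complex poly" where
  "vp \<equiv> esym_poly (\<lambda>i. of_real (v i))"

abbreviation kp :: "nat set \<Rightarrow> complex poly" where
  "kp \<equiv> esym_poly (\<lambda>j. of_real (k j))"

text \<open>By \<open>detf_diag_rank_one\<close> the determinant of
  \<open>base \<tau> \<sigma>\<close> is \<open>vp {..<n}\<close> at \<open>\<tau>\<close> minus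
  \<open>\<sigma>\<close> times \<open>qp\<close> at \<open>\<tau>\<close>.\<close>

definition qp :: "complex poly" where
  "qp = (\<Sum>i<n. Polynomial.smult (of_real (v i * (cmod (w i))\<^sup>2)) (vp ({..<n} - {i})))"

text \<open>The two leading terms are the determinant of \<open>base \<tau> \<sigma>\<close> under
  the operator of \<open>kp J\<close>; the sum over \<open>j\<close> records that row
  \<open>j\<close> also shifts \<open>\<sigma>\<close>, at the rate
  \<open>\<kappa> j * Zr j\<close>.\<close>

definition closed_form :: "nat set \<Rightarrow> complex \<Rightarrow> complex \<Rightarrow> complex" where
  "closed_form J \<tau> \<sigma> = poly (diff_op (kp J) (vp {..<n})) \<tau> - \<sigma> * poly (diff_op (kp J) qp) \<tau> -
     (\<Sum>j\<in>J. of_real (\<kappa> j * Zr j * k j) * poly (diff_op (kp (J - {j})) qp) \<tau>)"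

text \<open>The derivative has a part in \<open>\<tau>\<close>, which supplies the new linear factor
  of \<open>kp\<close>, and a part in \<open>\<sigma>\<close>, which supplies the new summand
  \<open>j = r\<close>.\<close>

lemma closed_form_insert:
  assumes "finite J" "r \<notin> J"
    and D: "((\<lambda>e. closed_form J (\<tau> + e) (\<sigma> + of_real (\<kappa> r * Zr r) * e)) has_field_derivative D) (at 0)"
  shows "closed_form (insert r J) \<tau> \<sigma> = closed_form J \<tau> \<sigma> + of_real (k r) * D"
proof -
  let ?c = "of_real (\<kappa> r * Zr r) :: complex"
  have comp: "((\<lambda>e. poly p (\<tau> + e)) has_field_derivative poly (pderiv p) \<tau>) (at 0)" for p
  proof -
    have "((\<lambda>e. poly p (\<tau> + e)) has_field_derivative poly (pderiv p) (\<tau> + 0) * 1) (at 0)"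
      by (rule DERIV_chain'[where f = "\<lambda>e. \<tau> + e", OF _ poly_DERIV]) (auto intro!: derivative_eq_intros)
    thus ?thesis by simp
  qed
  have "((\<lambda>e. closed_form J (\<tau> + e) (\<sigma> + ?c * e)) has_field_derivative
     poly (pderiv (diff_op (kp J) (vp {..<n}))) \<tau> -
     (?c * poly (diff_op (kp J) qp) \<tau> + \<sigma> * poly (pderiv (diff_op (kp J) qp)) \<tau>) -
     (\<Sum>j\<in>J. of_real (\<kappa> j * Zr j * k j) * poly (pderiv (diff_op (kp (J - {j})) qp)) \<tau>)) (at 0)"
    unfolding closed_form_def by (auto intro!: derivative_eq_intros comp sum.cong simp: mult_ac)
  hence D_eq: "D = poly (pderiv (diff_op (kp J) (vp {..<n}))) \<tau> -
     (?c * poly (diff_op (kp J) qp) \<tau> + \<sigma> * poly (pderiv (diff_op (kp J) qp)) \<tau>) -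
     (\<Sum>j\<in>J. of_real (\<kappa> j * Zr j * k j) * poly (pderiv (diff_op (kp (J - {j})) qp)) \<tau>)"
    using D by (rule DERIV_unique[symmetric])
  have ins: "kp (insert r I) = [:1, of_real (k r):] * kp I" if "I \<subseteq> J" for I
    using that assms finite_subset by (intro esym_poly_insert) auto
  have "(\<Sum>j\<in>insert r J. of_real (\<kappa> j * Zr j * k j) * poly (diff_op (kp (insert r J - {j})) qp) \<tau>) =
    of_real (\<kappa> r * Zr r * k r) * poly (diff_op (kp J) qp) \<tau> +
    (\<Sum>j\<in>J. of_real (\<kappa> j * Zr j * k j) * poly (diff_op (kp (insert r (J - {j}))) qp) \<tau>)"
    using assms by (simp add: insert_Diff_if) (intro sum.cong, auto)
  also have "(\<Sum>j\<in>J. of_real (\<kappa> j * Zr j * k j) * poly (diff_op (kp (insert r (J - {j}))) qp) \<tau>) =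
    (\<Sum>j\<in>J. of_real (\<kappa> j * Zr j * k j) * poly (diff_op (kp (J - {j})) qp) \<tau>) +
    of_real (k r) * (\<Sum>j\<in>J. of_real (\<kappa> j * Zr j * k j) * poly (pderiv (diff_op (kp (J - {j})) qp)) \<tau>)"
  proof -
    have "poly (diff_op (kp (insert r (J - {j}))) qp) \<tau> = poly (diff_op (kp (J - {j})) qp) \<tau> +
        of_real (k r) * poly (pderiv (diff_op (kp (J - {j})) qp)) \<tau>" for j
      unfolding ins[OF Diff_subset] diff_op_linear_mult by (simp only: poly_add poly_smult)
    thus ?thesis by (simp only: distrib_left sum.distrib sum_distrib_left mult.left_commute)
  qed
  finally show ?thesis
    unfolding closed_form_def D_eq ins[OF subset_refl] diff_op_linear_mult by (simp add: algebra_simps)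
qed

text \<open>\<open>jdiff\<close> is carried through the induction because each step has to read its
  double sum as a derivative of the previous mean.\<close>

lemma mean_det_base:
  assumes \<kappa>: "\<And>j. 0 \<le> \<kappa> j" and "finite J"
  shows "jdiff n (mean_det J) \<and>
    (\<forall>\<tau> \<sigma>. mean_det J (base \<tau> \<sigma>) = of_real (\<Prod>j\<in>J. Zr j) * closed_form J \<tau> \<sigma>)"
  using assms(2)
proof (induction J rule: finite_induct)
  case empty
  have const: "(LINT h|Q. c) = c" if "prob_space Q" for Q :: "(nat \<times> nat \<Rightarrow> complex) measure" and c :: complex
    using prob_space.prob_space[OF that] by simp
  have "shifted {} N h = N" for N h by (simp add: shifted_def fun_eq_iff)
  hence "mean_det {} N = detf n N" for N
    unfolding mean_det_def weight_def by (simp only: prod.empty of_real_1 mult_1 const[OF prob_space_PiM_cgauss])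
  hence [simp]: "mean_det {} = detf n" by (simp add: fun_eq_iff)
  have "detf n (base \<tau> \<sigma>) = closed_form {} \<tau> \<sigma>" for \<tau> \<sigma>
  proof -
    have "kp {} = 1" by (simp add: esym_poly_def)
    hence cf: "closed_form {} \<tau> \<sigma> = poly (vp {..<n}) \<tau> - \<sigma> * poly qp \<tau>"
      by (simp add: closed_form_def)
    have wi: "of_real (v i) * w i * cnj (w i) = of_real (v i * (cmod (w i))\<^sup>2)" for i
      using complex_norm_square[of "w i"] by simp
    have "detf n (base \<tau> \<sigma>) = (\<Prod>i<n. 1 + of_real (v i) * \<tau>) + - \<sigma> * (\<Sum>i<n. of_real (v i) * w i * cnj (w i) *
       (\<Prod>l\<in>{..<n} - {i}. 1 + of_real (v l) * \<tau>))"
      unfolding base_def by (rule detf_diag_rank_one)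
    thus ?thesis
      unfolding wi cf qp_def poly_sum poly_smult poly_esym_poly by simp
  qed
  thus ?case by (simp add: jdiff_detf)
next
  case (insert r J)
  let ?c = "of_real (\<kappa> r * Zr r) :: complex"
  define K where "K a b = of_real (v a) * ((if a = b then 1 else 0) - ?c * (w a * cnj (w b)))" for a b
  have jd: "jdiff n (mean_det J)" using insert.IH by simp
  have ins: "mean_det (insert r J) N = of_real (Zr r) * (mean_det J N + of_real (k r) *
      (\<Sum>a<n. \<Sum>b<n. K a b * (mean_det J (bump N a b) - mean_det J N)))" for N
    unfolding K_def by (rule mean_det_insert[OF \<kappa> insert.hyps])
  have "jdiff n (mean_det (insert r J))"
  proof -
    have "jdiff n (\<lambda>N. of_real (Zr r) * mean_det J N + (of_real (Zr r) * of_real (k r)) * (\<Sum>a<n. 1 *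
      (\<Sum>b<n. K a b * (1 * mean_det J (bump N a b) + (-1) * mean_det J N))))"
      by (intro jdiff_lin jdiff_sum jdiff_bump jd) auto
    also have "(\<lambda>N. of_real (Zr r) * mean_det J N + (of_real (Zr r) * of_real (k r)) * (\<Sum>a<n. 1 *
      (\<Sum>b<n. K a b * (1 * mean_det J (bump N a b) + (-1) * mean_det J N)))) = mean_det (insert r J)"
      by (rule ext) (simp add: ins distrib_left mult.assoc)
    finally show ?thesis .
  qed
  moreover have "mean_det (insert r J) (base \<tau> \<sigma>) = of_real (\<Prod>j\<in>insert r J. Zr j) * closed_form (insert r J) \<tau> \<sigma>" for \<tau> \<sigma>
  proof -
    define pz where "pz = complex_of_real (\<Prod>j\<in>J. Zr j)"
    define Dv where "Dv = (\<Sum>a<n. \<Sum>b<n. K a b * (mean_det J (bump (base \<tau> \<sigma>) a b) - mean_det J (base \<tau> \<sigma>)))"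
    have IH: "mean_det J (base \<tau> \<sigma>) = pz * closed_form J \<tau> \<sigma>" for \<tau> \<sigma>
      using insert.IH unfolding pz_def by blast
    have prod: "of_real (\<Prod>j\<in>insert r J. Zr j) = of_real (Zr r) * pz"
      using insert.hyps by (simp add: pz_def)
    have move: "(\<lambda>a b. base \<tau> \<sigma> a b + e * K a b) = base (\<tau> + e) (\<sigma> + ?c * e)" for e
      by (auto simp: base_def K_def fun_eq_iff algebra_simps)
    have D: "((\<lambda>e. pz * closed_form J (\<tau> + e) (\<sigma> + ?c * e)) has_field_derivative Dv) (at 0)"
      using jd[unfolded jdiff_def, rule_format, of "base \<tau> \<sigma>" K] unfolding move IH[symmetric] Dv_def .
    have ins': "mean_det (insert r J) (base \<tau> \<sigma>) = of_real (Zr r) * (pz * closed_form J \<tau> \<sigma> + of_real (k r) * Dv)"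
      unfolding ins Dv_def IH ..
    show ?thesis
    \<comment> \<open>The product \<open>pz\<close> is divided out of the derivative; if it is 0,
      both sides vanish.\<close>
    proof (cases "pz = 0")
      case True
      hence "Dv = 0" using DERIV_unique[OF D, of 0] by simp
      thus ?thesis unfolding ins' prod using True by simp
    next
      case False
      hence "((\<lambda>e. closed_form J (\<tau> + e) (\<sigma> + ?c * e)) has_field_derivative Dv / pz) (at 0)"
        using DERIV_cdivide[OF D, of pz] by simp
      from closed_form_insert[OF insert.hyps this] show ?thesis
        unfolding ins' prod using False by (simp add: distrib_left)
    qed
  qed
  ultimately show ?case by blast
qed

end

section \<open>Laplace transforms on the half-line\<close>

text \<open>A class closed under sums, products with bounded measurable functions and multiplication
  by the variable, in which integrability and vanishing boundary terms at infinity come for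
  free.\<close>

definition decaying :: "(real \<Rightarrow> real) \<Rightarrow> bool" where
  "decaying h \<longleftrightarrow> h \<in> borel_measurable borel \<and> (\<exists>C b. 0 < b \<and> (\<forall>r\<ge>0. \<bar>h r\<bar> \<le> C * exp (- b * r)))"

lemma decayingI:
  "h \<in> borel_measurable borel \<Longrightarrow> 0 < b \<Longrightarrow> (\<And>r. 0 \<le> r \<Longrightarrow> \<bar>h r\<bar> \<le> C * exp (- b * r)) \<Longrightarrow> decaying h"
  unfolding decaying_def by blast

lemma decaying_measurable [measurable_dest]: "decaying h \<Longrightarrow> h \<in> borel_measurable borel"
  by (simp add: decaying_def)

lemma decaying_exp: "0 < a \<Longrightarrow> decaying (\<lambda>r. exp (- (r / a)))"
  by (rule decayingI[of _ "1 / a" 1]) auto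

lemma decaying_zero: "decaying (\<lambda>_. 0)"
  by (rule decayingI[of _ 1 0]) auto

lemma decaying_mult_bounded:
  assumes "decaying h" "f \<in> borel_measurable borel" "\<And>r. 0 \<le> r \<Longrightarrow> \<bar>f r\<bar> \<le> K"
  shows "decaying (\<lambda>r. f r * h r)"
proof -
  from assms(1) obtain C b where b: "0 < b" "\<And>r. 0 \<le> r \<Longrightarrow> \<bar>h r\<bar> \<le> C * exp (- b * r)"
    and [measurable]: "h \<in> borel_measurable borel" unfolding decaying_def by blast
  show ?thesis
  proof (rule decayingI[of _ b "K * C"])
    fix r :: real assume r: "0 \<le> r"
    have "\<bar>f r\<bar> * \<bar>h r\<bar> \<le> K * (C * exp (- b * r))"
      using assms(3)[OF r] b(2)[OF r] by (intro mult_mono) (auto intro: order.trans[OF abs_ge_zero])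
    thus "\<bar>f r * h r\<bar> \<le> K * C * exp (- b * r)" by (simp add: abs_mult mult.assoc)
  qed (use assms b in auto)
qed

lemma decaying_cmult: "decaying h \<Longrightarrow> decaying (\<lambda>r. c * h r)"
  by (rule decaying_mult_bounded[where K = "\<bar>c\<bar>"]) auto

lemma decaying_add:
  assumes "decaying h" "decaying k"
  shows "decaying (\<lambda>r. h r + k r)"
proof -
  from assms(1) obtain C b where b: "0 < b" "\<And>r. 0 \<le> r \<Longrightarrow> \<bar>h r\<bar> \<le> C * exp (- b * r)"
    and [measurable]: "h \<in> borel_measurable borel" unfolding decaying_def by blast
  from assms(2) obtain C' b' where b': "0 < b'" "\<And>r. 0 \<le> r \<Longrightarrow> \<bar>k r\<bar> \<le> C' * exp (- b' * r)"
    and [measurable]: "k \<in> borel_measurable borel" unfolding decaying_def by blast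
  have C: "0 \<le> C" "0 \<le> C'" using b(2)[of 0] b'(2)[of 0] by auto
  show ?thesis
  proof (rule decayingI[of _ "min b b'" "C + C'"])
    fix r :: real assume r: "0 \<le> r"
    have "C * exp (- b * r) \<le> C * exp (- min b b' * r)" "C' * exp (- b' * r) \<le> C' * exp (- min b b' * r)"
      using C r by (auto intro!: mult_left_mono mult_right_mono)
    thus "\<bar>h r + k r\<bar> \<le> (C + C') * exp (- min b b' * r)"
      using b(2)[OF r] b'(2)[OF r] by (simp add: algebra_simps)
  qed (use b b' in auto)
qed

lemma decaying_diff: "decaying h \<Longrightarrow> decaying k \<Longrightarrow> decaying (\<lambda>r. h r - k r)"
  using decaying_add[of h "\<lambda>r. - 1 * k r"] decaying_cmult[of k "- 1"] by simp

lemma decaying_sum: "(\<And>i. i \<in> A \<Longrightarrow> decaying (h i)) \<Longrightarrow> decaying (\<lambda>r. \<Sum>i\<in>A. h i r)"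
  by (induction A rule: infinite_finite_induct) (auto intro: decaying_zero decaying_add)

lemma decaying_times_id:
  assumes "decaying h"
  shows "decaying (\<lambda>r. r * h r)"
proof -
  from assms obtain C b where b: "0 < b" "\<And>r. 0 \<le> r \<Longrightarrow> \<bar>h r\<bar> \<le> C * exp (- b * r)"
    and [measurable]: "h \<in> borel_measurable borel" unfolding decaying_def by blast
  have C: "0 \<le> C" using b(2)[of 0] by auto
  show ?thesis
  proof (rule decayingI[of _ "b / 2" "2 / b * C"])
    fix r :: real assume r: "0 \<le> r"
    have "b * r / 2 \<le> exp (b * r / 2)" using exp_ge_add_one_self[of "b * r / 2"] by linarith
    hence "r \<le> 2 / b * exp (b * r / 2)" using b(1) by (simp add: field_simps)
    hence "r * \<bar>h r\<bar> \<le> (2 / b * exp (b * r / 2)) * (C * exp (- b * r))"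
      using b r by (intro mult_mono) auto
    also have "\<dots> = 2 / b * C * (exp (b * r / 2) * exp (- b * r))" by simp
    also have "exp (b * r / 2) * exp (- b * r) = exp (- (b / 2) * r)"
      by (simp add: exp_add[symmetric])
    finally show "\<bar>r * h r\<bar> \<le> 2 / b * C * exp (- (b / 2) * r)" using r by (simp add: abs_mult)
  qed (use b in auto)
qed

lemma decaying_integrable:
  assumes "decaying h"
  shows "set_integrable lborel {0<..} h"
proof -
  from assms obtain C b where b: "0 < b" "\<And>r. 0 \<le> r \<Longrightarrow> \<bar>h r\<bar> \<le> C * exp (- b * r)"
    and [measurable]: "h \<in> borel_measurable borel" unfolding decaying_def by blast
  have "integrable lborel (\<lambda>r. C * (exponential_density b r / b))"
    using b(1) prob_space_exponential_density[OF b(1)]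
    by (intro integrable_mult_right integrable_divide) 
       (auto simp: integrable_iff_bounded nn_integral_density prob_space.emeasure_space_1 
         dest!: prob_space.emeasure_space_1 simp: emeasure_density exponential_density_nonneg)
  thus ?thesis unfolding set_integrable_def
  proof (rule Bochner_Integration.integrable_bound)
    show "AE r in lborel. norm (indicator {0<..} r *\<^sub>R h r) \<le> norm (C * (exponential_density b r / b))"
    proof (rule AE_I2)
      fix r :: real
      show "norm (indicator {0<..} r *\<^sub>R h r) \<le> norm (C * (exponential_density b r / b))"
      proof (cases "0 < r")
        case True
        hence "C * (exponential_density b r / b) = C * exp (- b * r)"
          using b(1) by (simp add: exponential_density_def mult.commute)
        thus ?thesis using True b(2)[of r] by (simp add: order.trans[OF _ abs_ge_self])
      qed simp
    qed
  qed measurable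
qed

lemma decaying_lim:
  assumes "decaying h"
  shows "(h \<longlongrightarrow> 0) at_top"
proof -
  from assms obtain C b where b: "0 < b" "\<And>r. 0 \<le> r \<Longrightarrow> \<bar>h r\<bar> \<le> C * exp (- b * r)"
    unfolding decaying_def by blast
  have "((\<lambda>r. C * exp (- b * r)) \<longlongrightarrow> C * 0) at_top"
    using b(1) by (intro tendsto_mult tendsto_const filterlim_compose[OF exp_at_bot]
        filterlim_tendsto_neg_mult_at_bot[OF tendsto_const _ filterlim_ident]) auto
  hence "((\<lambda>r. C * exp (- b * r)) \<longlongrightarrow> 0) at_top" by simp
  moreover have "eventually (\<lambda>r. norm (h r) \<le> C * exp (- b * r)) at_top"
    using eventually_ge_at_top[of 0] by eventually_elim (use b(2) in auto)
  ultimately show ?thesis by (rule Lim_null_comparison[rotated])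
qed

text \<open>The shape in which integration by parts is used: an antiderivative is given and decays,
  so only the boundary term at 0 survives.\<close>

lemma decaying_FTC:
  fixes F F' :: "real \<Rightarrow> real"
  assumes "\<And>r. 0 \<le> r \<Longrightarrow> (F has_real_derivative F' r) (at r)"
    and "\<And>r. 0 < r \<Longrightarrow> isCont F' r" and "decaying F" "decaying F'"
  shows "(LBINT r:{0<..}. F' r) = - F 0"
proof -
  have "(LBINT r=ereal 0..\<infinity>. F' r) = 0 - F 0"
  proof (rule interval_integral_FTC_integrable[where F = F])
    show "set_integrable lborel (einterval (ereal 0) \<infinity>) F'"
      using decaying_integrable[OF assms(4)] by simp
    have "(F \<longlongrightarrow> F 0) (at 0)" using assms(1)[of 0] DERIV_isCont isCont_def by blast
    hence "(F \<longlongrightarrow> F 0) (at_right 0)" by (rule filterlim_mono) (auto simp: at_le)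
    thus "((F \<circ> real_of_ereal) \<longlongrightarrow> F 0) (at_right (ereal 0))"
      by (simp add: ereal_tendsto_simps1)
    show "((F \<circ> real_of_ereal) \<longlongrightarrow> 0) (at_left \<infinity>)"
      using decaying_lim[OF assms(3)] by (simp add: ereal_tendsto_simps1)
  qed (use assms in \<open>auto simp: has_real_derivative_iff_has_vector_derivative[symmetric]\<close>)
  thus ?thesis by (simp add: interval_integral_to_infinity_eq)
qed

lemma set_integral_sum:
  fixes h :: "'b \<Rightarrow> real \<Rightarrow> real"
  assumes "finite I" "\<And>i. i \<in> I \<Longrightarrow> set_integrable lborel A (h i)"
  shows "(LBINT r:A. \<Sum>i\<in>I. h i r) = (\<Sum>i\<in>I. LBINT r:A. h i r)"
  using assms unfolding set_integrable_def set_lebesgue_integral_def scaleR_sum_right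
  by (intro Bochner_Integration.integral_sum) auto

lemma integral_exp:
  fixes a :: real
  assumes "0 < a"
  shows "(LBINT r:{0<..}. exp (- (r / a))) = a"
    and "(LBINT r:{0<..}. r * exp (- (r / a))) = a\<^sup>2"
proof -
  have "(LBINT r:{0<..}. exp (- (r / a))) = - (- a * exp (- (0 / a)))"
    by (rule decaying_FTC)
       (use assms in \<open>auto intro!: derivative_eq_intros continuous_intros decaying_exp decaying_cmult[of _ "- a", simplified]\<close>)
  thus "(LBINT r:{0<..}. exp (- (r / a))) = a" by simp
  have "(LBINT r:{0<..}. r * exp (- (r / a))) = - (- a * (0 * exp (- (0 / a)) + a * exp (- (0 / a))))"
  proof (rule decaying_FTC)
    show "decaying (\<lambda>r. - a * (r * exp (- (r / a)) + a * exp (- (r / a))))"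
      by (intro decaying_cmult decaying_add decaying_times_id decaying_exp assms)
    show "decaying (\<lambda>r. r * exp (- (r / a)))"
      by (intro decaying_times_id decaying_exp assms)
  qed (use assms in \<open>auto intro!: derivative_eq_intros continuous_intros simp: algebra_simps\<close>)
  thus "(LBINT r:{0<..}. r * exp (- (r / a))) = a\<^sup>2" by (simp add: power2_eq_square)
qed

section \<open>Inverse Laplace transforms of the partial fractions\<close>

context distinct_scales
begin

text \<open>The inverse Laplace transform of \<open>f k\<close>. For \<open>k = 0\<close> and at
  least one scale it is the tail function of a sum of independent exponential variables with means
  \<open>a j\<close>, and \<open>g\<close> is the density of that sum.\<close>

definition G :: "nat \<Rightarrow> real \<Rightarrow> real" where
  "G k r = (\<Sum>j<n. alpha j * er k j * exp (- (r / a j)))"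

definition g :: "real \<Rightarrow> real" where
  "g r = (\<Sum>j<n. alpha j / a j * exp (- (r / a j)))"

lemma DERIV_cmult_exp:
  "((\<lambda>r. c * exp (- (r / b))) has_real_derivative c * (exp (- (r / b)) * (- 1 / b))) (at r)" for c b :: real
proof -
  have "((\<lambda>r. exp (- (r / b))) has_real_derivative exp (- (r / b)) * (- 1 / b)) (at r)"
    by (rule DERIV_chain'[where f = "\<lambda>r. - (r / b)" and g = exp, OF _ DERIV_exp, THEN DERIV_cong])
       (auto intro!: derivative_eq_intros simp: divide_inverse)
  thus ?thesis by (rule DERIV_cmult)
qed

text \<open>The counterpart of \<open>f_Suc\<close> before the Laplace transform: multiplication by
  \<open>s\<close> corresponds to differentiation, and \<open>1 / P\<close> to
  \<open>g\<close>.\<close>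

lemma DERIV_G_Suc: "(G (Suc k) has_real_derivative G k r - e (Suc k) * g r) (at r)"
proof -
  have "(G (Suc k) has_real_derivative (\<Sum>j<n. alpha j * er (Suc k) j * (exp (- (r / a j)) * (- 1 / a j)))) (at r)"
    unfolding G_def by (intro DERIV_sum DERIV_cmult_exp)
  also have "(\<Sum>j<n. alpha j * er (Suc k) j * (exp (- (r / a j)) * (- 1 / a j))) = G k r - e (Suc k) * g r"
    unfolding G_def g_def sum_distrib_left sum_subtractf[symmetric]
  proof (intro sum.cong refl)
    fix j assume "j \<in> {..<n}"
    hence j: "j < n" by simp
    show "alpha j * er (Suc k) j * (exp (- (r / a j)) * (- 1 / a j)) =
      alpha j * er k j * exp (- (r / a j)) - e (Suc k) * (alpha j / a j * exp (- (r / a j)))"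
      using pos[OF j] unfolding e_Suc[OF j] by (simp add: field_simps)
  qed
  finally show ?thesis .
qed

lemma DERIV_G_0: "(G 0 has_real_derivative - g r) (at r)"
proof -
  have "(G 0 has_real_derivative (\<Sum>j<n. alpha j * er 0 j * (exp (- (r / a j)) * (- 1 / a j)))) (at r)"
    unfolding G_def by (intro DERIV_sum DERIV_cmult_exp)
  thus ?thesis by (simp add: g_def er_0 sum_negf mult_ac)
qed

lemma G_at_0: "0 < n \<Longrightarrow> G k 0 = (if k = 0 then 1 else 0)"
  using sum_alpha_er[of k] by (simp add: G_def)

lemma decaying_G: "decaying (G k)" and decaying_g: "decaying g"
  unfolding G_def g_def by (intro decaying_sum decaying_cmult decaying_exp pos, simp)+

lemma isCont_G: "isCont (G k) r" and isCont_g: "isCont g r"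
  unfolding G_def g_def using pos by (auto intro!: continuous_intros dest: pos)

lemma laplace_exp:
  assumes "j < n" "0 \<le> s"
  shows "(LBINT r:{0<..}. exp (- (r / a j)) * exp (- (r * s))) = a j / (1 + a j * s)"
    and "(LBINT r:{0<..}. r * (exp (- (r / a j)) * exp (- (r * s)))) = (a j / (1 + a j * s))\<^sup>2"
    and "decaying (\<lambda>r. exp (- (r / a j)) * exp (- (r * s)))"
proof -
  have b: "0 < a j / (1 + a j * s)" using pos[OF assms(1)] one_plus_pos[OF assms] by simp
  have *: "exp (- (r / a j)) * exp (- (r * s)) = exp (- (r / (a j / (1 + a j * s))))" for r
    using pos[OF assms(1)] one_plus_pos[OF assms] by (simp add: exp_add[symmetric] field_simps)
  show "(LBINT r:{0<..}. exp (- (r / a j)) * exp (- (r * s))) = a j / (1 + a j * s)"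
   "(LBINT r:{0<..}. r * (exp (- (r / a j)) * exp (- (r * s)))) = (a j / (1 + a j * s))\<^sup>2"
   "decaying (\<lambda>r. exp (- (r / a j)) * exp (- (r * s)))"
    unfolding * by (rule integral_exp[OF b] decaying_exp[OF b])+
qed

lemma laplace_g:
  assumes "0 < n" "0 \<le> s"
  shows "(LBINT r:{0<..}. g r * exp (- (r * s))) = 1 / P s"
proof -
  have "(LBINT r:{0<..}. g r * exp (- (r * s))) =
     (LBINT r:{0<..}. \<Sum>j<n. alpha j / a j * (exp (- (r / a j)) * exp (- (r * s))))"
    by (simp add: g_def sum_distrib_right mult.assoc)
  also have "\<dots> = (\<Sum>j<n. LBINT r:{0<..}. alpha j / a j * (exp (- (r / a j)) * exp (- (r * s))))"
    by (intro set_integral_sum decaying_integrable decaying_cmult laplace_exp assms) auto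
  also have "\<dots> = (\<Sum>j<n. alpha j / a j * (a j / (1 + a j * s)))"
    by (intro sum.cong refl) (simp only: set_integral_mult_right laplace_exp(1)[OF _ assms(2)] lessThan_iff)
  also have "\<dots> = (\<Sum>j<n. alpha j / (1 + a j * s))"
    by (intro sum.cong refl) (use pos in force)
  finally show ?thesis unfolding inverse_P[OF assms] .
qed

text \<open>\<open>G k\<close> transforms into \<open>f k\<close>, and multiplication by
  \<open>r\<close> into minus the derivative, so this is \<open>d_eq\<close>.\<close>

lemma laplace_d:
  assumes "0 < n" "0 \<le> s"
  shows "(LBINT r:{0<..}. (r * G k r - real (Suc k) * G (Suc k) r) * exp (- (r * s))) = d k s"
proof -
  have "(LBINT r:{0<..}. (r * G k r - real (Suc k) * G (Suc k) r) * exp (- (r * s))) =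
     (LBINT r:{0<..}. (\<Sum>j<n. alpha j * er k j * (r * (exp (- (r / a j)) * exp (- (r * s))))) -
       real (Suc k) * (\<Sum>j<n. alpha j * er (Suc k) j * (exp (- (r / a j)) * exp (- (r * s)))))"
    by (intro set_lebesgue_integral_cong)
       (auto simp: G_def sum_distrib_left sum_distrib_right left_diff_distrib
         right_diff_distrib mult_ac)
  also have "\<dots> = (LBINT r:{0<..}. (\<Sum>j<n. alpha j * er k j * (r * (exp (- (r / a j)) * exp (- (r * s)))))) -
       (LBINT r:{0<..}. real (Suc k) * (\<Sum>j<n. alpha j * er (Suc k) j * (exp (- (r / a j)) * exp (- (r * s)))))"
    by (intro set_integral_diff decaying_integrable decaying_sum decaying_cmult decaying_times_id laplace_exp assms) auto
  also have "(LBINT r:{0<..}. (\<Sum>j<n. alpha j * er k j * (r * (exp (- (r / a j)) * exp (- (r * s)))))) =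
      (\<Sum>j<n. LBINT r:{0<..}. alpha j * er k j * (r * (exp (- (r / a j)) * exp (- (r * s)))))"
    by (intro set_integral_sum decaying_integrable decaying_cmult decaying_times_id laplace_exp assms) auto
  also have "\<dots> = (\<Sum>j<n. alpha j * er k j * (a j / (1 + a j * s))\<^sup>2)"
    by (intro sum.cong refl) (simp only: set_integral_mult_right laplace_exp(2)[OF _ assms(2)] lessThan_iff)
  also have "(LBINT r:{0<..}. real (Suc k) * (\<Sum>j<n. alpha j * er (Suc k) j * (exp (- (r / a j)) * exp (- (r * s))))) =
      real (Suc k) * (\<Sum>j<n. LBINT r:{0<..}. alpha j * er (Suc k) j * (exp (- (r / a j)) * exp (- (r * s))))"
    by (subst set_integral_mult_right, intro arg_cong2[where f = "(*)"] refl set_integral_sum decaying_integrable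
        decaying_cmult laplace_exp assms) auto
  also have "(\<Sum>j<n. LBINT r:{0<..}. alpha j * er (Suc k) j * (exp (- (r / a j)) * exp (- (r * s)))) =
      (\<Sum>j<n. alpha j * er (Suc k) j * (a j / (1 + a j * s)))"
    by (intro sum.cong refl) (simp only: set_integral_mult_right laplace_exp(1)[OF _ assms(2)] lessThan_iff)
  also have "(\<Sum>j<n. alpha j * er k j * (a j / (1 + a j * s))\<^sup>2) -
      real (Suc k) * (\<Sum>j<n. alpha j * er (Suc k) j * (a j / (1 + a j * s))) = d k s"
    unfolding d_eq[OF assms] f_def f'_def by (simp add: power_divide mult.assoc)
  finally show ?thesis .
qed

end

section \<open>Half-line integrals representing the exponential integral\<close>

lemma has_real_derivative_quadratic_bound:
  fixes f :: "real \<Rightarrow> real"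
  assumes "\<And>y. y \<in> S \<Longrightarrow> \<bar>f y - f x - D * (y - x)\<bar> \<le> K * (y - x)\<^sup>2"
  shows "(f has_real_derivative D) (at x within S)"
proof -
  have "((\<lambda>y. (f y - f x) / (y - x) - D) \<longlongrightarrow> 0) (at x within S)"
  proof (rule Lim_null_comparison)
    show "eventually (\<lambda>y. norm ((f y - f x) / (y - x) - D) \<le> K * \<bar>y - x\<bar>) (at x within S)"
      unfolding eventually_at_topological
    proof (intro exI[of _ UNIV] conjI ballI impI)
      fix y assume y: "y \<noteq> x" "y \<in> S"
      have "(f y - f x) / (y - x) - D = (f y - f x - D * (y - x)) / (y - x)"
        using y by (simp add: field_simps)
      also have "norm \<dots> = \<bar>f y - f x - D * (y - x)\<bar> / \<bar>y - x\<bar>" by (simp add: abs_divide)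
      also have "\<dots> \<le> K * (y - x)\<^sup>2 / \<bar>y - x\<bar>" using assms[OF y(2)] by (rule divide_right_mono) simp
      also have "(y - x)\<^sup>2 = \<bar>y - x\<bar> * \<bar>y - x\<bar>" by (simp add: power2_eq_square)
      also have "K * (\<bar>y - x\<bar> * \<bar>y - x\<bar>) / \<bar>y - x\<bar> = K * \<bar>y - x\<bar>"
      proof -
        have "K * (t * t) / t = K * t" for t by simp
        thus ?thesis .
      qed
      finally show "norm ((f y - f x) / (y - x) - D) \<le> K * \<bar>y - x\<bar>" .
    qed auto
    have "((\<lambda>y. K * \<bar>y - x\<bar>) \<longlongrightarrow> K * \<bar>x - x\<bar>) (at x within S)" by (intro tendsto_intros)
    thus "((\<lambda>y. K * \<bar>y - x\<bar>) \<longlongrightarrow> 0) (at x within S)" by simp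
  qed
  hence "((\<lambda>y. (f y - f x) / (y - x)) \<longlongrightarrow> D) (at x within S)" by (rule LIM_zero_cancel)
  thus ?thesis by (simp add: has_field_derivative_iff)
qed

text \<open>For \<open>t = 1 / (x * a * b)\<close> the product \<open>x * stieltjes a b x\<close> is
  \<open>exp t * exp_integral_E1 t\<close>; unlike the latter expression, the integral is meaningful
  at \<open>x = 0\<close> and has a one-sided derivative there.\<close>

definition stieltjes :: "real \<Rightarrow> real \<Rightarrow> real \<Rightarrow> real" where
  "stieltjes a b x = (LBINT r:{0<..}. b / (1 + b * (x * r)) * exp (- (r / a)))"

definition stieltjes' :: "real \<Rightarrow> real \<Rightarrow> real \<Rightarrow> real" where
  "stieltjes' a b x = (LBINT r:{0<..}. - (b\<^sup>2 / (1 + b * (x * r))\<^sup>2) * (r * exp (- (r / a))))"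

lemma stieltjes_bounds:
  assumes "0 < b" "0 \<le> x" "0 \<le> (r::real)"
  shows "0 < 1 + b * (x * r)" "\<bar>b / (1 + b * (x * r))\<bar> \<le> b" "\<bar>- (b\<^sup>2 / (1 + b * (x * r))\<^sup>2)\<bar> \<le> b\<^sup>2"
proof -
  have 1: "1 \<le> 1 + b * (x * r)" using assms by simp
  thus "0 < 1 + b * (x * r)" by linarith
  have p: "0 < 1 + b * (x * r)" using 1 by linarith
  have "b * 1 \<le> b * (1 + b * (x * r))" using 1 assms by (intro mult_left_mono) auto
  hence "b / (1 + b * (x * r)) \<le> b" by (simp add: pos_divide_le_eq[OF p])
  thus "\<bar>b / (1 + b * (x * r))\<bar> \<le> b" using 1 assms by simp
  have "1 \<le> (1 + b * (x * r))\<^sup>2" using 1 by (rule one_le_power)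
  thus "\<bar>- (b\<^sup>2 / (1 + b * (x * r))\<^sup>2)\<bar> \<le> b\<^sup>2" using assms(1)
    by (simp add: divide_le_eq mult_le_cancel_left1)
qed

lemma decaying_stieltjes:
  assumes "0 < a" "0 < b" "0 \<le> x"
  shows "decaying (\<lambda>r. b / (1 + b * (x * r)) * exp (- (r / a)))"
    "decaying (\<lambda>r. - (b\<^sup>2 / (1 + b * (x * r))\<^sup>2) * (r * exp (- (r / a))))"
proof -
  show "decaying (\<lambda>r. b / (1 + b * (x * r)) * exp (- (r / a)))"
    by (rule decaying_mult_bounded[OF decaying_exp[OF assms(1)]], measurable)
       (rule stieltjes_bounds(2)[OF assms(2,3)])
  show "decaying (\<lambda>r. - (b\<^sup>2 / (1 + b * (x * r))\<^sup>2) * (r * exp (- (r / a))))"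
    by (rule decaying_mult_bounded[OF decaying_times_id[OF decaying_exp[OF assms(1)]]], measurable)
       (rule stieltjes_bounds(3)[OF assms(2,3)])
qed

text \<open>Differentiation under the integral with an explicit remainder: for
  \<open>p = 1 + b * (x * r)\<close> and \<open>q = 1 + b * (y * r)\<close> the error of the linear
  approximation is exactly \<open>b * (q - p)^2 / (q * p^2)\<close>, and dropping the denominator,
  which is at least 1, leaves an integrable multiple of \<open>(y - x)^2\<close>.\<close>

lemma DERIV_stieltjes:
  assumes "0 < a" "0 < b" "0 \<le> x"
  shows "(stieltjes a b has_real_derivative stieltjes' a b x) (at x within {0..})"
proof (rule has_real_derivative_quadratic_bound)
  fix y :: real assume "y \<in> {0..}"
  hence y: "0 \<le> y" by simp
  let ?C = "b ^ 3 * (y - x)\<^sup>2"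
  let ?K = "LBINT r:{0<..}. b ^ 3 * (r * (r * exp (- (r / a))))"
  define hh where "hh = (\<lambda>r. b / (1 + b * (y * r)) * exp (- (r / a)) - b / (1 + b * (x * r)) * exp (- (r / a)) -
      (y - x) * (- (b\<^sup>2 / (1 + b * (x * r))\<^sup>2) * (r * exp (- (r / a)))))"
  have h: "decaying hh" unfolding hh_def
    by (intro decaying_diff decaying_cmult decaying_stieltjes assms y)
  have k: "decaying (\<lambda>r. b ^ 3 * (r * (r * exp (- (r / a)))))"
    by (intro decaying_cmult decaying_times_id decaying_exp assms)
  have "(LBINT r:{0<..}. hh r) = (LBINT r:{0<..}. b / (1 + b * (y * r)) * exp (- (r / a)) -
      b / (1 + b * (x * r)) * exp (- (r / a))) -
      (LBINT r:{0<..}. (y - x) * (- (b\<^sup>2 / (1 + b * (x * r))\<^sup>2) * (r * exp (- (r / a)))))"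
    unfolding hh_def by (intro set_integral_diff decaying_integrable decaying_diff decaying_cmult decaying_stieltjes assms y)
  also have "(LBINT r:{0<..}. b / (1 + b * (y * r)) * exp (- (r / a)) - b / (1 + b * (x * r)) * exp (- (r / a))) =
      stieltjes a b y - stieltjes a b x"
    unfolding stieltjes_def by (intro set_integral_diff decaying_integrable decaying_stieltjes assms y)
  also have "(LBINT r:{0<..}. (y - x) * (- (b\<^sup>2 / (1 + b * (x * r))\<^sup>2) * (r * exp (- (r / a))))) =
      stieltjes' a b x * (y - x)"
    unfolding stieltjes'_def by (subst set_integral_mult_right) (rule mult.commute)
  finally have "stieltjes a b y - stieltjes a b x - stieltjes' a b x * (y - x) = (LBINT r:{0<..}. hh r)" ..
  also have "\<bar>\<dots>\<bar> \<le> (LBINT r:{0<..}. \<bar>hh r\<bar>)"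
    using set_integral_norm_bound[OF decaying_integrable[OF h]] by simp
  also have "\<dots> \<le> (LBINT r:{0<..}. (y - x)\<^sup>2 * (b ^ 3 * (r * (r * exp (- (r / a))))))"
  proof (rule set_integral_mono)
    show "set_integrable lborel {0<..} (\<lambda>r. \<bar>hh r\<bar>)"
      by (rule set_integrable_abs[OF decaying_integrable[OF h]])
    show "set_integrable lborel {0<..} (\<lambda>r. (y - x)\<^sup>2 * (b ^ 3 * (r * (r * exp (- (r / a))))))"
      by (intro decaying_integrable decaying_cmult k)
    fix r :: real assume "r \<in> {0<..}"
    hence r: "0 \<le> r" by simp
    define p where "p = 1 + b * (x * r)"
    define q where "q = 1 + b * (y * r)"
    have p: "1 \<le> p" and q: "1 \<le> q" using assms y r by (auto simp: p_def q_def)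
    have qp: "q - p = b * r * (y - x)" by (simp add: p_def q_def algebra_simps)
    have "hh r = (b / q - b / p + b * (b * r * (y - x)) / p\<^sup>2) * exp (- (r / a))"
      by (simp add: hh_def p_def q_def algebra_simps power2_eq_square)
    also have "b / q - b / p + b * (b * r * (y - x)) / p\<^sup>2 = b * (q - p)\<^sup>2 / (q * p\<^sup>2)"
      using p q unfolding qp[symmetric] by (simp add: field_simps power2_eq_square)
    finally have "\<bar>hh r\<bar> = b * (q - p)\<^sup>2 / (q * p\<^sup>2) * exp (- (r / a))"
      using p q assms by (simp add: abs_mult)
    also have "1 \<le> q * p\<^sup>2" using p q mult_mono[of 1 q 1 "p\<^sup>2"] by (simp add: one_le_power)
    hence "b * (q - p)\<^sup>2 / (q * p\<^sup>2) * exp (- (r / a)) \<le> b * (q - p)\<^sup>2 * exp (- (r / a))"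
    proof -
      assume m: "1 \<le> q * p\<^sup>2"
      have "C / m \<le> C" if "1 \<le> m" "0 \<le> C" for C m :: real
        using that divide_left_mono[of 1 m C] by simp
      from this[OF m, of "b * (q - p)\<^sup>2"] show ?thesis
        using assms by (intro mult_right_mono) auto
    qed
    also have "\<dots> = (y - x)\<^sup>2 * (b ^ 3 * (r * (r * exp (- (r / a)))))"
      unfolding qp by (simp add: power2_eq_square power3_eq_cube)
    finally show "\<bar>hh r\<bar> \<le> (y - x)\<^sup>2 * (b ^ 3 * (r * (r * exp (- (r / a)))))" .
  qed
  also have "\<dots> = ?K * (y - x)\<^sup>2" by (subst set_integral_mult_right) simp
  finally show "\<bar>stieltjes a b y - stieltjes a b x - stieltjes' a b x * (y - x)\<bar> \<le> ?K * (y - x)\<^sup>2" .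
qed

lemma continuous_on_stieltjes':
  assumes "0 < a" "0 < b"
  shows "continuous_on {0..} (stieltjes' a b)"
proof (rule continuous_on_sequentiallyI)
  fix X and x :: real assume X: "\<forall>m. X m \<in> {0..}" "x \<in> {0..}" "X \<longlonglongrightarrow> x"
  have k: "set_integrable lborel {0<..} (\<lambda>r. b\<^sup>2 * (r * exp (- (r / a))))"
    by (intro decaying_integrable decaying_cmult decaying_times_id decaying_exp assms)
  show "(\<lambda>m. stieltjes' a b (X m)) \<longlonglongrightarrow> stieltjes' a b x"
    unfolding stieltjes'_def set_lebesgue_integral_def
  proof (rule integral_dominated_convergence[where w = "\<lambda>r. indicator {0<..} r *\<^sub>R (b\<^sup>2 * (r * exp (- (r / a))))"])
    show "integrable lborel (\<lambda>r. indicator {0<..} r *\<^sub>R (b\<^sup>2 * (r * exp (- (r / a)))))"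
      using k by (simp add: set_integrable_def)
    show "AE r in lborel. (\<lambda>m. indicator {0<..} r *\<^sub>R (- (b\<^sup>2 / (1 + b * (X m * r))\<^sup>2) * (r * exp (- (r / a)))))
      \<longlonglongrightarrow> indicator {0<..} r *\<^sub>R (- (b\<^sup>2 / (1 + b * (x * r))\<^sup>2) * (r * exp (- (r / a))))"
    proof (rule AE_I2)
      fix r :: real
      show "(\<lambda>m. indicator {0<..} r *\<^sub>R (- (b\<^sup>2 / (1 + b * (X m * r))\<^sup>2) * (r * exp (- (r / a)))))
        \<longlonglongrightarrow> indicator {0<..} r *\<^sub>R (- (b\<^sup>2 / (1 + b * (x * r))\<^sup>2) * (r * exp (- (r / a))))"
        using stieltjes_bounds(1)[of b x r] X assms
        by (cases "0 < r") (auto intro!: tendsto_intros X)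
    qed
    show "AE r in lborel. norm (indicator {0<..} r *\<^sub>R (- (b\<^sup>2 / (1 + b * (X m * r))\<^sup>2) * (r * exp (- (r / a)))))
      \<le> indicator {0<..} r *\<^sub>R (b\<^sup>2 * (r * exp (- (r / a))))" for m
    proof (rule AE_I2)
      fix r :: real
      show "norm (indicator {0<..} r *\<^sub>R (- (b\<^sup>2 / (1 + b * (X m * r))\<^sup>2) * (r * exp (- (r / a)))))
        \<le> indicator {0<..} r *\<^sub>R (b\<^sup>2 * (r * exp (- (r / a))))"
      proof (cases "0 < r")
        case True
        have "\<bar>c * E\<bar> \<le> B * E" if "\<bar>c\<bar> \<le> B" "0 \<le> E" for c E B :: real
          using that by (simp add: abs_mult mult_right_mono)
        from this[OF stieltjes_bounds(3)[of b "X m" r], of "r * exp (- (r / a))"] True X assms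
        show ?thesis by (simp add: less_imp_le)
      qed simp
    qed
  qed measurable
qed

text \<open>The substitution \<open>s = t + r / a\<close> with \<open>t = 1 / (x * a * b)\<close>
  turns the half-line above \<open>t\<close> into the positive one.\<close>

lemma stieltjes_E1:
  assumes "0 < a" "0 < b" "0 < x"
  shows "x * stieltjes a b x = exp (1 / (x * a * b)) * exp_integral_E1 (1 / (x * a * b))"
proof -
  define t where "t = 1 / (x * a * b)"
  have t: "0 < t" using assms by (simp add: t_def)
  have "exp_integral_E1 t = (LBINT s. indicator {t<..} s *\<^sub>R (exp (- s) / s))"
    unfolding exp_integral_E1_def set_lebesgue_integral_def
  proof (rule integral_cong_AE)
    show "AE s in lborel. indicator {t..} s *\<^sub>R (exp (- s) / s) = indicator {t<..} s *\<^sub>R (exp (- s) / s)"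
      using AE_lborel_singleton[of t] by eventually_elim (auto simp: indicator_def)
  qed measurable
  also have "\<dots> = \<bar>1 / a\<bar> *\<^sub>R (LBINT r. indicator {t<..} (t + 1 / a * r) *\<^sub>R (exp (- (t + 1 / a * r)) / (t + 1 / a * r)))"
    using assms by (intro lborel_integral_real_affine) simp
  also have "\<dots> = (LBINT r. x * exp (- t) * (indicator {0<..} r *\<^sub>R (b / (1 + b * (x * r)) * exp (- (r / a)))))"
    unfolding Bochner_Integration.integral_scaleR_right[symmetric]
  proof (rule Bochner_Integration.integral_cong[OF refl])
    fix r :: real
    show "\<bar>1 / a\<bar> *\<^sub>R (indicator {t<..} (t + 1 / a * r) *\<^sub>R (exp (- (t + 1 / a * r)) / (t + 1 / a * r))) =
      x * exp (- t) * (indicator {0<..} r *\<^sub>R (b / (1 + b * (x * r)) * exp (- (r / a))))"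
    proof (cases "0 < r")
      case True
      have "t + 1 / a * r = (1 + b * (x * r)) / (x * a * b)"
        using assms by (simp add: t_def field_simps)
      hence "1 / a * (1 / (t + 1 / a * r)) = x * (b / (1 + b * (x * r)))"
        using assms by simp
      moreover have "exp (- (t + 1 / a * r)) = exp (- t) * exp (- (r / a))"
        by (simp add: exp_add[symmetric])
      ultimately have "1 / a * (exp (- (t + 1 / a * r)) / (t + 1 / a * r)) =
          (exp (- t) * exp (- (r / a))) * (x * (b / (1 + b * (x * r))))"
        by (metis (no_types, opaque_lifting) mult.left_commute mult.right_neutral times_divide_eq_right)
      thus ?thesis using True assms by (simp add: mult_ac)
    next
      case False
      thus ?thesis using assms by (auto simp: indicator_def zero_less_divide_iff)
    qed
  qed
  also have "\<dots> = exp (- t) * (x * stieltjes a b x)"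
    unfolding stieltjes_def set_lebesgue_integral_def real_scaleR_def
    by (subst Bochner_Integration.integral_mult_right_zero) (simp only: mult_ac)
  finally have "exp t * exp_integral_E1 t = exp t * exp (- t) * (x * stieltjes a b x)" by simp
  thus ?thesis by (simp add: exp_add[symmetric] t_def)
qed

context distinct_scales
begin

lemma bounded_fraction: "j < n \<Longrightarrow> 0 \<le> s \<Longrightarrow> \<bar>c / (1 + a j * s)\<bar> \<le> \<bar>c\<bar>"
proof -
  assume "j < n" "0 \<le> s"
  hence 1: "1 \<le> 1 + a j * s" using pos[of j] by simp
  hence "\<bar>c\<bar> / (1 + a j * s) \<le> \<bar>c\<bar> / 1" by (intro divide_left_mono) auto
  thus ?thesis using 1 by (simp add: abs_divide)
qed

lemma f_bounded: "\<exists>K. \<forall>s\<ge>0. \<bar>f k s\<bar> \<le> K"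
proof (intro exI[of _ "\<Sum>j<n. \<bar>alpha j * er k j * a j\<bar>"] allI impI)
  fix s :: real assume "0 \<le> s"
  thus "\<bar>f k s\<bar> \<le> (\<Sum>j<n. \<bar>alpha j * er k j * a j\<bar>)"
    unfolding f_def by (intro order.trans[OF sum_abs] sum_mono bounded_fraction) auto
qed

lemma f'_bounded: "\<exists>K. \<forall>s\<ge>0. \<bar>f' k s\<bar> \<le> K"
proof (intro exI[of _ "\<Sum>j<n. \<bar>alpha j * er k j * (a j)\<^sup>2\<bar>"] allI impI)
  fix s :: real assume s: "0 \<le> s"
  have "\<bar>alpha j * er k j * (a j)\<^sup>2 / (1 + a j * s)\<^sup>2\<bar> \<le> \<bar>alpha j * er k j * (a j)\<^sup>2\<bar>" if "j < n" for j
  proof -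
    have "1 \<le> (1 + a j * s)\<^sup>2" using pos[OF that] s by (intro one_le_power) simp
    thus ?thesis by (simp add: abs_divide divide_le_eq mult_le_cancel_left1)
  qed
  thus "\<bar>f' k s\<bar> \<le> (\<Sum>j<n. \<bar>alpha j * er k j * (a j)\<^sup>2\<bar>)"
    unfolding f'_def abs_minus_cancel by (intro order.trans[OF sum_abs] sum_mono) auto
qed

lemma measurable_f [measurable]: "f k \<in> borel_measurable borel" "f' k \<in> borel_measurable borel"
  unfolding f_def f'_def by measurable

lemma decaying_f_mult:
  assumes "decaying h" "0 \<le> x"
  shows "decaying (\<lambda>r. f k (x * r) * h r)" "decaying (\<lambda>r. f' k (x * r) * h r)"
proof -
  obtain K where "\<And>s. 0 \<le> s \<Longrightarrow> \<bar>f k s\<bar> \<le> K" using f_bounded by blast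
  thus "decaying (\<lambda>r. f k (x * r) * h r)" using assms by (intro decaying_mult_bounded[where K = K]) auto
  obtain K' where "\<And>s. 0 \<le> s \<Longrightarrow> \<bar>f' k s\<bar> \<le> K'" using f'_bounded by blast
  thus "decaying (\<lambda>r. f' k (x * r) * h r)" using assms by (intro decaying_mult_bounded[where K = K']) auto
qed

lemma DERIV_f_scaled:
  assumes "0 \<le> x" "0 \<le> r"
  shows "((\<lambda>r. f k (x * r)) has_real_derivative x * f' k (x * r)) (at r)"
proof -
  have "((\<lambda>r. f k (x * r)) has_real_derivative f' k (x * r) * x) (at r)"
    by (rule DERIV_chain'[where f = "\<lambda>r. x * r"])
       (use assms in \<open>auto intro!: derivative_eq_intros DERIV_f\<close>)
  thus ?thesis by (simp add: mult.commute)
qed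

lemma isCont_f': "0 \<le> s \<Longrightarrow> isCont (f' k) s"
  unfolding f'_def using one_plus_pos by (intro continuous_intros) (auto simp: less_imp_neq[symmetric])

end

section \<open>The derivative of the mean log-determinant\<close>

locale two_scales = U: distinct_scales u R + V: distinct_scales v T
  for u R v T +
  assumes R: "0 < R" and T: "0 < T"
begin

text \<open>Pairs the two systems, \<open>f k\<close> for the scales \<open>v\<close> with
  \<open>G k\<close> for \<open>u\<close>; the factorial is the one of
  \<open>poly_diff_op_0\<close>.\<close>

definition Nk :: "nat \<Rightarrow> real \<Rightarrow> real" where
  "Nk k x = fact k * (LBINT r:{0<..}. V.f k (x * r) * U.G k r)"

definition Nk' :: "nat \<Rightarrow> real \<Rightarrow> real" where
  "Nk' k x = fact k * (LBINT r:{0<..}. V.f' k (x * r) * (r * U.G k r))"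

text \<open>Chosen so that \<open>x ^ k * Bk k x\<close> is the derivative of
  \<open>x ^ Suc k * Nk k x\<close>; the integrations by parts below yield exactly this
  combination.\<close>

definition Bk :: "nat \<Rightarrow> real \<Rightarrow> real" where
  "Bk k x = real (Suc k) * Nk k x + x * Nk' k x"

section \<open>Integration by parts for the mixed integrals\<close>

lemmas decaying_intros [intro] = decaying_diff decaying_add decaying_cmult decaying_times_id V.decaying_f_mult
  U.decaying_G U.decaying_g

lemma isCont_f_scaled:
  assumes "0 \<le> x" "0 \<le> r"
  shows "isCont (\<lambda>r. V.f k (x * r)) r" "isCont (\<lambda>r. V.f' k (x * r)) r"
proof -
  show "isCont (\<lambda>r. V.f k (x * r)) r" by (rule DERIV_isCont[OF V.DERIV_f_scaled[OF assms]])
  show "isCont (\<lambda>r. V.f' k (x * r)) r"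
    by (rule isCont_o2[where f = "\<lambda>r. x * r" and g = "V.f' k"]) (simp, rule V.isCont_f', use assms in simp)
qed

lemma mixture_0:
  assumes x: "0 \<le> x"
  shows "(LBINT r:{0<..}. U.g r / V.P (x * r)) = 1 - x * Bk 0 x"
proof -
  let ?A1 = "\<lambda>r. V.f 0 (x * r) * U.G 0 r" and ?A2 = "\<lambda>r. V.f' 0 (x * r) * (r * U.G 0 r)"
  \<comment> \<open>By \<open>V.f_0\<close> this is \<open>- U.G 0 r / V.P (x * r)\<close>, written
    without a quotient so that decay follows from the closure rules. Its value -1 at 0 is the source
    of the constant 1.\<close>
  let ?F = "\<lambda>r. x * (r * (V.f 0 (x * r) * U.G 0 r)) - U.G 0 r"
  let ?F' = "\<lambda>r. x * ?A1 r + x\<^sup>2 * ?A2 r - x * (r * (V.f 0 (x * r) * U.g r)) + U.g r"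
  have dA: "decaying ?A1" "decaying ?A2" and dF': "decaying ?F'" and dF: "decaying ?F"
    using x by (auto intro!: decaying_intros)
  have "(LBINT r:{0<..}. ?F' r) = - ?F 0"
  proof (rule decaying_FTC[OF _ _ dF dF'])
    fix r :: real assume "0 \<le> r"
    thus "(?F has_real_derivative ?F' r) (at r)"
      by - ((rule V.DERIV_f_scaled[OF x] U.DERIV_G_0 derivative_eq_intros refl | assumption)+,
        simp add: algebra_simps power2_eq_square)
  next
    fix r :: real assume "0 < r"
    thus "isCont ?F' r"
      using isCont_f_scaled[OF x, of r] by (intro continuous_intros U.isCont_G U.isCont_g) auto
  qed
  hence 1: "(LBINT r:{0<..}. ?F' r) = 1" using U.G_at_0[OF R] by simp
  have "(LBINT r:{0<..}. U.g r / V.P (x * r)) = (LBINT r:{0<..}. ?F' r - (x * ?A1 r + x\<^sup>2 * ?A2 r))"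
  proof (rule set_lebesgue_integral_cong)
    show "\<forall>r. r \<in> {0<..} \<longrightarrow> U.g r / V.P (x * r) = ?F' r - (x * ?A1 r + x\<^sup>2 * ?A2 r)"
    proof (intro allI impI)
      fix r :: real assume "r \<in> {0<..}"
      hence "1 / V.P (x * r) = 1 - (x * r) * V.f 0 (x * r)" using V.f_0[OF T, of "x * r"] x by simp
      hence "U.g r / V.P (x * r) = U.g r * (1 - (x * r) * V.f 0 (x * r))"
        by (metis times_divide_eq_right mult.right_neutral)
      thus "U.g r / V.P (x * r) = ?F' r - (x * ?A1 r + x\<^sup>2 * ?A2 r)" by (simp add: algebra_simps)
    qed
  qed simp
  also have "\<dots> = (LBINT r:{0<..}. ?F' r) - (x * (LBINT r:{0<..}. ?A1 r) + x\<^sup>2 * (LBINT r:{0<..}. ?A2 r))"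
  proof -
    have "(LBINT r:{0<..}. ?F' r - (x * ?A1 r + x\<^sup>2 * ?A2 r)) = (LBINT r:{0<..}. ?F' r) - (LBINT r:{0<..}. x * ?A1 r + x\<^sup>2 * ?A2 r)"
      by (rule set_integral_diff) (rule decaying_integrable, intro decaying_add decaying_cmult dA dF')+
    also have "(LBINT r:{0<..}. x * ?A1 r + x\<^sup>2 * ?A2 r) = (LBINT r:{0<..}. x * ?A1 r) + (LBINT r:{0<..}. x\<^sup>2 * ?A2 r)"
      by (rule set_integral_add) (rule decaying_integrable, intro decaying_cmult dA)+
    finally show ?thesis by (simp only: set_integral_mult_right)
  qed
  finally show ?thesis unfolding 1 by (simp add: Bk_def Nk_def Nk'_def algebra_simps power2_eq_square)
qed

text \<open>The left side will be the coefficient of \<open>y ^ Suc k\<close> in the ratio. After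
  \<open>d_eq\<close> and \<open>f_Suc\<close> its integrand is that of the right side plus a
  multiple of a derivative whose integral is 0.\<close>

lemma mixture_Suc:
  assumes x: "0 \<le> x"
  shows "fact (Suc k) * (U.e (Suc k) * V.e (Suc k)) * (LBINT r:{0<..}. U.g r / V.P (x * r)) -
     x * (fact k * (LBINT r:{0<..}. (r * U.G k r - real (Suc k) * U.G (Suc k) r) * V.d k (x * r))) =
     Bk k x - x * Bk (Suc k) x"
proof -
  let ?f0 = "\<lambda>r. V.f k (x * r)" and ?f1 = "\<lambda>r. V.f (Suc k) (x * r)"
  let ?f0' = "\<lambda>r. V.f' k (x * r)" and ?f1' = "\<lambda>r. V.f' (Suc k) (x * r)"
  let ?G0 = "U.G k" and ?G1 = "U.G (Suc k)"
  let ?A1 = "\<lambda>r. ?f0 r * ?G0 r" and ?A2 = "\<lambda>r. ?f0' r * (r * ?G0 r)"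
  let ?A3 = "\<lambda>r. ?f1 r * ?G1 r" and ?A4 = "\<lambda>r. ?f1' r * (r * ?G1 r)"
  let ?W = "\<lambda>r. ?G0 r - U.e (Suc k) * U.g r"
  \<comment> \<open>By \<open>V.f_Suc\<close> this is
    \<open>- V.e (Suc k) * U.G (Suc k) r / V.P (x * r)\<close>; it vanishes at 0 because
    \<open>U.G (Suc k) 0 = 0\<close>.\<close>
  let ?F = "\<lambda>r. x * (r * ?A3 r) - ?f0 r * ?G1 r"
  let ?F' = "\<lambda>r. x * ?A3 r + x\<^sup>2 * ?A4 r + x * (r * (?f1 r * ?W r)) - x * (?f0' r * ?G1 r) - ?f0 r * ?W r"
  let ?c = "fact k :: real" and ?k = "real (Suc k)"
  have dA: "decaying ?A1" "decaying ?A2" "decaying ?A3" "decaying ?A4"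
    and dF': "decaying ?F'" and dF: "decaying ?F"
    using x by (auto intro!: decaying_intros)
  have "(LBINT r:{0<..}. ?F' r) = - ?F 0"
  proof (rule decaying_FTC[OF _ _ dF dF'])
    fix r :: real assume "0 \<le> r"
    thus "(?F has_real_derivative ?F' r) (at r)"
      by - ((rule V.DERIV_f_scaled[OF x] U.DERIV_G_Suc derivative_eq_intros refl | assumption)+,
        simp add: algebra_simps power2_eq_square)
  next
    fix r :: real assume "0 < r"
    thus "isCont ?F' r"
      using isCont_f_scaled[OF x, of r] by (intro continuous_intros U.isCont_G U.isCont_g) auto
  qed
  hence 1: "(LBINT r:{0<..}. ?F' r) = 0" using U.G_at_0[OF R] by simp
  define X where "X = (\<lambda>r. U.g r / V.P (x * r))"
  define Y where "Y = (\<lambda>r. (r * ?G0 r - ?k * ?G1 r) * V.d k (x * r))"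
  have P: "X r = (1 - (x * r) * V.f 0 (x * r)) * U.g r" if "0 < r" for r
    using V.f_0[OF T, of "x * r"] x that by (simp add: X_def)
  have d: "V.d k (x * r) = - (?k * ?f1 r + ?f0' r)" if "0 < r" for r
    using V.d_eq[OF T, of "x * r" k] x that by simp
  have "set_integrable lborel {0<..} X"
  proof -
    have "decaying (\<lambda>r. U.g r - x * (r * (V.f 0 (x * r) * U.g r)))" using x by (auto intro!: decaying_intros)
    hence "set_integrable lborel {0<..} (\<lambda>r. U.g r - x * (r * (V.f 0 (x * r) * U.g r)))"
      by (rule decaying_integrable)
    moreover have "X r = U.g r - x * (r * (V.f 0 (x * r) * U.g r))" if "0 < r" for r
      unfolding P[OF that] by (simp add: algebra_simps)
    ultimately show ?thesis by (subst set_integrable_cong[OF refl refl]) auto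
  qed
  moreover have "set_integrable lborel {0<..} Y"
  proof -
    have "decaying (\<lambda>r. (-1) * (r * (?k * (?f1 r * ?G0 r) + ?f0' r * ?G0 r)) +
       ?k * (?k * (?f1 r * ?G1 r) + ?f0' r * ?G1 r))" using x by (intro decaying_intros; simp)
    hence "set_integrable lborel {0<..} (\<lambda>r. (-1) * (r * (?k * (?f1 r * ?G0 r) + ?f0' r * ?G0 r)) +
       ?k * (?k * (?f1 r * ?G1 r) + ?f0' r * ?G1 r))"
      by (rule decaying_integrable)
    moreover have "Y r = (-1) * (r * (?k * (?f1 r * ?G0 r) + ?f0' r * ?G0 r)) +
       ?k * (?k * (?f1 r * ?G1 r) + ?f0' r * ?G1 r)" if "0 < r" for r
      unfolding Y_def d[OF that] by (simp add: algebra_simps)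
    ultimately show ?thesis by (subst set_integrable_cong[OF refl refl]) auto
  qed
  ultimately have "fact (Suc k) * (U.e (Suc k) * V.e (Suc k)) * (LBINT r:{0<..}. X r) -
     x * (?c * (LBINT r:{0<..}. Y r)) =
     (LBINT r:{0<..}. fact (Suc k) * (U.e (Suc k) * V.e (Suc k)) * X r - x * ?c * Y r)"
    by (subst set_integral_diff) (auto simp del: fact_Suc)
  also have "\<dots> = (LBINT r:{0<..}. ?k * ?c * ?A1 r + x * ?c * ?A2 r -
      x * (real (Suc (Suc k)) * (?k * ?c) * ?A3 r) - x * (x * (?k * ?c) * ?A4 r) + ?k * ?c * ?F' r)"
  proof (rule set_lebesgue_integral_cong)
    show "\<forall>r. r \<in> {0<..} \<longrightarrow> fact (Suc k) * (U.e (Suc k) * V.e (Suc k)) * X r - x * ?c * Y r =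
      ?k * ?c * ?A1 r + x * ?c * ?A2 r -
      x * (real (Suc (Suc k)) * (?k * ?c) * ?A3 r) - x * (x * (?k * ?c) * ?A4 r) + ?k * ?c * ?F' r"
    proof (intro allI impI)
      fix r :: real assume "r \<in> {0<..}"
      hence r: "0 < r" by simp
      have "V.e (Suc k) / V.P (x * r) = ?f0 r - x * r * ?f1 r"
        using V.f_Suc[OF T, of "x * r" k] x r by simp
      moreover have "V.e (Suc k) * X r = V.e (Suc k) / V.P (x * r) * U.g r" by (simp add: X_def)
      ultimately have "V.e (Suc k) * X r = (?f0 r - x * r * ?f1 r) * U.g r" by simp
      hence "fact (Suc k) * (U.e (Suc k) * V.e (Suc k)) * X r = ?k * ?c * (U.e (Suc k) * ((?f0 r - x * r * ?f1 r) * U.g r))"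
        by (simp add: mult_ac)
      thus "fact (Suc k) * (U.e (Suc k) * V.e (Suc k)) * X r - x * ?c * Y r =
        ?k * ?c * ?A1 r + x * ?c * ?A2 r -
        x * (real (Suc (Suc k)) * (?k * ?c) * ?A3 r) - x * (x * (?k * ?c) * ?A4 r) + ?k * ?c * ?F' r"
        unfolding Y_def d[OF r] by (simp only:) (simp add: algebra_simps power2_eq_square)
    qed
  qed simp
  also have "\<dots> = ?k * ?c * (LBINT r:{0<..}. ?A1 r) + x * ?c * (LBINT r:{0<..}. ?A2 r) -
      x * (real (Suc (Suc k)) * (?k * ?c) * (LBINT r:{0<..}. ?A3 r)) -
      x * (x * (?k * ?c) * (LBINT r:{0<..}. ?A4 r)) + ?k * ?c * (LBINT r:{0<..}. ?F' r)"
  proof -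
    have t1: "decaying (\<lambda>r. ?k * ?c * ?A1 r)" and t2: "decaying (\<lambda>r. x * ?c * ?A2 r)"
      and t3: "decaying (\<lambda>r. x * (real (Suc (Suc k)) * (?k * ?c) * ?A3 r))"
      and t4: "decaying (\<lambda>r. x * (x * (?k * ?c) * ?A4 r))" and t5: "decaying (\<lambda>r. ?k * ?c * ?F' r)"
      by (intro decaying_cmult dA dF')+
    note t12 = decaying_add[OF t1 t2]
    note t123 = decaying_diff[OF t12 t3]
    note t1234 = decaying_diff[OF t123 t4]
    note int = decaying_integrable
    show ?thesis
      unfolding set_integral_add(2)[OF int[OF t1234] int[OF t5]] set_integral_diff(2)[OF int[OF t123] int[OF t4]]
        set_integral_diff(2)[OF int[OF t12] int[OF t3]] set_integral_add(2)[OF int[OF t1] int[OF t2]]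
        set_integral_mult_right ..
  qed
  finally show ?thesis unfolding 1 X_def Y_def
    by (simp add: Bk_def Nk_def Nk'_def algebra_simps)
qed

lemma Nk_stieltjes:
  assumes "0 \<le> x"
  shows "Nk k x = fact k * (\<Sum>j<R. \<Sum>i<T. U.alpha j * U.er k j * V.alpha i * V.er k i * stieltjes (u j) (v i) x)"
    and "Nk' k x = fact k * (\<Sum>j<R. \<Sum>i<T. U.alpha j * U.er k j * V.alpha i * V.er k i * stieltjes' (u j) (v i) x)"
proof -
  have ints: "(LBINT r:{0<..}. (\<Sum>j<R. \<Sum>i<T. c j i * F j i r)) = (\<Sum>j<R. \<Sum>i<T. c j i * (LBINT r:{0<..}. F j i r))"
    if F: "\<And>j i. j < R \<Longrightarrow> i < T \<Longrightarrow> decaying (F j i)" for c :: "nat \<Rightarrow> nat \<Rightarrow> real" and F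
  proof -
    have "(LBINT r:{0<..}. (\<Sum>j<R. \<Sum>i<T. c j i * F j i r)) = (\<Sum>j<R. LBINT r:{0<..}. \<Sum>i<T. c j i * F j i r)"
      by (intro set_integral_sum decaying_integrable decaying_sum decaying_cmult F) auto
    also have "\<dots> = (\<Sum>j<R. \<Sum>i<T. LBINT r:{0<..}. c j i * F j i r)"
      by (intro sum.cong refl set_integral_sum decaying_integrable decaying_cmult F) auto
    finally show ?thesis by (simp only: set_integral_mult_right)
  qed
  have "(LBINT r:{0<..}. V.f k (x * r) * U.G k r) =
    (LBINT r:{0<..}. (\<Sum>j<R. \<Sum>i<T. U.alpha j * U.er k j * V.alpha i * V.er k i *
      (v i / (1 + v i * (x * r)) * exp (- (r / u j)))))"
    unfolding V.f_def U.G_def sum_product by (subst sum.swap) (simp add: mult_ac)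
  also have "\<dots> = (\<Sum>j<R. \<Sum>i<T. U.alpha j * U.er k j * V.alpha i * V.er k i * stieltjes (u j) (v i) x)"
    unfolding stieltjes_def by (rule ints) (intro decaying_stieltjes U.pos V.pos assms)
  finally show "Nk k x = fact k * (\<Sum>j<R. \<Sum>i<T. U.alpha j * U.er k j * V.alpha i * V.er k i * stieltjes (u j) (v i) x)"
    by (simp add: Nk_def)
  have "(LBINT r:{0<..}. V.f' k (x * r) * (r * U.G k r)) =
    (LBINT r:{0<..}. (\<Sum>j<R. \<Sum>i<T. U.alpha j * U.er k j * V.alpha i * V.er k i *
      (- ((v i)\<^sup>2 / (1 + v i * (x * r))\<^sup>2) * (r * exp (- (r / u j))))))"
  proof (rule arg_cong[where f = "set_lebesgue_integral lborel {0<..}"], rule ext)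
    fix r
    have "V.f' k (x * r) * (r * U.G k r) = (\<Sum>i<T. - (V.alpha i * V.er k i * (v i)\<^sup>2 / (1 + v i * (x * r))\<^sup>2)) *
        (\<Sum>j<R. r * (U.alpha j * U.er k j * exp (- (r / u j))))"
      by (simp add: V.f'_def U.G_def sum_negf sum_distrib_left)
    also have "\<dots> = (\<Sum>j<R. \<Sum>i<T. - (V.alpha i * V.er k i * (v i)\<^sup>2 / (1 + v i * (x * r))\<^sup>2) *
        (r * (U.alpha j * U.er k j * exp (- (r / u j)))))"
      unfolding sum_product by (rule sum.swap)
    finally show "V.f' k (x * r) * (r * U.G k r) = (\<Sum>j<R. \<Sum>i<T. U.alpha j * U.er k j * V.alpha i * V.er k i *
      (- ((v i)\<^sup>2 / (1 + v i * (x * r))\<^sup>2) * (r * exp (- (r / u j)))))"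
      by (simp add: mult_ac)
  qed
  also have "\<dots> = (\<Sum>j<R. \<Sum>i<T. U.alpha j * U.er k j * V.alpha i * V.er k i * stieltjes' (u j) (v i) x)"
    unfolding stieltjes'_def by (rule ints) (intro decaying_stieltjes U.pos V.pos assms)
  finally show "Nk' k x = fact k * (\<Sum>j<R. \<Sum>i<T. U.alpha j * U.er k j * V.alpha i * V.er k i * stieltjes' (u j) (v i) x)"
    by (simp add: Nk'_def)
qed

lemma DERIV_Nk:
  assumes "0 \<le> x"
  shows "(Nk k has_real_derivative Nk' k x) (at x within {0..})"
proof -
  have "((\<lambda>x. fact k * (\<Sum>j<R. \<Sum>i<T. U.alpha j * U.er k j * V.alpha i * V.er k i * stieltjes (u j) (v i) x))
    has_real_derivative Nk' k x) (at x within {0..})"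
    unfolding Nk_stieltjes(2)[OF assms]
    by (intro DERIV_cmult DERIV_sum DERIV_stieltjes U.pos V.pos assms) auto
  thus ?thesis
    by (rule has_field_derivative_transform_within[where d = 1]) (use assms Nk_stieltjes(1) in auto)
qed

lemma continuous_on_Nk': "continuous_on {0..} (Nk' k)"
proof -
  have "continuous_on {0..} (\<lambda>x. fact k * (\<Sum>j<R. \<Sum>i<T. U.alpha j * U.er k j * V.alpha i * V.er k i * stieltjes' (u j) (v i) x))"
    by (intro continuous_intros continuous_on_stieltjes' U.pos V.pos) auto
  thus ?thesis by (rule continuous_on_eq) (simp add: Nk_stieltjes(2))
qed

lemma continuous_on_Bk: "continuous_on {0..} (Bk k)"
proof -
  have "continuous_on {0..} (Nk k)" by (rule DERIV_continuous_on[OF DERIV_Nk]) auto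
  thus ?thesis unfolding Bk_def[abs_def] by (intro continuous_intros continuous_on_Nk')
qed

definition Lam :: "real \<Rightarrow> real" where
  "Lam x = (\<Sum>k<T. x ^ Suc k * Nk k x)"

lemma DERIV_Lam:
  assumes "0 \<le> x"
  shows "(Lam has_real_derivative (\<Sum>k<T. x ^ k * Bk k x)) (at x within {0..})"
proof -
  have "((\<lambda>x. x ^ Suc k * Nk k x) has_real_derivative x ^ k * Bk k x) (at x within {0..})" for k
    by (rule derivative_eq_intros DERIV_Nk assms refl)+ (simp add: Bk_def algebra_simps)
  thus ?thesis unfolding Lam_def[abs_def] by (intro DERIV_sum)
qed

text \<open>Only \<open>T - 1\<close> scales remain when one is removed, so \<open>V.er T\<close>
  vanishes on all indices; this ends the telescoping in \<open>ratio_eq\<close>.\<close>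

lemma Bk_T_eq_0: "Bk T x = 0"
  using V.er_eq_0[of _ T] by (simp add: Bk_def Nk_def Nk'_def V.f_def V.f'_def)

section \<open>Averaging over the auxiliary Gaussian vector\<close>

abbreviation Zm :: "(nat \<Rightarrow> complex) measure" where "Zm \<equiv> PiM {..<T} (\<lambda>_. cgauss)"
abbreviation Hm :: "(nat \<times> nat \<Rightarrow> complex) measure" where "Hm \<equiv> PiM ({..<R} \<times> {..<T}) (\<lambda>_. cgauss)"

sublocale Zm: prob_space Zm by (rule prob_space_PiM_cgauss)
sublocale Hm: prob_space Hm by (rule prob_space_PiM_cgauss)

definition S :: "(nat \<Rightarrow> complex) \<Rightarrow> real" where
  "S z = (\<Sum>i<T. v i * (cmod (z i))\<^sup>2)"

lemma S_nonneg: "0 \<le> S z"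
  unfolding S_def using V.pos by (intro sum_nonneg) (auto simp: less_imp_le)

lemma measurable_z [measurable]: "i \<in> {..<T} \<Longrightarrow> (\<lambda>z. z i) \<in> borel_measurable Zm"
  by (rule measurable_component_cgauss)

lemma measurable_S [measurable]: "S \<in> borel_measurable Zm"
  unfolding S_def by measurable

lemma qform_diag: "qform T (\<lambda>a b. if a = b then of_real (\<theta> * v a) else 0) z = \<theta> * S z"
proof -
  have "(\<Sum>a<T. \<Sum>b<T. cnj (z a) * (if a = b then of_real (\<theta> * v a) else 0) * z b) =
    (\<Sum>a<T. complex_of_real (\<theta> * (v a * (cmod (z a))\<^sup>2)))"
  proof (rule sum.cong[OF refl])
    fix a assume "a \<in> {..<T}"
    hence "(\<Sum>b<T. cnj (z a) * (if a = b then of_real (\<theta> * v a) else 0) * z b) = cnj (z a) * of_real (\<theta> * v a) * z a"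
      by (subst sum.remove[of _ a]) auto
    also have "\<dots> = complex_of_real (\<theta> * v a) * (z a * cnj (z a))" by (simp add: mult_ac)
    finally show "(\<Sum>b<T. cnj (z a) * (if a = b then of_real (\<theta> * v a) else 0) * z b) =
      complex_of_real (\<theta> * (v a * (cmod (z a))\<^sup>2))" unfolding complex_norm_square[symmetric] by simp
  qed
  thus ?thesis by (simp add: qform_def S_def sum_distrib_left)
qed

text \<open>Gaussian integrals of the diagonal form \<open>\<theta> * S z\<close>; the second one
  perturbs the \<open>i\<close>-th diagonal entry alone.\<close>

lemma expectation_exp_S:
  assumes "0 \<le> \<theta>"
  shows "(LINT z|Zm. exp (- (\<theta> * S z))) = 1 / V.P \<theta>"
    and "i < T \<Longrightarrow> (LINT z|Zm. (cmod (z i))\<^sup>2 * exp (- (\<theta> * S z))) = 1 / ((1 + v i * \<theta>) * V.P \<theta>)"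
proof -
  let ?Q = "\<lambda>a b. if a = b then complex_of_real (\<theta> * v a) else 0"
  have psd: "0 \<le> qform T ?Q z" for z unfolding qform_diag using assms S_nonneg by simp
  have det: "detf T (\<lambda>a b. (if a = b then 1 else 0) + ?Q a b) = complex_of_real (V.P \<theta>)"
    by (subst detf_upper_triangular) (auto simp: V.P_def mult.commute)
  show "(LINT z|Zm. exp (- (\<theta> * S z))) = 1 / V.P \<theta>"
    using gaussian_expectation(3)[of ?Q T "V.P \<theta>", OF _ psd det] unfolding qform_diag by simp
  assume i: "i < T"
  define l where "l a = (if a = i then 1 else 0 :: complex)" for a
  define D1 where "D1 = (\<Prod>a\<in>{..<T} - {i}. 1 + v a * \<theta>)"
  have P: "V.P \<theta> = (1 + v i * \<theta>) * D1"
    unfolding V.P_def D1_def using i by (subst prod.remove[of _ i]) auto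
  have "detf T (\<lambda>a b. (if a = b then 1 else 0) + (?Q a b + of_real e * (cnj (l a) * l b))) =
      complex_of_real (V.P \<theta> + e * D1)" for e
  proof -
    have "detf T (\<lambda>a b. (if a = b then 1 else 0) + (?Q a b + of_real e * (cnj (l a) * l b))) =
      (\<Prod>a<T. 1 + (of_real (\<theta> * v a) + (if a = i then of_real e else 0)))"
      by (subst detf_upper_triangular) (auto simp: l_def intro!: prod.cong)
    also have "\<dots> = (1 + (of_real (\<theta> * v i) + of_real e)) *
        (\<Prod>a\<in>{..<T} - {i}. 1 + (of_real (\<theta> * v a) + (if a = i then of_real e else 0)))"
      using i by (subst prod.remove[of _ i]) auto
    also have "(\<Prod>a\<in>{..<T} - {i}. 1 + (of_real (\<theta> * v a) + (if a = i then of_real e else 0))) = complex_of_real D1"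
      unfolding D1_def of_real_prod by (intro prod.cong) (auto simp: mult.commute)
    finally show ?thesis unfolding P by (simp add: algebra_simps)
  qed
  hence "(LINT z|Zm. (cmod (\<Sum>a<T. l a * z a))\<^sup>2 * exp (- qform T ?Q z)) = D1 / (V.P \<theta>)\<^sup>2"
    by (intro gaussian_second_moment psd) auto
  also have "(\<lambda>z. (cmod (\<Sum>a<T. l a * z a))\<^sup>2) = (\<lambda>z. (cmod (z i))\<^sup>2)"
    using i by (intro ext) (subst sum.remove[of _ i], auto simp: l_def intro!: sum.neutral)
  hence "(\<lambda>z. (cmod (\<Sum>a<T. l a * z a))\<^sup>2 * exp (- qform T ?Q z)) = (\<lambda>z. (cmod (z i))\<^sup>2 * exp (- (\<theta> * S z)))"
    unfolding qform_diag by (simp add: fun_eq_iff)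
  finally have "(LINT z|Zm. (cmod (z i))\<^sup>2 * exp (- (\<theta> * S z))) = D1 / (V.P \<theta>)\<^sup>2" .
  thus "(LINT z|Zm. (cmod (z i))\<^sup>2 * exp (- (\<theta> * S z))) = 1 / ((1 + v i * \<theta>) * V.P \<theta>)"
    using V.P_pos[OF assms] V.one_plus_pos[OF i assms] unfolding P by (simp add: power2_eq_square)
qed

lemma integrable_norm_square_z: "i < T \<Longrightarrow> integrable Zm (\<lambda>z. (cmod (z i))\<^sup>2)"
  using moments_PiM_cgauss[of i "{..<T}"] unfolding moments_def by auto

lemma laplace_fubini:
  assumes "decaying \<psi>" "integrable Zm Y" "0 \<le> x"
  shows "(LINT z|Zm. (LBINT r:{0<..}. \<psi> r * exp (- (r * (x * S z)))) * Y z) =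
    (LBINT r:{0<..}. \<psi> r * (LINT z|Zm. exp (- (x * r * S z)) * Y z))"
proof -
  interpret pair_sigma_finite lborel Zm ..
  note [measurable] = decaying_measurable[OF assms(1)] borel_measurable_integrable[OF assms(2)]
  define F where "F = (\<lambda>r::real. indicator {0<..} r * \<psi> r)"
  have [measurable]: "F \<in> borel_measurable borel" unfolding F_def by measurable
  define f where "f = (\<lambda>r z. F r * (exp (- (x * r * S z)) * Y z))"
  have i1: "integrable lborel F"
    using decaying_integrable[OF assms(1)] by (simp add: set_integrable_def F_def)
  have "integrable (lborel \<Otimes>\<^sub>M Zm) (\<lambda>(r, z). F r * Y z)"
    using i1 assms(2) by (intro Fubini_integrable) (auto simp: abs_mult)
  hence int: "integrable (lborel \<Otimes>\<^sub>M Zm) (\<lambda>(r, z). f r z)"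
  proof (rule Bochner_Integration.integrable_bound)
    show "(\<lambda>(r, z). f r z) \<in> borel_measurable (lborel \<Otimes>\<^sub>M Zm)" unfolding f_def by measurable
    show "AE p in lborel \<Otimes>\<^sub>M Zm. norm (case p of (r, z) \<Rightarrow> f r z) \<le>
        norm (case p of (r, z) \<Rightarrow> F r * Y z)"
    proof (rule AE_I2, clarify)
      fix r z
      have "exp (- (x * r * S z)) \<le> 1" if "0 < r" using that assms(3) S_nonneg[of z] by simp
      thus "norm (f r z) \<le> norm (F r * Y z)"
        by (auto simp: f_def F_def abs_mult indicator_def intro!: mult_left_mono mult_left_le_one_le)
    qed
  qed
  have "(LINT z|Zm. (LBINT r. f r z)) = (LBINT r. (LINT z|Zm. f r z))"
    by (rule Fubini_integral[OF int])
  also have "(\<lambda>z. (LBINT r. f r z)) = (\<lambda>z. (LBINT r:{0<..}. \<psi> r * exp (- (r * (x * S z)))) * Y z)"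
    unfolding f_def F_def set_lebesgue_integral_def
    by (subst Bochner_Integration.integral_mult_left_zero[symmetric]) (simp add: mult_ac)
  also have "(\<lambda>r. (LINT z|Zm. f r z)) = (\<lambda>r. indicator {0<..} r *\<^sub>R (\<psi> r * (LINT z|Zm. exp (- (x * r * S z)) * Y z)))"
    unfolding f_def F_def by (simp add: mult.assoc)
  finally show ?thesis by (simp add: set_lebesgue_integral_def)
qed

text \<open>With \<open>1 / U.P\<close> written as the Laplace transform of \<open>U.g\<close>, the
  vector \<open>z\<close> enters only through an exponential of \<open>S z\<close>, whose mean is a
  value of \<open>1 / V.P\<close>.\<close>

lemma expectation_inverse_P:
  assumes "0 \<le> x"
  shows "(LINT z|Zm. 1 / U.P (x * S z)) = (LBINT r:{0<..}. U.g r / V.P (x * r))"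
proof -
  have "(LINT z|Zm. 1 / U.P (x * S z)) = (LINT z|Zm. (LBINT r:{0<..}. U.g r * exp (- (r * (x * S z)))) * 1)"
    using assms S_nonneg by (simp add: U.laplace_g[OF R])
  also have "\<dots> = (LBINT r:{0<..}. U.g r * (LINT z|Zm. exp (- (x * r * S z)) * 1))"
    by (rule laplace_fubini) (auto intro: U.decaying_g assms)
  also have "\<dots> = (LBINT r:{0<..}. U.g r / V.P (x * r))"
    by (intro set_lebesgue_integral_cong) (use assms expectation_exp_S(1) in \<open>auto simp: mult_nonneg_nonneg\<close>)
  finally show ?thesis .
qed

text \<open>The \<open>k\<close>-th coefficient of \<open>qp\<close> for
  \<open>w = diag(\<surd>v) z\<close>.\<close>

definition Y :: "nat \<Rightarrow> (nat \<Rightarrow> complex) \<Rightarrow> real" where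
  "Y k z = (\<Sum>i<T. (v i)\<^sup>2 * (cmod (z i))\<^sup>2 * V.er k i)"

lemma integrable_Y: "integrable Zm (Y k)"
  unfolding Y_def[abs_def] by (intro Bochner_Integration.integrable_sum integrable_mult_left integrable_mult_right integrable_norm_square_z) auto

text \<open>The Laplace representation again isolates an exponential of \<open>S z\<close>; its mean
  against \<open>Y k z\<close> is the same kind of sum \<open>d\<close>, now for the scales
  \<open>v\<close>.\<close>

lemma expectation_d:
  assumes "0 \<le> x"
  shows "(LINT z|Zm. U.d k (x * S z) * Y k z) =
    (LBINT r:{0<..}. (r * U.G k r - real (Suc k) * U.G (Suc k) r) * V.d k (x * r))"
proof -
  let ?\<psi> = "\<lambda>r. r * U.G k r - real (Suc k) * U.G (Suc k) r"
  have "(LINT z|Zm. U.d k (x * S z) * Y k z) = (LINT z|Zm. (LBINT r:{0<..}. ?\<psi> r * exp (- (r * (x * S z)))) * Y k z)"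
    using assms S_nonneg by (subst U.laplace_d[OF R]) auto
  also have "\<dots> = (LBINT r:{0<..}. ?\<psi> r * (LINT z|Zm. exp (- (x * r * S z)) * Y k z))"
    by (rule laplace_fubini) (auto intro!: decaying_intros integrable_Y assms)
  also have "\<dots> = (LBINT r:{0<..}. ?\<psi> r * V.d k (x * r))"
  proof (intro set_lebesgue_integral_cong allI impI)
    fix r :: real assume "r \<in> {0<..}"
    hence t: "0 \<le> x * r" using assms by simp
    let ?e = "\<lambda>z. exp (- (x * r * S z))"
    have int: "integrable Zm (\<lambda>z. (cmod (z i))\<^sup>2 * ?e z)" if "i < T" for i
    proof (rule Bochner_Integration.integrable_bound[OF integrable_norm_square_z[OF that]])
      have [measurable]: "(\<lambda>z. z i) \<in> borel_measurable Zm" by (rule measurable_z) (use that in simp)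
      show "(\<lambda>z. (cmod (z i))\<^sup>2 * ?e z) \<in> borel_measurable Zm" by measurable
      show "AE z in Zm. norm ((cmod (z i))\<^sup>2 * ?e z) \<le> norm ((cmod (z i))\<^sup>2)"
        using t S_nonneg by (intro AE_I2) (auto intro!: mult_left_le)
    qed
    have "(LINT z|Zm. ?e z * Y k z) = (LINT z|Zm. (\<Sum>i<T. ((v i)\<^sup>2 * V.er k i) * ((cmod (z i))\<^sup>2 * ?e z)))"
      by (simp add: Y_def sum_distrib_left mult_ac)
    also have "\<dots> = (\<Sum>i<T. ((v i)\<^sup>2 * V.er k i) * (1 / ((1 + v i * (x * r)) * V.P (x * r))))"
      using int by (subst Bochner_Integration.integral_sum) (auto intro!: sum.cong simp only: lessThan_iff
        Bochner_Integration.integral_mult_right_zero expectation_exp_S(2)[OF t])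
    also have "\<dots> = V.d k (x * r)" by (simp add: V.d_def)
    finally show "?\<psi> r * (LINT z|Zm. ?e z * Y k z) = ?\<psi> r * V.d k (x * r)" by simp
  qed simp
  finally show ?thesis .
qed

section \<open>The channel determinant and the ratio of two of its values\<close>

abbreviation idm :: "nat \<Rightarrow> nat \<Rightarrow> complex" where
  "idm \<equiv> \<lambda>a b. if a = b then 1 else 0"

definition chan :: "real \<Rightarrow> (nat \<times> nat \<Rightarrow> complex) \<Rightarrow> nat \<Rightarrow> nat \<Rightarrow> complex" where
  "chan x h = shifted v (\<lambda>j. x * u j) {..<R} idm h"

definition Dt :: "real \<Rightarrow> (nat \<times> nat \<Rightarrow> complex) \<Rightarrow> real" where
  "Dt x h = Re (detf T (chan x h))"

definition wz :: "(nat \<Rightarrow> complex) \<Rightarrow> nat \<Rightarrow> complex" where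
  "wz z b = of_real (sqrt (v b)) * z b"

definition wt :: "real \<Rightarrow> (nat \<Rightarrow> complex) \<Rightarrow> (nat \<times> nat \<Rightarrow> complex) \<Rightarrow> real" where
  "wt x z h = weight T (\<lambda>j. x * u j) (wz z) {..<R} h"

lemma wt_eq: "wt x z h = exp (- x * (\<Sum>j<R. u j * (cmod (\<Sum>b<T. h (j, b) * wz z b))\<^sup>2))"
  by (simp add: wt_def weight_def row_weight_def exp_sum[symmetric] sum_distrib_left sum_negf mult.assoc)

lemma wt_bounds: "0 \<le> x \<Longrightarrow> wt x z h \<le> 1" "0 \<le> wt x z h"
  unfolding wt_eq using U.pos by (auto intro!: mult_nonneg_nonneg sum_nonneg simp: less_imp_le)

text \<open>Conjugation by the square roots of \<open>v\<close> makes the perturbation Hermitian and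
  nonnegative, so \<open>gaussian_expectation\<close> applies and identifies
  \<open>1 / Dt x h\<close> with the mean of the weight.\<close>

lemma Dt_expectation:
  assumes x: "0 \<le> x"
  shows "detf T (chan x h) = complex_of_real (Dt x h)" "0 < Dt x h"
    "integrable Zm (\<lambda>z. wt x z h)" "(LINT z|Zm. wt x z h) = 1 / Dt x h"
proof -
  define s where "s a = complex_of_real (sqrt (v a))" for a
  define Q where "Q a b = s a * s b * of_real x * (\<Sum>j<R. of_real (u j) * cnj (h (j, a)) * h (j, b))" for a b
  have s: "s a \<noteq> 0" "s a * s a = of_real (v a)" if "a < T" for a
  proof -
    show "s a \<noteq> 0" using V.pos[OF that] by (simp add: s_def)
    have "sqrt (v a) * sqrt (v a) = v a" using V.pos[OF that] by simp
    thus "s a * s a = of_real (v a)" unfolding s_def of_real_mult[symmetric] by simp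
  qed
  have herm: "Q b a = cnj (Q a b)" for a b by (simp add: Q_def s_def mult_ac)
  have qf: "qform T Q z = x * (\<Sum>j<R. u j * (cmod (\<Sum>b<T. h (j, b) * wz z b))\<^sup>2)" for z
  proof -
    have "(\<Sum>a<T. \<Sum>b<T. cnj (z a) * Q a b * z b) = (\<Sum>a<T. \<Sum>b<T. \<Sum>j<R. of_real (x * u j) *
        (cnj (h (j, a) * wz z a) * (h (j, b) * wz z b)))"
      by (simp add: Q_def wz_def s_def sum_distrib_left sum_distrib_right mult_ac)
    also have "\<dots> = (\<Sum>j<R. \<Sum>a<T. \<Sum>b<T. of_real (x * u j) *
        (cnj (h (j, a) * wz z a) * (h (j, b) * wz z b)))"
      by (subst (2) sum.swap, subst sum.swap) (rule refl)
    also have "\<dots> = (\<Sum>j<R. of_real (x * u j) * (cnj (\<Sum>b<T. h (j, b) * wz z b) * (\<Sum>b<T. h (j, b) * wz z b)))"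
      unfolding cnj_sum sum_product by (simp add: sum_distrib_left)
    also have "\<dots> = complex_of_real (\<Sum>j<R. (x * u j) * (cmod (\<Sum>b<T. h (j, b) * wz z b))\<^sup>2)"
      unfolding of_real_sum of_real_mult complex_norm_square by (simp add: mult_ac)
    finally show ?thesis by (simp add: qform_def sum_distrib_left mult.assoc)
  qed
  have psd: "0 \<le> qform T Q z" for z
    unfolding qf using x U.pos by (intro mult_nonneg_nonneg sum_nonneg) (auto simp: less_imp_le)
  have "detf T (\<lambda>a b. idm a b + Q a b) = detf T (\<lambda>a b. s a * (idm a b + Q a b) / s b)"
    using s by (subst detf_conj_diag) auto
  also have "\<dots> = detf T (chan x h)"
  proof (rule detf_cong)
    fix a b assume ab: "a < T" "b < T"
    have "s a * Q a b / s b = (s a * s a) * of_real x * (\<Sum>j<R. of_real (u j) * cnj (h (j, a)) * h (j, b))"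
      unfolding Q_def using s ab by simp
    also have "\<dots> = (\<Sum>j<R. of_real (x * u j) * (of_real (v a) * cnj (h (j, a)) * h (j, b)))"
      unfolding s(2)[OF ab(1)] by (simp add: sum_distrib_left mult_ac)
    finally show "s a * (idm a b + Q a b) / s b = chan x h a b"
      using s ab by (simp add: chan_def shifted_def distrib_left add_divide_distrib)
  qed
  finally have det: "detf T (\<lambda>a b. idm a b + Q a b) = detf T (chan x h)" .
  from gaussian_integral[of Q T, OF herm psd] obtain D where D: "detf T (chan x h) = complex_of_real D"
    unfolding det by blast
  hence [simp]: "D = Dt x h" by (simp add: Dt_def)
  show "detf T (chan x h) = complex_of_real (Dt x h)" using D by simp
  note g = gaussian_expectation[of Q T D, OF herm psd, unfolded det, OF D]
  have wt: "wt x z h = exp (- qform T Q z)" for z by (simp add: wt_eq qf)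
  show "0 < Dt x h" "integrable Zm (\<lambda>z. wt x z h)" "(LINT z|Zm. wt x z h) = 1 / Dt x h"
    unfolding wt using g by auto
qed

text \<open>The weight is at most 1, hence so is its mean \<open>1 / Dt x h\<close>.\<close>

lemma Dt_ge_1:
  assumes "0 \<le> x"
  shows "1 \<le> Dt x h"
proof -
  have "(LINT z|Zm. wt x z h) \<le> (LINT z|Zm. 1)"
    by (rule integral_mono) (use Dt_expectation[OF assms] wt_bounds(1)[OF assms] in auto)
  thus ?thesis using Dt_expectation(2,4)[OF assms, of h] by (simp add: Zm.prob_space field_simps)
qed

lemma moments_Dt: "moments Hm (\<lambda>h. detf T (chan y h))"
  unfolding chan_def by (rule moments_detf_shifted) simp

lemma measurable_Dt [measurable]: "Dt x \<in> borel_measurable Hm"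
  unfolding Dt_def[abs_def] using moments_Dt[THEN moments_measurable] by measurable

lemma integrable_Dt: "integrable Hm (Dt y)"
  unfolding Dt_def[abs_def] using moments_integrable[OF moments_Dt] by (rule integrable_Re)

lemma measurable_wt [measurable]: "(\<lambda>(h, z). wt x z h) \<in> borel_measurable (Hm \<Otimes>\<^sub>M Zm)"
proof -
  have 1 [measurable]: "(\<lambda>p. fst p (j, b)) \<in> borel_measurable (Hm \<Otimes>\<^sub>M Zm)" if "j \<in> {..<R}" "b \<in> {..<T}" for j b
    by (rule measurable_compose[OF measurable_fst measurable_component_cgauss]) (use that in auto)
  have 2 [measurable]: "(\<lambda>p. snd p b) \<in> borel_measurable (Hm \<Otimes>\<^sub>M Zm)" if "b \<in> {..<T}" for b
    by (rule measurable_compose[OF measurable_snd measurable_component_cgauss]) (use that in auto)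
  show ?thesis unfolding wt_eq wz_def case_prod_unfold by measurable
qed

definition ratio :: "real \<Rightarrow> real \<Rightarrow> real" where
  "ratio x y = (LINT h|Hm. Dt y h / Dt x h)"

lemma integrable_ratio:
  assumes "0 \<le> x" "0 \<le> y"
  shows "integrable Hm (\<lambda>h. Dt y h / Dt x h)"
proof (rule Bochner_Integration.integrable_bound[OF integrable_Dt[of y]])
  have "norm (Dt y h / Dt x h) \<le> norm (Dt y h)" for h
  proof -
    have p: "1 \<le> Dt x h" "0 < Dt y h" using Dt_ge_1 Dt_expectation(2) assms by auto
    hence "Dt y h / Dt x h \<le> Dt y h / 1" by (intro divide_left_mono) auto
    thus ?thesis using p by simp
  qed
  thus "AE h in Hm. norm (Dt y h / Dt x h) \<le> norm (Dt y h)" by (intro AE_I2)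
qed measurable

text \<open>For fixed \<open>z\<close> this is \<open>mean_det\<close> at the identity matrix, that
  is, the product of the \<open>Zr\<close> times \<open>closed_form\<close> at
  \<open>\<tau> = \<sigma> = 0\<close>, expanded by \<open>poly_diff_op_0\<close>.\<close>

lemma mean_det_value:
  assumes x: "0 \<le> x" and y: "0 \<le> y"
  shows "(LINT h|Hm. wt x z h * Dt y h) =
    1 / U.P (x * S z) * (\<Sum>k\<le>T. y ^ k * (fact k * (U.e k * V.e k))) -
    x * (\<Sum>k<T. y ^ Suc k * (fact k * (U.d k (x * S z) * Y k z)))"
proof -
  \<comment> \<open>The absolute value makes \<open>?\<kappa>\<close> nonnegative at every index, as
    \<open>mean_det_base\<close> demands; the sign of \<open>u j\<close> is known for
    \<open>j < R\<close> only.\<close>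
  let ?\<kappa> = "\<lambda>j. \<bar>x * u j\<bar>" and ?k = "\<lambda>j. y * u j" and ?w = "wz z"
  have \<kappa>: "0 \<le> ?\<kappa> j" for j by simp
  have \<kappa>_eq: "?\<kappa> j = x * u j" if "j < R" for j using U.pos[OF that] x by simp
  have wt: "wt x z h = weight T ?\<kappa> ?w {..<R} h" for h
    unfolding wt_def weight_def row_weight_def by (intro prod.cong refl) (simp add: \<kappa>_eq)
  have norm_w: "(cmod (?w i))\<^sup>2 = v i * (cmod (z i))\<^sup>2" if "i < T" for i
    using V.pos[OF that] by (simp add: wz_def norm_mult power_mult_distrib)
  have S_eq: "(\<Sum>a<T. (cmod (?w a))\<^sup>2) = S z"
    unfolding S_def by (intro sum.cong refl norm_w) auto
  have s: "0 \<le> x * S z" using x S_nonneg by simp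
  have Zr: "Zr T ?\<kappa> ?w j = 1 / (1 + u j * (x * S z))" if "j < R" for j
    unfolding Zr_def S_eq \<kappa>_eq[OF that] by (simp add: mult_ac)
  have prodZ: "(\<Prod>j<R. Zr T ?\<kappa> ?w j) = 1 / U.P (x * S z)"
    unfolding U.P_def by (simp add: Zr prod_dividef)
  have base: "base v ?w 0 0 = idm" by (auto simp: base_def fun_eq_iff)
  have kp: "coeff (esym_poly (\<lambda>j. complex_of_real (?k j)) A) m = of_real (y ^ m * esym u A m)" if "finite A" for A m
    using esym_scale[OF that, of y u m] esym_of_real[OF that, of ?k m] unfolding esym_def by simp
  have vp: "coeff (esym_poly (\<lambda>i. complex_of_real (v i)) A) m = of_real (esym v A m)" if "finite A" for A m
    using esym_of_real[OF that, of v m] unfolding esym_def by simp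
  have deg: "Polynomial.degree (esym_poly (\<lambda>j. complex_of_real (?k j)) A) \<le> R + T" if "A \<subseteq> {..<R}" for A
    using degree_esym_poly_le[of A "\<lambda>j. complex_of_real (?k j)"] card_mono[OF _ that] finite_subset[OF that] by simp
  have qc: "coeff (qp T v ?w) m = of_real (Y m z)" for m
  proof -
    have "coeff (qp T v ?w) m = (\<Sum>i<T. of_real (v i * (cmod (?w i))\<^sup>2) * of_real (esym v ({..<T} - {i}) m))"
      unfolding qp_def by (simp add: coeff_sum vp)
    also have "\<dots> = (\<Sum>i<T. of_real ((v i)\<^sup>2 * (cmod (z i))\<^sup>2 * V.er m i))"
    proof (rule sum.cong[OF refl])
      fix i assume "i \<in> {..<T}"
      hence "v i * (cmod (?w i))\<^sup>2 * esym v ({..<T} - {i}) m = (v i)\<^sup>2 * (cmod (z i))\<^sup>2 * V.er m i"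
        by (subst norm_w) (auto simp: V.er_def power2_eq_square)
      thus "of_real (v i * (cmod (?w i))\<^sup>2) * complex_of_real (esym v ({..<T} - {i}) m) =
        of_real ((v i)\<^sup>2 * (cmod (z i))\<^sup>2 * V.er m i)" by (simp only: of_real_mult[symmetric])
    qed
    finally show ?thesis by (simp add: Y_def)
  qed
  have Y0: "Y m z = 0" if "T \<le> m" for m
    unfolding Y_def using V.er_eq_0 that by (intro sum.neutral) auto
  have first: "poly (diff_op (esym_poly (\<lambda>j. complex_of_real (?k j)) {..<R}) (esym_poly (\<lambda>i. complex_of_real (v i)) {..<T})) 0 =
      of_real (\<Sum>k\<le>T. y ^ k * (fact k * (U.e k * V.e k)))"
  proof -
    have "poly (diff_op (esym_poly (\<lambda>j. complex_of_real (?k j)) {..<R}) (esym_poly (\<lambda>i. complex_of_real (v i)) {..<T})) 0 =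
      (\<Sum>k\<le>R + T. of_real (y ^ k * (fact k * (U.e k * V.e k))))"
      unfolding poly_diff_op_0[OF deg[OF subset_refl]]
      unfolding kp[OF finite_lessThan] vp[OF finite_lessThan] U.e_def V.e_def
      by (intro sum.cong refl) simp
    also have "\<dots> = (\<Sum>k\<le>T. of_real (y ^ k * (fact k * (U.e k * V.e k))))"
      by (intro sum.mono_neutral_right) (auto simp: V.e_def esym_eq_0)
    finally show ?thesis by simp
  qed
  have second: "poly (diff_op (esym_poly (\<lambda>j. complex_of_real (?k j)) ({..<R} - {j})) (qp T v ?w)) 0 =
      of_real (\<Sum>k<T. y ^ k * (fact k * (U.er k j * Y k z)))" for j
  proof -
    have "poly (diff_op (esym_poly (\<lambda>j. complex_of_real (?k j)) ({..<R} - {j})) (qp T v ?w)) 0 =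
      (\<Sum>k\<le>R + T. of_real (y ^ k * (fact k * (U.er k j * Y k z))))"
      unfolding poly_diff_op_0[OF deg[OF Diff_subset]]
      unfolding kp[OF finite_Diff[OF finite_lessThan]] qc U.er_def
      by (intro sum.cong refl) simp
    also have "\<dots> = (\<Sum>k<T. of_real (y ^ k * (fact k * (U.er k j * Y k z))))"
      by (intro sum.mono_neutral_right) (auto simp: Y0)
    finally show ?thesis by simp
  qed
  have "complex_of_real (LINT h|Hm. wt x z h * Dt y h) = (LINT h|Hm. complex_of_real (wt x z h * Dt y h))"
    by (rule integral_complex_of_real[symmetric])
  also have "\<dots> = mean_det T v ?\<kappa> ?k ?w {..<R} idm"
    unfolding mean_det_def wt chan_def[symmetric]
    by (simp add: Dt_expectation(1)[OF y])
  also have "\<dots> = of_real (1 / U.P (x * S z)) * closed_form T v ?\<kappa> ?k ?w {..<R} 0 0"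
  proof -
    have "mean_det T v ?\<kappa> ?k ?w {..<R} (base v ?w 0 0) =
        of_real (\<Prod>j<R. Zr T ?\<kappa> ?w j) * closed_form T v ?\<kappa> ?k ?w {..<R} 0 0"
      by (rule mean_det_base[THEN conjunct2, rule_format]) (use \<kappa> in auto)
    thus ?thesis unfolding prodZ base .
  qed
  also have "closed_form T v ?\<kappa> ?k ?w {..<R} 0 0 = of_real ((\<Sum>k\<le>T. y ^ k * (fact k * (U.e k * V.e k))) -
      (\<Sum>j<R. ?\<kappa> j * Zr T ?\<kappa> ?w j * ?k j * (\<Sum>k<T. y ^ k * (fact k * (U.er k j * Y k z)))))"
    unfolding closed_form_def first second by simp
  also have "of_real (1 / U.P (x * S z)) * complex_of_real ((\<Sum>k\<le>T. y ^ k * (fact k * (U.e k * V.e k))) -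
      (\<Sum>j<R. ?\<kappa> j * Zr T ?\<kappa> ?w j * ?k j * (\<Sum>k<T. y ^ k * (fact k * (U.er k j * Y k z))))) =
    of_real (1 / U.P (x * S z) * ((\<Sum>k\<le>T. y ^ k * (fact k * (U.e k * V.e k))) -
      (\<Sum>j<R. ?\<kappa> j * Zr T ?\<kappa> ?w j * ?k j * (\<Sum>k<T. y ^ k * (fact k * (U.er k j * Y k z))))))"
    by (rule of_real_mult[symmetric])
  finally have *: "(LINT h|Hm. wt x z h * Dt y h) = 1 / U.P (x * S z) * ((\<Sum>k\<le>T. y ^ k * (fact k * (U.e k * V.e k))) -
      (\<Sum>j<R. ?\<kappa> j * Zr T ?\<kappa> ?w j * ?k j * (\<Sum>k<T. y ^ k * (fact k * (U.er k j * Y k z)))))"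
    by (rule of_real_eq_iff[THEN iffD1])
  have "1 / U.P (x * S z) * (\<Sum>j<R. ?\<kappa> j * Zr T ?\<kappa> ?w j * ?k j * (\<Sum>k<T. y ^ k * (fact k * (U.er k j * Y k z)))) =
    (\<Sum>j<R. \<Sum>k<T. x * (y ^ Suc k * (fact k * ((u j)\<^sup>2 * U.er k j / ((1 + u j * (x * S z)) * U.P (x * S z)) * Y k z))))"
    unfolding sum_distrib_left
    by (intro sum.cong refl) (simp add: Zr \<kappa>_eq power2_eq_square mult_ac)
  also have "\<dots> = (\<Sum>k<T. \<Sum>j<R. x * (y ^ Suc k * (fact k * ((u j)\<^sup>2 * U.er k j / ((1 + u j * (x * S z)) * U.P (x * S z)) * Y k z))))"
    by (rule sum.swap)
  also have "\<dots> = x * (\<Sum>k<T. y ^ Suc k * (fact k * (U.d k (x * S z) * Y k z)))"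
    unfolding U.d_def sum_distrib_left sum_distrib_right ..
  finally show ?thesis unfolding * right_diff_distrib by simp
qed

lemma ratio_eq:
  assumes x: "0 \<le> x" and y: "0 \<le> y"
  shows "ratio x y = 1 + (y - x) * (\<Sum>k<T. y ^ k * Bk k x)"
proof -
  interpret pair_sigma_finite Hm Zm ..
  define f where "f = (\<lambda>h z. wt x z h * Dt y h)"
  have "integrable (Hm \<Otimes>\<^sub>M Zm) (\<lambda>(h, z). Dt y h)"
    using integrable_Dt[of y] by (intro Fubini_integrable) (auto simp: Zm.prob_space)
  hence int: "integrable (Hm \<Otimes>\<^sub>M Zm) (\<lambda>(h, z). f h z)"
  proof (rule Bochner_Integration.integrable_bound)
    show "(\<lambda>(h, z). f h z) \<in> borel_measurable (Hm \<Otimes>\<^sub>M Zm)" unfolding f_def by measurable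
    show "AE p in Hm \<Otimes>\<^sub>M Zm. norm (case p of (h, z) \<Rightarrow> f h z) \<le> norm (case p of (h, z) \<Rightarrow> Dt y h)"
      using wt_bounds(1)[OF x] wt_bounds(2) by (intro AE_I2) (auto simp: f_def abs_mult intro!: mult_left_le_one_le)
  qed
  have "ratio x y = (LINT h|Hm. LINT z|Zm. f h z)"
    unfolding ratio_def f_def using Dt_expectation(4)[OF x] by simp
  also have "\<dots> = (LINT z|Zm. LINT h|Hm. f h z)" by (rule Fubini_integral[OF int, symmetric])
  also have "\<dots> = (LINT z|Zm. (\<Sum>k\<le>T. y ^ k * (fact k * (U.e k * V.e k))) * (1 / U.P (x * S z)) -
    (\<Sum>k<T. (x * (y ^ Suc k * fact k)) * (U.d k (x * S z) * Y k z)))"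
    unfolding f_def mean_det_value[OF x y] by (simp add: sum_distrib_left mult_ac)
  also have "\<dots> = (\<Sum>k\<le>T. y ^ k * (fact k * (U.e k * V.e k))) * (LINT z|Zm. 1 / U.P (x * S z)) -
    (\<Sum>k<T. (x * (y ^ Suc k * fact k)) * (LINT z|Zm. U.d k (x * S z) * Y k z))"
  proof -
    have [measurable]: "(\<lambda>z. U.P (x * S z)) \<in> borel_measurable Zm" "(\<lambda>z. U.d k (x * S z)) \<in> borel_measurable Zm" for k
      unfolding U.d_def U.P_def by measurable
    have s: "0 \<le> x * S z" for z using x S_nonneg by simp
    have P1: "1 \<le> U.P t" if "0 \<le> t" for t
      unfolding U.P_def using U.pos that by (intro prod_ge_1) (auto simp: less_imp_le)
    have "norm (1 / U.P (x * S z)) \<le> 1" for z using P1[OF s, of z] by simp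
    hence i1: "integrable Zm (\<lambda>z. 1 / U.P (x * S z))"
      by (intro Zm.integrable_const_bound[where B = 1] AE_I2) measurable
    have i2: "integrable Zm (\<lambda>z. U.d k (x * S z) * Y k z)" for k
    proof (rule Bochner_Integration.integrable_bound)
      let ?C = "\<Sum>j<R. \<bar>(u j)\<^sup>2 * U.er k j\<bar>"
      show "integrable Zm (\<lambda>z. ?C * Y k z)" using integrable_Y by simp
      have dC: "\<bar>U.d k t\<bar> \<le> ?C" if "0 \<le> t" for t
        unfolding U.d_def
      proof (intro order.trans[OF sum_abs] sum_mono)
        fix j assume "j \<in> {..<R}"
        hence "1 \<le> (1 + u j * t) * U.P t"
          using P1[OF that] U.pos[of j] that mult_mono[of 1 "1 + u j * t" 1 "U.P t"] by simp
        thus "\<bar>(u j)\<^sup>2 * U.er k j / ((1 + u j * t) * U.P t)\<bar> \<le> \<bar>(u j)\<^sup>2 * U.er k j\<bar>"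
          by (subst abs_divide) (simp add: divide_le_eq mult_le_cancel_left1)
      qed
      show "AE z in Zm. norm (U.d k (x * S z) * Y k z) \<le> norm (?C * Y k z)"
        unfolding norm_mult
        by (intro AE_I2 mult_right_mono norm_ge_zero, unfold real_norm_def)
          (rule order.trans[OF dC[OF s] abs_ge_self])
      show "(\<lambda>z. U.d k (x * S z) * Y k z) \<in> borel_measurable Zm"
        using borel_measurable_integrable[OF integrable_Y] by measurable
    qed
    have i3: "integrable Zm (\<lambda>z. c * (U.d k (x * S z) * Y k z))" for c k
      by (rule integrable_mult_right[OF i2])
    have i4: "integrable Zm (\<lambda>z. c * (1 / U.P (x * S z)))" for c
      by (rule integrable_mult_right[OF i1])
    show ?thesis
      unfolding Bochner_Integration.integral_diff[OF i4 Bochner_Integration.integrable_sum[OF i3]]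
        Bochner_Integration.integral_sum[OF i3] integral_mult_right_zero ..
  qed
  also have "\<dots> = (\<Sum>k\<le>T. y ^ k * (if k = 0 then 1 - x * Bk 0 x else Bk (k - 1) x - x * Bk k x))"
  proof -
    define I where "I = (LBINT r:{0<..}. U.g r / V.P (x * r))"
    define J where "J = (\<lambda>k. LBINT r:{0<..}. (r * U.G k r - real (Suc k) * U.G (Suc k) r) * V.d k (x * r))"
    have I: "I = 1 - x * Bk 0 x" unfolding I_def by (rule mixture_0[OF x])
    have J: "fact (Suc k) * (U.e (Suc k) * V.e (Suc k)) * I - x * (fact k * J k) = Bk k x - x * Bk (Suc k) x" for k
      unfolding I_def J_def by (rule mixture_Suc[OF x])
    have "(\<Sum>k\<le>T. y ^ k * (fact k * (U.e k * V.e k))) * I - (\<Sum>k<T. (x * (y ^ Suc k * fact k)) * J k) =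
      I + ((\<Sum>k<T. y ^ Suc k * (fact (Suc k) * (U.e (Suc k) * V.e (Suc k)))) * I - (\<Sum>k<T. (x * (y ^ Suc k * fact k)) * J k))"
      unfolding sum.atMost_shift by (simp add: U.e_0 V.e_0 distrib_right del: fact_Suc power_Suc of_nat_Suc)
    also have "\<dots> = I + (\<Sum>k<T. y ^ Suc k * (fact (Suc k) * (U.e (Suc k) * V.e (Suc k)) * I - x * (fact k * J k)))"
      unfolding sum_distrib_right sum_subtractf[symmetric]
      by (intro arg_cong2[where f = "(+)"] sum.cong refl) (simp only: right_diff_distrib mult_ac)
    also have "\<dots> = (\<Sum>k\<le>T. y ^ k * (if k = 0 then 1 - x * Bk 0 x else Bk (k - 1) x - x * Bk k x))"
      unfolding sum.atMost_shift J by (simp add: I)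
    finally show ?thesis unfolding expectation_inverse_P[OF x] expectation_d[OF x] I_def J_def .
  qed
  also have "\<dots> = 1 + (y - x) * (\<Sum>k<T. y ^ k * Bk k x)"
  proof -
    \<comment> \<open>The sum telescopes up to one boundary term, which vanishes for
      \<open>m = T\<close> by \<open>Bk_T_eq_0\<close>.\<close>
    have "(\<Sum>k\<le>m. y ^ k * (if k = 0 then 1 - x * Bk 0 x else Bk (k - 1) x - x * Bk k x)) =
      1 + (y - x) * (\<Sum>k<m. y ^ k * Bk k x) - x * y ^ m * Bk m x" for m
      by (induction m) (simp_all add: algebra_simps)
    from this[of T] show ?thesis by (simp add: Bk_T_eq_0)
  qed
  finally show ?thesis .
qed

section \<open>The mean log-determinant\<close>

definition L :: "real \<Rightarrow> real" where
  "L x = (LINT h|Hm. ln (Dt x h))"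

lemma integrable_ln_Dt:
  assumes "0 \<le> x"
  shows "integrable Hm (\<lambda>h. ln (Dt x h))"
proof (rule Bochner_Integration.integrable_bound[OF integrable_Dt[of x]])
  have "norm (ln (Dt x h)) \<le> norm (Dt x h)" for h
    using Dt_ge_1[OF assms, of h] ln_le_minus_one[of "Dt x h"] by (simp add: abs_of_nonneg)
  thus "AE h in Hm. norm (ln (Dt x h)) \<le> norm (Dt x h)" by (intro AE_I2)
qed measurable

text \<open>Exchanging \<open>x\<close> and \<open>y\<close> gives the matching lower bound, so
  \<open>ln r \<le> r - 1\<close> is the only inequality to integrate.\<close>

lemma L_diff_le:
  assumes "0 \<le> x" "0 \<le> y"
  shows "L y - L x \<le> (y - x) * (\<Sum>k<T. y ^ k * Bk k x)"
proof -
  have "L y - L x = (LINT h|Hm. ln (Dt y h) - ln (Dt x h))"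
    unfolding L_def using integrable_ln_Dt assms by (intro Bochner_Integration.integral_diff[symmetric])
  also have "\<dots> \<le> (LINT h|Hm. Dt y h / Dt x h - 1)"
  proof (rule integral_mono)
    fix h
    have "0 < Dt x h" "0 < Dt y h" using Dt_expectation(2) assms by auto
    thus "ln (Dt y h) - ln (Dt x h) \<le> Dt y h / Dt x h - 1"
      using ln_le_minus_one[of "Dt y h / Dt x h"] by (simp add: ln_div)
  qed (use integrable_ln_Dt integrable_ratio assms in auto)
  also have "\<dots> = ratio x y - 1"
    unfolding ratio_def using integrable_ratio[OF assms] by (simp add: Hm.prob_space)
  finally show ?thesis unfolding ratio_eq[OF assms] by simp
qed

lemma L_eq_Lam:
  assumes x: "0 \<le> x"
  shows "L x = Lam x"
proof -
  define K where "K x y = (\<Sum>k<T. y ^ k * Bk k x)" for x y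
  have DL: "(L has_real_derivative K x x) (at x within {0..})" if x: "0 \<le> x" for x
  proof -
    have c1: "((\<lambda>y. K x y) \<longlongrightarrow> K x x) (at x within {0..})"
      unfolding K_def by (intro tendsto_intros)
    have c2: "((\<lambda>y. K y x) \<longlongrightarrow> K x x) (at x within {0..})"
      unfolding K_def using continuous_on_Bk x by (intro tendsto_intros) (auto simp: continuous_on_def)
    have "((\<lambda>y. (L y - L x) / (y - x) - K x x) \<longlongrightarrow> 0) (at x within {0..})"
    proof (rule Lim_null_comparison)
      show "eventually (\<lambda>y. norm ((L y - L x) / (y - x) - K x x) \<le> \<bar>K x y - K x x\<bar> + \<bar>K y x - K x x\<bar>) (at x within {0..})"
        unfolding eventually_at_topological
      proof (intro exI[of _ UNIV] conjI ballI impI)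
        fix y assume y: "y \<noteq> x" "y \<in> {0..}"
        have up: "L y - L x \<le> (y - x) * K x y" using L_diff_le[OF x, of y] y by (simp add: K_def)
        have lo: "(y - x) * K y x \<le> L y - L x"
          using L_diff_le[of y x] x y by (simp add: K_def algebra_simps)
        \<comment> \<open>Which of the two bounds lies above depends on the sign of
          \<open>y - x\<close>; continuity in either argument closes the squeeze in both
          cases.\<close>
        have "K y x \<le> (L y - L x) / (y - x) \<and> (L y - L x) / (y - x) \<le> K x y \<or>
              K x y \<le> (L y - L x) / (y - x) \<and> (L y - L x) / (y - x) \<le> K y x"
        proof (cases "x < y")
          case True
          thus ?thesis using up lo by (simp add: field_simps)
        next
          case False
          hence "y - x < 0" using y by simp
          thus ?thesis using up lo by (simp add: neg_le_divide_eq neg_divide_le_eq mult.commute)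
        qed
        thus "norm ((L y - L x) / (y - x) - K x x) \<le> \<bar>K x y - K x x\<bar> + \<bar>K y x - K x x\<bar>" by auto
      qed auto
      have "((\<lambda>y. \<bar>K x y - K x x\<bar> + \<bar>K y x - K x x\<bar>) \<longlongrightarrow> \<bar>K x x - K x x\<bar> + \<bar>K x x - K x x\<bar>) (at x within {0..})"
        by (intro tendsto_intros c1 c2)
      thus "((\<lambda>y. \<bar>K x y - K x x\<bar> + \<bar>K y x - K x x\<bar>) \<longlongrightarrow> 0) (at x within {0..})" by simp
    qed
    hence "((\<lambda>y. (L y - L x) / (y - x)) \<longlongrightarrow> K x x) (at x within {0..})" by (rule LIM_zero_cancel)
    thus ?thesis by (simp add: has_field_derivative_iff)
  qed
  have "((\<lambda>x. L x - Lam x) has_real_derivative 0) (at x within {0..})" if "x \<in> {0..}" for x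
    using DERIV_diff[OF DL[of x] DERIV_Lam[of x]] that by (simp add: K_def)
  hence "\<exists>c. \<forall>x\<in>{0..}. L x - Lam x = c"
    by (intro has_field_derivative_zero_constant convex_real_interval) auto
  then obtain c where c: "L x - Lam x = c" if "0 \<le> x" for x by auto
  \<comment> \<open>At \<open>x = 0\<close> the determinant is 1 and the primitive vanishes, which
    fixes the constant.\<close>
  have "detf T (chan 0 h) = 1" for h
  proof -
    have "detf T (chan 0 h) = (\<Prod>i<T. chan 0 h i i)"
      by (rule detf_upper_triangular) (auto simp: chan_def shifted_def)
    thus ?thesis by (simp add: chan_def shifted_def)
  qed
  hence "L 0 = 0" by (simp add: L_def Dt_def)
  moreover have "Lam 0 = 0" by (simp add: Lam_def)
  ultimately show ?thesis using c[of 0] c[OF x] by simp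
qed

lemma L_formula:
  assumes x: "0 < x"
  shows "L x = (\<Sum>k<T. fact k * x ^ k * (\<Sum>j<R. \<Sum>i<T. U.alpha j * U.er k j * V.alpha i * V.er k i *
     (exp (1 / (x * u j * v i)) * exp_integral_E1 (1 / (x * u j * v i)))))"
proof -
  have "x * stieltjes (u j) (v i) x = exp (1 / (x * u j * v i)) * exp_integral_E1 (1 / (x * u j * v i))"
    if "j < R" "i < T" for i j
    by (rule stieltjes_E1) (use that U.pos V.pos x in auto)
  hence "(\<Sum>j<R. \<Sum>i<T. U.alpha j * U.er k j * V.alpha i * V.er k i * (x * stieltjes (u j) (v i) x)) =
     (\<Sum>j<R. \<Sum>i<T. U.alpha j * U.er k j * V.alpha i * V.er k i *
     (exp (1 / (x * u j * v i)) * exp_integral_E1 (1 / (x * u j * v i))))" for k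
    by (intro sum.cong) auto
  hence A: "(\<Sum>j<R. \<Sum>i<T. U.alpha j * U.er k j * V.alpha i * V.er k i *
     (exp (1 / (x * u j * v i)) * exp_integral_E1 (1 / (x * u j * v i)))) =
     x * (\<Sum>j<R. \<Sum>i<T. U.alpha j * U.er k j * V.alpha i * V.er k i * stieltjes (u j) (v i) x)" for k
    by (simp add: sum_distrib_left mult.left_commute)
  show ?thesis unfolding L_eq_Lam[OF less_imp_le[OF x]] Lam_def
    by (intro sum.cong refl, simp only: A Nk_stieltjes(1)[OF less_imp_le[OF x]] power_Suc) (simp only: mult_ac)
qed

end

section \<open>The trace formula\<close>

context distinct_scales
begin

text \<open>The Lagrange basis at the nodes \<open>a j\<close>; its coefficients are the entries of
  the inverse Vandermonde matrix.\<close>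

definition lag :: "nat \<Rightarrow> real poly" where
  "lag j = Polynomial.smult (\<Prod>l\<in>{..<n} - {j}. 1 / (a j - a l)) (\<Prod>l\<in>{..<n} - {j}. [:- a l, 1:])"

lemma degree_lag_le: "j < n \<Longrightarrow> Polynomial.degree (lag j) \<le> n - 1"
  unfolding lag_def by (rule order.trans[OF degree_smult_le], rule order.trans[OF degree_prod_sum_le])
    (auto simp: card_Diff_singleton_if)

lemma poly_lag:
  assumes "i < n" "j < n"
  shows "poly (lag j) (a i) = (if i = j then 1 else 0)"
proof (cases "i = j")
  case True
  have "a j - a l \<noteq> 0" if "l \<in> {..<n} - {j}" for l
    using inj that assms by (auto simp: inj_on_def)
  hence "(\<Prod>l\<in>{..<n} - {j}. 1 / (a j - a l)) * (\<Prod>l\<in>{..<n} - {j}. a j - a l) = (\<Prod>l\<in>{..<n} - {j}. 1)"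
    unfolding prod.distrib[symmetric] by (intro prod.cong) auto
  thus ?thesis using True by (simp add: lag_def poly_prod)
next
  case False
  hence "(\<Prod>l\<in>{..<n} - {j}. a i - a l) = 0" using assms by (intro prod_zero) auto
  thus ?thesis using False by (simp add: lag_def poly_prod)
qed

lemma coeff_lag_row:
  assumes "i < n" "j < n"
  shows "(\<Sum>m<n. a i ^ m * coeff (lag j) m) = (if i = j then 1 else 0)"
proof -
  have "poly (lag j) (a i) = (\<Sum>m\<le>n - 1. coeff (lag j) m * a i ^ m)"
    unfolding poly_altdef using degree_lag_le[OF assms(2)]
    by (intro sum.mono_neutral_left) (auto simp: coeff_eq_0)
  also have "{..n - 1} = {..<n}" using assms by auto
  finally show ?thesis using poly_lag[OF assms] by (simp add: mult.commute)
qed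

text \<open>Interpolation at \<open>n\<close> nodes reproduces the monomial of degree
  \<open>k < n\<close>.\<close>

lemma coeff_lag_col:
  assumes "k < n" "m < n"
  shows "(\<Sum>j<n. a j ^ k * coeff (lag j) m) = (if k = m then 1 else 0)"
proof -
  have "(\<Sum>j<n. Polynomial.smult (a j ^ k) (lag j)) = monom 1 k"
  proof (rule poly_eqI_degree[where A = "a ` {..<n}"])
    have card: "card (a ` {..<n}) = n" using inj by (simp add: card_image)
    have "Polynomial.degree (\<Sum>j<n. Polynomial.smult (a j ^ k) (lag j)) \<le> n - 1"
      by (intro degree_sum_le order.trans[OF degree_smult_le degree_lag_le]) auto
    thus "Polynomial.degree (\<Sum>j<n. Polynomial.smult (a j ^ k) (lag j)) < card (a ` {..<n})"
      unfolding card using assms by linarith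
    show "Polynomial.degree (monom (1::real) k) < card (a ` {..<n})"
      unfolding card using assms degree_monom_le[of "1::real" k] by linarith
    fix x assume "x \<in> a ` {..<n}"
    then obtain i where i: "i < n" "x = a i" by auto
    have "(\<Sum>j<n. a j ^ k * poly (lag j) (a i)) = (\<Sum>j<n. if j = i then a i ^ k else 0)"
      by (intro sum.cong refl) (use i poly_lag in auto)
    thus "poly (\<Sum>j<n. Polynomial.smult (a j ^ k) (lag j)) x = poly (monom 1 k) x"
      using i by (simp add: poly_sum poly_monom)
  qed
  from arg_cong[OF this, of "\<lambda>p. coeff p m"] show ?thesis by (simp add: coeff_sum)
qed

text \<open>Reversing the product of the \<open>t - a l\<close> gives the product of the
  \<open>1 - a l * t\<close>, so the coefficients counted from the top are signed
  \<open>er p j\<close>; the power \<open>a j ^ (n - 1)\<close> turns the Lagrange denominator into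
  \<open>alpha j\<close>.\<close>

lemma coeff_lag_top:
  assumes j: "j < n" and p: "p < n"
  shows "coeff (lag j) (n - 1 - p) * a j ^ (n - 1) = (-1) ^ p * (er p j * alpha j)"
proof -
  let ?A = "{..<n} - {j}"
  define q where "q = (\<Prod>l\<in>?A. [:- a l, 1:])"
  have card: "card ?A = n - 1" using j by (simp add: card_Diff_singleton_if)
  have nz: "a l \<noteq> 0" if "l \<in> ?A" for l using pos[of l] that by simp
  have deg: "Polynomial.degree q = n - 1"
    unfolding q_def by (subst degree_prod_eq_sum_degree) (use card in auto)
  have "reflect_poly q = (\<Prod>l\<in>?A. [:1, - 1 * a l:])"
    unfolding q_def reflect_poly_prod
    by (intro prod.cong refl) (use nz in \<open>auto simp: reflect_poly_pCons\<close>)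
  also have "\<dots> = esym_poly (\<lambda>l. - 1 * a l) ?A" by (simp only: esym_poly_def)
  finally have "coeff (reflect_poly q) p = (-1) ^ p * er p j"
    unfolding er_def using esym_scale[of ?A "-1" a p] by (simp add: esym_def)
  hence c: "coeff q (n - 1 - p) = (-1) ^ p * er p j"
    using p unfolding coeff_reflect_poly deg by (simp split: if_splits)
  have al: "alpha j = (\<Prod>l\<in>?A. 1 / (a j - a l)) * a j ^ (n - 1)"
    unfolding alpha_def using card by (simp add: prod_dividef)
  have "coeff (lag j) (n - 1 - p) = (\<Prod>l\<in>?A. 1 / (a j - a l)) * coeff q (n - 1 - p)"
    by (simp only: lag_def q_def coeff_smult)
  thus ?thesis unfolding c al by (simp only: mult_ac)
qed

end

lemma mat_trace_mult_comm:
  assumes "A \<in> carrier_mat n n" "B \<in> carrier_mat n n"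
  shows "mat_trace (A * B) = mat_trace (B * A :: real mat)"
proof -
  have "mat_trace (A * B) = (\<Sum>i<n. \<Sum>j<n. A $$ (i, j) * B $$ (j, i))"
    using assms by (auto simp: mat_trace_def scalar_prod_def atLeast0LessThan intro!: sum.cong)
  also have "\<dots> = (\<Sum>j<n. \<Sum>i<n. B $$ (j, i) * A $$ (i, j))"
    by (subst sum.swap) (simp add: mult.commute)
  also have "\<dots> = mat_trace (B * A)"
    using assms by (auto simp: mat_trace_def scalar_prod_def atLeast0LessThan intro!: sum.cong)
  finally show ?thesis .
qed

text \<open>A right inverse of a square matrix is two-sided, and uniqueness identifies it with the
  one that \<open>mat_inverse\<close> computes.\<close>

lemma mat_inverse_eq:
  fixes A :: "real mat"
  assumes A: "A \<in> carrier_mat n n" and Y: "Y \<in> carrier_mat n n" and AY: "A * Y = 1\<^sub>m n"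
  shows "invertible_mat A" "mat_inverse A = Some Y"
proof -
  have YA: "Y * A = 1\<^sub>m n" by (rule mat_mult_left_right_inverse[OF A Y AY])
  show "invertible_mat A"
    unfolding invertible_mat_def inverts_mat_def square_mat.simps
    using A Y AY YA by (intro conjI exI[of _ Y]) auto
  show "mat_inverse A = Some Y"
  proof (cases "mat_inverse A")
    case None
    have "A \<in> Units (ring_mat TYPE(real) n ())"
      unfolding Units_def ring_mat_def using A Y AY YA by auto
    with mat_inverse(1)[OF A None, of "()"] show ?thesis by auto
  next
    case (Some B)
    with mat_inverse(2)[OF A Some] have B: "B * A = 1\<^sub>m n" "B \<in> carrier_mat n n" by auto
    have "B = B * (A * Y)" using B AY by simp
    also have "\<dots> = (B * A) * Y" by (rule assoc_mult_mat[symmetric, OF B(2) A Y])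
    finally show ?thesis using B Y Some by simp
  qed
qed

section \<open>Pochhammer factors and the sums \<open>H_sum\<close>\<close>

lemma xi_nonzero: "k < R \<Longrightarrow> xi R k \<noteq> 0"
proof -
  assume k: "k < R"
  have "- real R + 1 + real i \<noteq> 0" if "i < k" for i using that k by simp
  thus ?thesis by (auto simp: xi_def pochhammer_prod)
qed

text \<open>The last \<open>p\<close> factors of the Pochhammer product are
  \<open>-p, ..., -1\<close>.\<close>

lemma xi_top:
  assumes "p < R"
  shows "xi R (R - 1) = xi R (R - 1 - p) * ((-1) ^ p * fact p)"
proof -
  have "xi R (R - 1) = xi R (R - 1 - p) * pochhammer (- real R + 1 + real (R - 1 - p)) (R - 1 - (R - 1 - p))"
    unfolding xi_def by (rule pochhammer_product) simp
  also have "- real R + 1 + real (R - 1 - p) = - real p" using assms by (simp add: of_nat_diff)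
  also have "R - 1 - (R - 1 - p) = p" using assms by simp
  finally show ?thesis by (simp add: pochhammer_same)
qed

text \<open>After exchanging the sums, \<open>1 / (r - R)\<close> occurs \<open>R - r\<close> times,
  so each of the \<open>R - 1\<close> values of \<open>r\<close> contributes -1.\<close>

lemma sum_H_sum:
  assumes "0 < R"
  shows "(\<Sum>k<R. H_sum R k) = - (real R - 1)"
proof -
  have "(\<Sum>k<m. H_sum R k) = (\<Sum>r\<in>{1..<m}. (real m - real r) / (- real R + real r))" for m
  proof (induction m)
    case (Suc m)
    have "(\<Sum>r\<in>{1..<Suc m}. (real (Suc m) - real r) / (- real R + real r)) =
      (\<Sum>r\<in>{1..<Suc m}. (real m - real r) / (- real R + real r)) + (\<Sum>r\<in>{1..<Suc m}. 1 / (- real R + real r))"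
      unfolding sum.distrib[symmetric] by (intro sum.cong refl) (simp add: add_divide_distrib[symmetric])
    also have "(\<Sum>r\<in>{1..<Suc m}. (real m - real r) / (- real R + real r)) =
      (\<Sum>r\<in>{1..<m}. (real m - real r) / (- real R + real r))"
      by (intro sum.mono_neutral_right) (auto simp: less_Suc_eq)
    also have "(\<Sum>r\<in>{1..<Suc m}. 1 / (- real R + real r)) = H_sum R m"
      unfolding H_sum_def by (intro sum.cong) auto
    finally show ?case using Suc by simp
  qed simp
  also have "(\<Sum>r\<in>{1..<R}. (real R - real r) / (- real R + real r)) = (\<Sum>r\<in>{1..<R}. - 1)"
    by (intro sum.cong refl) (simp add: field_simps)
  finally show ?thesis using assms by (simp add: of_nat_diff)
qed

section \<open>Factorisation, inversion and trace of the block matrices\<close>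

locale psi_setup =
  U: distinct_scales "\<lambda>j. u $ j" R + V: distinct_scales "\<lambda>i. v $ i" T
  for u v :: "real vec" and R T :: nat +
  fixes g :: real
  assumes T: "1 \<le> T" and TR: "T \<le> R" and g: "0 < g"
begin

definition c :: "nat \<Rightarrow> real" where "c k = (- (g / real T)) ^ k * xi R k"

definition J :: "nat \<Rightarrow> nat \<Rightarrow> real" where
  "J j i = exp (real T / (g * u $ j * v $ i)) * exp_integral_E1 (real T / (g * u $ j * v $ i))"

text \<open>Rows below \<open>T\<close> hold the powers of \<open>v $ r\<close> in the last
  \<open>T\<close> columns; each remaining row selects one of the first \<open>R - T\<close>
  columns, as a row of \<open>Psi2\<close> consists of a single power of the
  \<open>u $ j\<close>.\<close>

definition Dm :: "real mat" where
  "Dm = mat R R (\<lambda>(r, k). if r < T then (if R - T \<le> k then (v $ r) ^ (k + T - R) else 0) else (if k = r - T then 1 else 0))"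

definition Di :: "real mat" where
  "Di = mat R R (\<lambda>(k, r). if r < T then (if R - T \<le> k then coeff (V.lag r) (k - (R - T)) else 0) else (if k = r - T then 1 else 0))"

definition Xm :: "real mat" where "Xm = mat R R (\<lambda>(k, j). c k * (u $ j) ^ k)"

definition Xi :: "real mat" where "Xi = mat R R (\<lambda>(j, k). coeff (U.lag j) k / c k)"

text \<open>The part of \<open>dPsi\<close> that carries the exponential integral, without the
  factor \<open>1 / ln 2\<close>.\<close>

definition Em :: "real mat" where
  "Em = mat R R (\<lambda>(r, j). if r < T then c (R - 1) * (u $ j) ^ (R - 1) * (v $ r) ^ (T - 1) * J j r else 0)"

lemma R: "0 < R" using T TR by simp

lemma c_nonzero: "k < R \<Longrightarrow> c k \<noteq> 0"
  using xi_nonzero[of k R] g T by (simp add: c_def)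

lemma carriers [simp]: "Dm \<in> carrier_mat R R" "Di \<in> carrier_mat R R" "Xm \<in> carrier_mat R R" "Xi \<in> carrier_mat R R"
    "Em \<in> carrier_mat R R"
  by (auto simp: Dm_def Di_def Xm_def Xi_def Em_def)

lemma split_R: "(\<Sum>k<R. F k) = (\<Sum>k<R - T. F k) + (\<Sum>m<T. F (R - T + m))" for F :: "nat \<Rightarrow> real"
proof -
  have "(\<Sum>k<a + b. F k) = (\<Sum>k<a. F k) + (\<Sum>m<b. F (a + m))" for a b
    by (induction b) simp_all
  from this[of "R - T" T]
  have "(\<Sum>k<R - T + T. F k) = (\<Sum>k<R - T. F k) + (\<Sum>m<T. F (R - T + m))" .
  thus ?thesis using TR by simp
qed

lemma Xm_Xi: "Xm * Xi = 1\<^sub>m R"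
proof (rule eq_matI)
  fix k m assume km: "k < dim_row (1\<^sub>m R :: real mat)" "m < dim_col (1\<^sub>m R :: real mat)"
  have "(Xm * Xi) $$ (k, m) = (\<Sum>j<R. c k * (u $ j) ^ k * (coeff (U.lag j) m / c m))"
    using km by (simp add: Xm_def Xi_def scalar_prod_def atLeast0LessThan)
  also have "\<dots> = c k / c m * (\<Sum>j<R. (u $ j) ^ k * coeff (U.lag j) m)"
    by (simp add: sum_distrib_left mult_ac)
  also have "\<dots> = (1\<^sub>m R) $$ (k, m)"
    using km U.coeff_lag_col[of k m] c_nonzero[of m] by simp
  finally show "(Xm * Xi) $$ (k, m) = (1\<^sub>m R) $$ (k, m)" .
qed (auto simp: Xm_def Xi_def)

lemma Dm_Di: "Dm * Di = 1\<^sub>m R"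
proof (rule eq_matI)
  fix r s assume rs: "r < dim_row (1\<^sub>m R :: real mat)" "s < dim_col (1\<^sub>m R :: real mat)"
  have "(Dm * Di) $$ (r, s) = (\<Sum>k<R. Dm $$ (r, k) * Di $$ (k, s))"
    using rs by (simp add: Dm_def Di_def scalar_prod_def atLeast0LessThan)
  also have "\<dots> = (\<Sum>k<R - T. Dm $$ (r, k) * Di $$ (k, s)) + (\<Sum>m<T. Dm $$ (r, R - T + m) * Di $$ (R - T + m, s))"
    by (rule split_R)
  also have "(\<Sum>k<R - T. Dm $$ (r, k) * Di $$ (k, s)) = (\<Sum>k<R - T. if k = r - T then (if T \<le> r \<and> T \<le> s \<and> r = s then 1 else 0) else 0)"
    using rs by (intro sum.cong refl) (auto simp: Dm_def Di_def)
  also have "\<dots> = (if T \<le> r \<and> r = s then 1 else 0)"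
    using rs TR by auto
  also have "(\<Sum>m<T. Dm $$ (r, R - T + m) * Di $$ (R - T + m, s)) = (\<Sum>m<T. if r < T \<and> s < T then (v $ r) ^ m * coeff (V.lag s) m else 0)"
  proof (rule sum.cong[OF refl])
    fix m assume m: "m \<in> {..<T}"
    define k where "k = R - T + m"
    have k: "k < R" "R - T \<le> k" "k + T - R = m" "k - (R - T) = m" using m TR by (auto simp: k_def)
    have "k \<noteq> r - T" if "\<not> r < T"
    proof -
      have "r - T < R - T" using rs that by (simp add: diff_less_mono)
      thus ?thesis using k(2) by linarith
    qed
    thus "Dm $$ (r, R - T + m) * Di $$ (R - T + m, s) = (if r < T \<and> s < T then (v $ r) ^ m * coeff (V.lag s) m else 0)"
      unfolding k_def[symmetric] using rs k by (auto simp: Dm_def Di_def)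
  qed
  also have "\<dots> = (if r < T \<and> r = s then 1 else 0)"
    by (cases "r < T \<and> s < T") (use V.coeff_lag_row[of r s] in auto)
  finally show "(Dm * Di) $$ (r, s) = (1\<^sub>m R) $$ (r, s)" using rs by auto
qed (auto simp: Dm_def Di_def)

lemma scaled_power: "(- (g * x / real T)) ^ k = (- (g / real T)) ^ k * x ^ k"
  by (simp add: power_mult_distrib[symmetric])

text \<open>In \<open>Psi1\<close> the summand \<open>k = R - 1\<close> stands apart, with exponent
  \<open>T - 1 = (R - 1) + T - R\<close>.\<close>

lemma tail_sum:
  "(\<Sum>k<R. (if R - T \<le> k then x ^ (k + T - R) else 0) * F k) = x ^ (T - 1) * F (R - 1) + (\<Sum>k\<in>{R - T..<R - 1}. x ^ (k + T - R) * F k)"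
  for F :: "nat \<Rightarrow> real"
proof -
  have "(\<Sum>k<R. (if R - T \<le> k then x ^ (k + T - R) else 0) * F k) = (\<Sum>k\<in>{R - T..<R}. x ^ (k + T - R) * F k)"
    by (intro sum.mono_neutral_cong_right) auto
  also have "{R - T..<R} = insert (R - 1) {R - T..<R - 1}" using T TR by auto
  also have "(\<Sum>k\<in>insert (R - 1) {R - T..<R - 1}. x ^ (k + T - R) * F k) =
      x ^ (R - 1 + T - R) * F (R - 1) + (\<Sum>k\<in>{R - T..<R - 1}. x ^ (k + T - R) * F k)"
    by (rule sum.insert) auto
  also have "R - 1 + T - R = T - 1" using R by simp
  finally show ?thesis .
qed

lemma Psi_eq: "Psi R T g u v = Dm * Xm"
proof (rule eq_matI)
  fix r j assume rj: "r < dim_row (Dm * Xm)" "j < dim_col (Dm * Xm)"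
  hence r: "r < R" and j: "j < R" by (auto simp: Dm_def Xm_def)
  have DX: "(Dm * Xm) $$ (r, j) = (\<Sum>k<R. Dm $$ (r, k) * (c k * (u $ j) ^ k))"
    using r j by (simp add: Dm_def Xm_def scalar_prod_def atLeast0LessThan)
  show "Psi R T g u v $$ (r, j) = (Dm * Xm) $$ (r, j)"
  proof (cases "r < T")
    case True
    have "(Dm * Xm) $$ (r, j) = (\<Sum>k<R. (if R - T \<le> k then (v $ r) ^ (k + T - R) else 0) * (c k * (u $ j) ^ k))"
      unfolding DX using r True by (intro sum.cong) (auto simp: Dm_def)
    thus ?thesis unfolding tail_sum using True r j TR
      by (simp add: Psi_def append_rows_def Psi1_def Psi2_def scaled_power c_def mult_ac)
  next
    case False
    have "(Dm * Xm) $$ (r, j) = (\<Sum>k<R. if k = r - T then c k * (u $ j) ^ k else 0)"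
      unfolding DX using r False by (intro sum.cong) (auto simp: Dm_def)
    also have "\<dots> = c (r - T) * (u $ j) ^ (r - T)" using r by auto
    finally show ?thesis using False r j TR
      by (simp add: Psi_def append_rows_def Psi1_def Psi2_def scaled_power c_def mult_ac)
  qed
qed (use TR in \<open>auto simp: Psi_def append_rows_def Psi1_def Psi2_def Dm_def Xm_def\<close>)

text \<open>\<open>H_sum R k\<close> multiplies the \<open>k\<close>-th power of
  \<open>u $ j\<close> in every row, so it acts as a diagonal matrix between the two factors of
  \<open>Psi\<close>.\<close>

lemma dPsi_eq: "dPsi R T g u v = (1 / ln 2) \<cdot>\<^sub>m (Em - Dm * (mat_diag R (H_sum R) * Xm))"
proof (rule eq_matI)
  let ?N = "(1 / ln 2) \<cdot>\<^sub>m (Em - Dm * (mat_diag R (H_sum R) * Xm))"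
  fix r j assume rj: "r < dim_row ?N" "j < dim_col ?N"
  hence r: "r < R" and j: "j < R" by (auto simp: Dm_def Xm_def mat_diag_def)
  have HX: "mat_diag R (H_sum R) * Xm = mat R R (\<lambda>(k, j). H_sum R k * (c k * (u $ j) ^ k))"
    by (subst mat_diag_mult_left[OF carriers(3)]) (auto simp: Xm_def)
  have DX: "(Dm * (mat_diag R (H_sum R) * Xm)) $$ (r, j) = (\<Sum>k<R. Dm $$ (r, k) * (H_sum R k * (c k * (u $ j) ^ k)))"
    using r j unfolding HX by (simp add: Dm_def scalar_prod_def atLeast0LessThan)
  have N: "?N $$ (r, j) = (1 / ln 2) * (Em $$ (r, j) - (Dm * (mat_diag R (H_sum R) * Xm)) $$ (r, j))"
    using r j by (simp add: Dm_def Xm_def mat_diag_def)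
  show "dPsi R T g u v $$ (r, j) = ?N $$ (r, j)"
  proof (cases "r < T")
    case True
    have "(Dm * (mat_diag R (H_sum R) * Xm)) $$ (r, j) =
      (\<Sum>k<R. (if R - T \<le> k then (v $ r) ^ (k + T - R) else 0) * (H_sum R k * (c k * (u $ j) ^ k)))"
      unfolding DX using r True by (intro sum.cong) (auto simp: Dm_def)
    also have "\<dots> = (v $ r) ^ (T - 1) * (H_sum R (R - 1) * (c (R - 1) * (u $ j) ^ (R - 1))) +
        (\<Sum>k\<in>{R - T..<R - 1}. (- (g * u $ j / real T)) ^ k * (v $ r) ^ (k + T - R) * xi R k * H_sum R k)"
      unfolding tail_sum scaled_power c_def by (simp add: mult_ac)
    finally have DX': "(Dm * (mat_diag R (H_sum R) * Xm)) $$ (r, j) =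
        (v $ r) ^ (T - 1) * (H_sum R (R - 1) * (c (R - 1) * (u $ j) ^ (R - 1))) +
        (\<Sum>k\<in>{R - T..<R - 1}. (- (g * u $ j / real T)) ^ k * (v $ r) ^ (k + T - R) * xi R k * H_sum R k)" .
    have E: "Em $$ (r, j) = c (R - 1) * (u $ j) ^ (R - 1) * (v $ r) ^ (T - 1) * J j r"
      using r j True by (simp add: Em_def)
    have "dPsi R T g u v $$ (r, j) = - (1 / ln 2) * (- (g * u $ j / real T)) ^ (R - 1) * (v $ r) ^ (T - 1) * xi R (R - 1)
         * (H_sum R (R - 1) - J j r)
     - (1 / ln 2) * (\<Sum>k\<in>{R - T..<R - 1}. (- (g * u $ j / real T)) ^ k * (v $ r) ^ (k + T - R) * xi R k * H_sum R k)"
      using True r j TR by (simp add: dPsi_def append_rows_def dPsi1_def dPsi2_def J_def)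
    also have "(- (g * u $ j / real T)) ^ (R - 1) = (- (g / real T)) ^ (R - 1) * (u $ j) ^ (R - 1)"
      by (rule scaled_power)
    finally have d: "dPsi R T g u v $$ (r, j) = - (1 / ln 2) * ((- (g / real T)) ^ (R - 1) * (u $ j) ^ (R - 1)) *
      (v $ r) ^ (T - 1) * xi R (R - 1) * (H_sum R (R - 1) - J j r)
      - (1 / ln 2) * (\<Sum>k\<in>{R - T..<R - 1}. (- (g * u $ j / real T)) ^ k * (v $ r) ^ (k + T - R) * xi R k * H_sum R k)" .
    have "- L * (A * B) * V * X * (H - Jj) - L * S' = L * (A * X * B * V * Jj - (V * (H * (A * X * B)) + S'))"
      for L A B V X H Jj S' :: real by (simp add: algebra_simps)
    thus ?thesis unfolding N DX' E d c_def .
  next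
    case False
    have "(Dm * (mat_diag R (H_sum R) * Xm)) $$ (r, j) = (\<Sum>k<R. if k = r - T then H_sum R k * (c k * (u $ j) ^ k) else 0)"
      unfolding DX using r False by (intro sum.cong) (auto simp: Dm_def)
    also have "\<dots> = H_sum R (r - T) * (c (r - T) * (u $ j) ^ (r - T))" using r by auto
    finally have DX': "(Dm * (mat_diag R (H_sum R) * Xm)) $$ (r, j) = H_sum R (r - T) * (c (r - T) * (u $ j) ^ (r - T))" .
    have E: "Em $$ (r, j) = 0" using r j False by (simp add: Em_def)
    show ?thesis unfolding N DX' E using False r j TR
      by (simp add: dPsi_def append_rows_def dPsi1_def dPsi2_def scaled_power c_def mult_ac)
  qed
qed (use TR in \<open>auto simp: dPsi_def append_rows_def dPsi1_def dPsi2_def Dm_def Xm_def mat_diag_def\<close>)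

lemma Psi_inverse:
  shows "invertible_mat (Psi R T g u v)" "the (mat_inverse (Psi R T g u v)) = Xi * Di"
proof -
  have Y: "(Dm * Xm) * (Xi * Di) = 1\<^sub>m R"
  proof -
    have "(Dm * Xm) * (Xi * Di) = Dm * (Xm * (Xi * Di))"
      by (rule assoc_mult_mat[OF carriers(1) carriers(3) mult_carrier_mat[OF carriers(4) carriers(2)]])
    also have "Xm * (Xi * Di) = (Xm * Xi) * Di" by (rule assoc_mult_mat[symmetric, of _ R R _ R _ R]) auto
    also have "\<dots> = Di" unfolding Xm_Xi by (rule left_mult_one_mat[of _ R R]) simp
    finally show ?thesis by (simp add: Dm_Di)
  qed
  have C: "Psi R T g u v \<in> carrier_mat R R" "Xi * Di \<in> carrier_mat R R"
    unfolding Psi_eq by (rule mult_carrier_mat[of _ R R _ R]; simp)+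
  note inv = mat_inverse_eq[OF C, unfolded Psi_eq, OF Y]
  show "invertible_mat (Psi R T g u v)" unfolding Psi_eq by (rule inv(1))
  show "the (mat_inverse (Psi R T g u v)) = Xi * Di" unfolding Psi_eq inv(2) by simp
qed

text \<open>Multiplied by the inverse, the \<open>H_sum\<close> part becomes a conjugate of the
  diagonal matrix, whose trace supplies the constant with \<open>R - 1\<close>. The rest pairs
  \<open>Em\<close> with the \<open>T\<close> leading columns of the inverse, which are products of
  Lagrange coefficients.\<close>

lemma trace_formula:
  "mat_trace (the (mat_inverse (Psi R T g u v)) * dPsi R T g u v) =
    (real R - 1) / ln 2 + (1 / ln 2) * (\<Sum>p<T. fact p * (g / real T) ^ p *
      (\<Sum>j<R. \<Sum>i<T. U.alpha j * U.er p j * V.alpha i * V.er p i * J j i))"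
proof -
  let ?H = "mat_diag R (H_sum R)"
  have Xi_Xm: "Xi * Xm = 1\<^sub>m R" by (rule mat_mult_left_right_inverse[OF _ _ Xm_Xi]) auto
  have Di_Dm: "Di * Dm = 1\<^sub>m R" by (rule mat_mult_left_right_inverse[OF _ _ Dm_Di]) auto
  define Y where "Y = Xi * Di"
  define W where "W = Dm * (?H * Xm)"
  have CHX: "?H * Xm \<in> carrier_mat R R" by (rule mult_carrier_mat[of _ R R _ R]) auto
  have CY: "Y \<in> carrier_mat R R" "W \<in> carrier_mat R R"
    unfolding Y_def W_def using CHX by (auto intro: mult_carrier_mat[of _ R R _ R])
  have "Y * W = Xi * (Di * (Dm * (?H * Xm)))"
    unfolding Y_def W_def by (rule assoc_mult_mat[of _ R R _ R _ R]) (use CHX in \<open>auto intro: mult_carrier_mat[of _ R R _ R]\<close>)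
  also have "Di * (Dm * (?H * Xm)) = (Di * Dm) * (?H * Xm)"
    by (rule assoc_mult_mat[symmetric, of _ R R _ R _ R]) (use CHX in auto)
  also have "\<dots> = ?H * Xm" unfolding Di_Dm by (rule left_mult_one_mat[OF CHX])
  finally have YW: "mat_trace (Y * W) = mat_trace (Xi * (?H * Xm))" by simp
  also have "\<dots> = mat_trace ((?H * Xm) * Xi)" by (rule mat_trace_mult_comm[of _ R]) (use CHX in auto)
  also have "(?H * Xm) * Xi = ?H * (Xm * Xi)" by (rule assoc_mult_mat[of _ R R _ R _ R]) auto
  also have "\<dots> = ?H" unfolding Xm_Xi by (rule right_mult_one_mat[of _ R R]) simp
  also have "mat_trace ?H = (\<Sum>k<R. H_sum R k)" by (simp add: mat_trace_def mat_diag_def)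
  finally have t1: "mat_trace (Y * W) = - (real R - 1)" using sum_H_sum[OF R] by simp
  have t2: "mat_trace (Y * Em) = (\<Sum>p<T. fact p * (g / real T) ^ p *
      (\<Sum>j<R. \<Sum>i<T. U.alpha j * U.er p j * V.alpha i * V.er p i * J j i))"
  proof -
    have Yji: "Y $$ (j, i) = (\<Sum>m<T. coeff (U.lag j) (R - T + m) / c (R - T + m) * coeff (V.lag i) m)"
      if "j < R" "i < T" for j i
    proof -
      have "Y $$ (j, i) = (\<Sum>k<R. coeff (U.lag j) k / c k * (if R - T \<le> k then coeff (V.lag i) (k - (R - T)) else 0))"
        using that TR by (simp add: Y_def Xi_def Di_def scalar_prod_def atLeast0LessThan)
      thus ?thesis unfolding split_R by simp
    qed
    have term_eq: "Y $$ (j, i) * (c (R - 1) * (u $ j) ^ (R - 1) * (v $ i) ^ (T - 1)) =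
       (\<Sum>p<T. fact p * (g / real T) ^ p * (U.alpha j * U.er p j * V.alpha i * V.er p i))" if "j < R" "i < T" for j i
    proof -
      \<comment> \<open>Counting from the top, \<open>m = T - 1 - p\<close> and
        \<open>R - T + m = R - 1 - p\<close>: one \<open>p\<close> serves both \<open>u\<close> and
        \<open>v\<close>, so both Lagrange coefficients become signed \<open>er p\<close>.\<close>
      have "Y $$ (j, i) = (\<Sum>p<T. coeff (U.lag j) (R - 1 - p) / c (R - 1 - p) * coeff (V.lag i) (T - 1 - p))"
        unfolding Yji[OF that] using TR
        by (subst sum.nat_diff_reindex[symmetric]) (intro sum.cong refl arg_cong2[where f = "(*)"] arg_cong2[where f = "(/)"] arg_cong2[where f = coeff] arg_cong[where f = c], auto)
      hence "Y $$ (j, i) * (c (R - 1) * (u $ j) ^ (R - 1) * (v $ i) ^ (T - 1)) =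
        (\<Sum>p<T. c (R - 1) / c (R - 1 - p) * ((coeff (U.lag j) (R - 1 - p) * (u $ j) ^ (R - 1)) * (coeff (V.lag i) (T - 1 - p) * (v $ i) ^ (T - 1))))"
        by (simp add: sum_distrib_right sum_distrib_left mult_ac)
      also have "\<dots> = (\<Sum>p<T. fact p * (g / real T) ^ p * (U.alpha j * U.er p j * V.alpha i * V.er p i))"
      proof (intro sum.cong refl)
        fix p assume "p \<in> {..<T}"
        hence p: "p < T" "p < R" using TR by auto
        have "(- (g / real T)) ^ (R - 1) = (- (g / real T)) ^ (R - 1 - p) * (- (g / real T)) ^ p"
          using p by (simp add: power_add[symmetric])
        hence "c (R - 1) = c (R - 1 - p) * ((- (g / real T)) ^ p * ((-1) ^ p * fact p))"
          unfolding c_def xi_top[OF p(2)] by (simp only: mult_ac)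
        \<comment> \<open>The sign from \<open>xi_top\<close> cancels that of the power; the two
          signs from \<open>coeff_lag_top\<close> will cancel each other.\<close>
        also have "(- (g / real T)) ^ p * ((-1) ^ p * fact p) = fact p * (g / real T) ^ p"
        proof -
          have "(- (g / real T)) ^ p * (-1) ^ p = (g / real T) ^ p"
            by (simp only: power_mult_distrib[symmetric]) simp
          thus ?thesis by (metis mult.assoc mult.commute)
        qed
        finally have cc: "c (R - 1) / c (R - 1 - p) = fact p * (g / real T) ^ p"
          using c_nonzero[of "R - 1 - p"] R by simp
        have "((-1) ^ p * (U.er p j * U.alpha j)) * ((-1) ^ p * (V.er p i * V.alpha i)) =
            U.alpha j * U.er p j * V.alpha i * V.er p i"
          by (simp add: power_mult_distrib[symmetric])
        thus "c (R - 1) / c (R - 1 - p) * ((coeff (U.lag j) (R - 1 - p) * (u $ j) ^ (R - 1)) * (coeff (V.lag i) (T - 1 - p) * (v $ i) ^ (T - 1))) =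
          fact p * (g / real T) ^ p * (U.alpha j * U.er p j * V.alpha i * V.er p i)"
          unfolding cc U.coeff_lag_top[OF that(1) p(2)] V.coeff_lag_top[OF that(2) p(1)] by simp
      qed
      finally show ?thesis .
    qed
    have "mat_trace (Y * Em) = (\<Sum>j<R. \<Sum>r<R. Y $$ (j, r) * Em $$ (r, j))"
      using CY(1) by (auto simp: mat_trace_def scalar_prod_def atLeast0LessThan Em_def intro!: sum.cong)
    also have "\<dots> = (\<Sum>j<R. \<Sum>i<T. Y $$ (j, i) * (c (R - 1) * (u $ j) ^ (R - 1) * (v $ i) ^ (T - 1)) * J j i)"
    proof (rule sum.cong[OF refl])
      fix j assume j: "j \<in> {..<R}"
      show "(\<Sum>r<R. Y $$ (j, r) * Em $$ (r, j)) = (\<Sum>i<T. Y $$ (j, i) * (c (R - 1) * (u $ j) ^ (R - 1) * (v $ i) ^ (T - 1)) * J j i)"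
        by (rule sum.mono_neutral_cong_right) (use TR j in \<open>auto simp: Em_def mult_ac\<close>)
    qed
    also have "\<dots> = (\<Sum>j<R. \<Sum>i<T. \<Sum>p<T. fact p * (g / real T) ^ p * (U.alpha j * U.er p j * V.alpha i * V.er p i * J j i))"
    proof -
      have "Y $$ (j, i) * (c (R - 1) * (u $ j) ^ (R - 1) * (v $ i) ^ (T - 1)) * J j i =
        (\<Sum>p<T. fact p * (g / real T) ^ p * (U.alpha j * U.er p j * V.alpha i * V.er p i * J j i))" if "j < R" "i < T" for j i
        unfolding term_eq[OF that] by (simp only: sum_distrib_right mult.assoc)
      thus ?thesis by (intro sum.cong refl) auto
    qed
    also have "\<dots> = (\<Sum>j<R. \<Sum>p<T. \<Sum>i<T. fact p * (g / real T) ^ p * (U.alpha j * U.er p j * V.alpha i * V.er p i * J j i))"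
      by (intro sum.cong refl sum.swap)
    also have "\<dots> = (\<Sum>p<T. \<Sum>j<R. \<Sum>i<T. fact p * (g / real T) ^ p * (U.alpha j * U.er p j * V.alpha i * V.er p i * J j i))"
      by (rule sum.swap)
    finally show ?thesis by (simp only: sum_distrib_left)
  qed
  have "Y * dPsi R T g u v = (1 / ln 2) \<cdot>\<^sub>m (Y * (Em - W))"
    unfolding dPsi_eq W_def[symmetric] by (rule mult_smult_distrib[of _ R R _ R]) (use CY in auto)
  also have "Y * (Em - W) = Y * Em - Y * W"
    by (rule mult_minus_distrib_mat[of _ R R _ R]) (use CY in auto)
  finally have "mat_trace (Y * dPsi R T g u v) = (1 / ln 2) * (mat_trace (Y * Em) - mat_trace (Y * W))"
    using CY by (simp add: mat_trace_def sum_distrib_left sum_subtractf right_diff_distrib)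
  hence tr: "mat_trace (Y * dPsi R T g u v) = (1 / ln 2) * (mat_trace (Y * Em) - - (real R - 1))"
    unfolding t1 .
  have "(1 / l) * (S - - r) = r / l + (1 / l) * S" for l S r :: real
    by (simp add: add_divide_distrib)
  thus ?thesis unfolding Psi_inverse(2) Y_def[symmetric] t2[symmetric] tr .
qed

end

section \<open>Transfer to an arbitrary probability space\<close>

lemma distr_std_complex_gaussian:
  assumes "prob_space M" and Z: "std_complex_gaussian M Z"
  shows "distr M borel Z = cgauss"
proof -
  interpret prob_space M by fact
  have d: "distr M borel X = half_normal"
    if "distributed M lborel X (\<lambda>x. ennreal (normal_density 0 (sqrt (1 / 2)) x))" for X
    using distributed_distr_eq_density[OF that] by (simp cong: distr_cong)
  have rv: "random_variable borel (\<lambda>\<omega>. Re (Z \<omega>))" "random_variable borel (\<lambda>\<omega>. Im (Z \<omega>))"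
    and eq: "distr M borel (\<lambda>\<omega>. Re (Z \<omega>)) \<Otimes>\<^sub>M distr M borel (\<lambda>\<omega>. Im (Z \<omega>)) =
      distr M (borel \<Otimes>\<^sub>M borel) (\<lambda>\<omega>. (Re (Z \<omega>), Im (Z \<omega>)))"
    using Z unfolding std_complex_gaussian_def indep_var_distribution_eq by auto
  have "half_normal \<Otimes>\<^sub>M half_normal = distr M (borel \<Otimes>\<^sub>M borel) (\<lambda>\<omega>. (Re (Z \<omega>), Im (Z \<omega>)))"
    using Z unfolding eq[symmetric] std_complex_gaussian_def by (simp add: d)
  hence "cgauss = distr (distr M (borel \<Otimes>\<^sub>M borel) (\<lambda>\<omega>. (Re (Z \<omega>), Im (Z \<omega>)))) borel (\<lambda>(p, q). Complex p q)"
    by (simp add: cgauss_def)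
  also have "\<dots> = distr M borel ((\<lambda>(p, q). Complex p q) \<circ> (\<lambda>\<omega>. (Re (Z \<omega>), Im (Z \<omega>))))"
    by (rule distr_distr[OF measurable_Complex]) (use rv in measurable)
  also have "(\<lambda>(p, q). Complex p q) \<circ> (\<lambda>\<omega>. (Re (Z \<omega>), Im (Z \<omega>))) = Z" by (simp add: fun_eq_iff)
  finally show ?thesis ..
qed

text \<open>Independence makes the joint law of the entries the product of its marginals, and each
  of these is \<open>cgauss\<close>.\<close>

lemma distr_iid_complex_gaussian_mat:
  assumes "prob_space M" and H: "iid_complex_gaussian_mat M R T H" and "0 < R" "0 < T"
  shows "distr M (PiM ({..<R} \<times> {..<T}) (\<lambda>_. cgauss)) (\<lambda>\<omega>. \<lambda>ij\<in>{..<R} \<times> {..<T}. H \<omega> $$ ij) =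
     PiM ({..<R} \<times> {..<T}) (\<lambda>_. cgauss)"
    and "(\<lambda>\<omega>. \<lambda>ij\<in>{..<R} \<times> {..<T}. H \<omega> $$ ij) \<in> M \<rightarrow>\<^sub>M PiM ({..<R} \<times> {..<T}) (\<lambda>_. cgauss)"
proof -
  interpret prob_space M by fact
  let ?I = "{..<R} \<times> {..<T}"
  have ind: "indep_vars (\<lambda>_. borel) (\<lambda>ij \<omega>. H \<omega> $$ ij) ?I"
    using H by (simp add: iid_complex_gaussian_mat_def)
  have rv: "random_variable borel (\<lambda>\<omega>. H \<omega> $$ ij)" if "ij \<in> ?I" for ij
    using ind that by (auto simp: indep_vars_def)
  have sets: "sets (PiM ?I (\<lambda>_. cgauss)) = sets (PiM ?I (\<lambda>_. borel :: complex measure))"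
    by (rule sets_PiM_cong) simp_all
  have "distr M (PiM ?I (\<lambda>_. cgauss)) (\<lambda>\<omega>. \<lambda>ij\<in>?I. H \<omega> $$ ij) = distr M (PiM ?I (\<lambda>_. borel)) (\<lambda>\<omega>. \<lambda>ij\<in>?I. H \<omega> $$ ij)"
    by (rule distr_cong[OF refl sets]) simp
  also have "\<dots> = PiM ?I (\<lambda>ij. distr M borel (\<lambda>\<omega>. H \<omega> $$ ij))"
    by (rule indep_vars_iff_distr_eq_PiM'[THEN iffD1, OF _ rv ind]) (use assms in auto)
  also have "\<dots> = PiM ?I (\<lambda>_. cgauss)"
    by (rule PiM_cong[OF refl])
      (use H in \<open>auto simp: iid_complex_gaussian_mat_def intro!: distr_std_complex_gaussian[OF assms(1)]\<close>)
  finally show "distr M (PiM ?I (\<lambda>_. cgauss)) (\<lambda>\<omega>. \<lambda>ij\<in>?I. H \<omega> $$ ij) = PiM ?I (\<lambda>_. cgauss)" .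
  show "(\<lambda>\<omega>. \<lambda>ij\<in>?I. H \<omega> $$ ij) \<in> M \<rightarrow>\<^sub>M PiM ?I (\<lambda>_. cgauss)"
    by (rule measurable_restrict) (use rv in simp)
qed

text \<open>The locale works with functions on all naturals, the capacity with vectors; they have to
  agree only below \<open>R\<close> and \<open>T\<close>.\<close>

lemma (in two_scales) log_det_capacity_eq:
  fixes uu vv :: "real vec"
  assumes uu: "uu \<in> carrier_vec R" "\<And>j. j < R \<Longrightarrow> uu $ j = u j"
    and vv: "vv \<in> carrier_vec T" "\<And>i. i < T \<Longrightarrow> vv $ i = v i"
    and A: "A \<in> carrier_mat R T"
  shows "log_det_capacity T g uu vv A = ln (Dt (g / real T) (\<lambda>ij\<in>{..<R} \<times> {..<T}. A $$ ij)) / ln 2"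
proof -
  let ?h = "\<lambda>ij\<in>{..<R} \<times> {..<T}. A $$ ij"
  have adj: "mat_adjoint A \<in> carrier_mat T R"
    using A by (auto simp: mat_adjoint_def)
  have adj_idx: "mat_adjoint A $$ (i, j) = cnj (A $$ (j, i))" if "i < T" "j < R" for i j
    using A that by (simp add: mat_adjoint_def mat_of_rows_def conjugate_vec_def conjugate_complex_def)
  have 1: "diag_of_vec vv * mat_adjoint A = mat T R (\<lambda>(i, j). of_real (v i) * cnj (A $$ (j, i)))"
    unfolding diag_of_vec_def using vv(1)
    by (subst mat_diag_mult_left[of _ _ R]) (use adj in \<open>auto intro!: eq_matI simp: vv(2) adj_idx\<close>)
  have 2: "diag_of_vec vv * mat_adjoint A * diag_of_vec uu =
      mat T R (\<lambda>(i, j). of_real (v i) * cnj (A $$ (j, i)) * of_real (u j))"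
    unfolding 1 unfolding diag_of_vec_def using uu(1)
    by (subst mat_diag_mult_right[of _ T]) (auto intro!: eq_matI simp: uu(2))
  have 3: "(diag_of_vec vv * mat_adjoint A * diag_of_vec uu * A) $$ (a, b) =
      (\<Sum>j<R. of_real (v a) * cnj (A $$ (j, a)) * of_real (u j) * A $$ (j, b))" if "a < T" "b < T" for a b
    unfolding 2 using that A by (simp add: scalar_prod_def atLeast0LessThan)
  have "1\<^sub>m T + complex_of_real (g / real T) \<cdot>\<^sub>m (diag_of_vec vv * mat_adjoint A * diag_of_vec uu * A) =
    mat T T (\<lambda>(a, b). chan (g / real T) ?h a b)"
  proof (rule eq_matI)
    fix a b assume "a < dim_row (mat T T (\<lambda>(a, b). chan (g / real T) ?h a b))"
      "b < dim_col (mat T T (\<lambda>(a, b). chan (g / real T) ?h a b))"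
    hence ab: "a < T" "b < T" by auto
    have dims: "dim_row (diag_of_vec vv * mat_adjoint A * diag_of_vec uu * A) = T"
      "dim_col (diag_of_vec vv * mat_adjoint A * diag_of_vec uu * A) = T"
      unfolding 2 using A by auto
    have "(1\<^sub>m T + complex_of_real (g / real T) \<cdot>\<^sub>m (diag_of_vec vv * mat_adjoint A * diag_of_vec uu * A)) $$ (a, b) =
      idm a b + complex_of_real (g / real T) * (\<Sum>j<R. of_real (v a) * cnj (A $$ (j, a)) * of_real (u j) * A $$ (j, b))"
      using ab dims by (simp add: 3 del: index_mult_mat)
    also have "\<dots> = chan (g / real T) ?h a b"
      using ab by (simp add: chan_def shifted_def sum_distrib_left mult_ac)
    finally show "(1\<^sub>m T + complex_of_real (g / real T) \<cdot>\<^sub>m (diag_of_vec vv * mat_adjoint A * diag_of_vec uu * A)) $$ (a, b) =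
      mat T T (\<lambda>(a, b). chan (g / real T) ?h a b) $$ (a, b)" using ab by simp
  qed (use A in \<open>auto simp: 2\<close>)
  hence "Determinant.det (1\<^sub>m T + complex_of_real (g / real T) \<cdot>\<^sub>m (diag_of_vec vv * mat_adjoint A * diag_of_vec uu * A)) =
    detf T (chan (g / real T) ?h)" by (simp add: detf_def)
  thus ?thesis by (simp add: log_det_capacity_def Dt_def log_def)
qed

theorem theorem2:
  fixes M :: "'a measure" and H :: "'a \<Rightarrow> complex mat"
    and R T :: nat and g :: real and u v :: "real vec"
  assumes "1 \<le> T" and "T \<le> R"
    and "0 < g"
    and "u \<in> carrier_vec R" and "v \<in> carrier_vec T"
    and "\<And>i. i < R \<Longrightarrow> 0 < u $ i" and "\<And>i. i < T \<Longrightarrow> 0 < v $ i"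
    and "\<And>i j. i < j \<Longrightarrow> j < R \<Longrightarrow> u $ j < u $ i"
    and "\<And>i j. i < j \<Longrightarrow> j < T \<Longrightarrow> v $ j < v $ i"
    and "prob_space M"
    and "iid_complex_gaussian_mat M R T H"
  shows "integrable M (\<lambda>\<omega>. log_det_capacity T g u v (H \<omega>)) \<and>
         invertible_mat (Psi R T g u v) \<and>
         ergodic_capacity M T g u v H =
           - (real R - 1) / ln 2 + mat_trace (the (mat_inverse (Psi R T g u v)) * dPsi R T g u v)"
proof -
  have injs: "inj_on (\<lambda>i. x $ i) {..<n}" if "\<And>i j. i < j \<Longrightarrow> j < n \<Longrightarrow> x $ j < x $ i" for x :: "real vec" and n
    by (intro linorder_inj_onI) (use that in fastforce)+
  interpret psi_setup u v R T g
    by unfold_locales (use assms(1-3,6,7) injs[OF assms(8)] injs[OF assms(9)] in auto)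
  interpret S: two_scales "\<lambda>j. u $ j" R "\<lambda>i. v $ i" T
    by unfold_locales (use assms(1,2) in auto)
  interpret prob_space M by fact
  define X where "X = (\<lambda>\<omega>. \<lambda>ij\<in>{..<R} \<times> {..<T}. H \<omega> $$ ij)"
  have RT: "0 < R" "0 < T" using assms(1,2) by auto
  have X: "distr M S.Hm X = S.Hm" and Xm: "X \<in> M \<rightarrow>\<^sub>M S.Hm"
    unfolding X_def using distr_iid_complex_gaussian_mat[OF assms(10,11) RT] by auto
  let ?\<rho> = "g / real T"
  have \<rho>: "0 < ?\<rho>" using assms(1,3) by simp
  have cap: "log_det_capacity T g u v (H \<omega>) = ln (S.Dt ?\<rho> (X \<omega>)) / ln 2" if "\<omega> \<in> space M" for \<omega>
    unfolding X_def by (rule S.log_det_capacity_eq) (use assms(4,5,11) that in \<open>auto simp: iid_complex_gaussian_mat_def\<close>)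
  have ln_meas: "(\<lambda>h. ln (S.Dt ?\<rho> h)) \<in> borel_measurable S.Hm" by measurable
  have int: "integrable M (\<lambda>\<omega>. ln (S.Dt ?\<rho> (X \<omega>)))"
    using S.integrable_ln_Dt[of ?\<rho>] \<rho> integrable_distr_eq[OF Xm ln_meas] by (simp add: X)
  have val: "(LINT \<omega>|M. ln (S.Dt ?\<rho> (X \<omega>))) = S.L ?\<rho>"
    unfolding S.L_def using integral_distr[OF Xm ln_meas] by (simp add: X)
  have 1: "integrable M (\<lambda>\<omega>. log_det_capacity T g u v (H \<omega>))"
    using int by (subst Bochner_Integration.integrable_cong[OF refl cap]) auto
  have "ergodic_capacity M T g u v H = (LINT \<omega>|M. ln (S.Dt ?\<rho> (X \<omega>)) / ln 2)"
    unfolding ergodic_capacity_def by (rule Bochner_Integration.integral_cong[OF refl cap])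
  also have "\<dots> = S.L ?\<rho> / ln 2" by (simp add: val)
  \<comment> \<open>For \<open>?\<rho> = g / real T\<close> the argument
    \<open>1 / (?\<rho> * u $ j * v $ i)\<close> in \<open>L_formula\<close> is the one in
    \<open>J\<close>.\<close>
  also have "S.L ?\<rho> = (\<Sum>p<T. fact p * ?\<rho> ^ p *
      (\<Sum>j<R. \<Sum>i<T. U.alpha j * U.er p j * V.alpha i * V.er p i * J j i))"
    unfolding S.L_formula[OF \<rho>] J_def by simp
  finally have "ergodic_capacity M T g u v H = (1 / ln 2) * (\<Sum>p<T. fact p * ?\<rho> ^ p *
      (\<Sum>j<R. \<Sum>i<T. U.alpha j * U.er p j * V.alpha i * V.er p i * J j i))" by simp
  also have "\<dots> = - (real R - 1) / ln 2 + mat_trace (the (mat_inverse (Psi R T g u v)) * dPsi R T g u v)"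
    unfolding trace_formula by (simp add: diff_divide_distrib)
  finally show ?thesis using 1 Psi_inverse(1) by blast
qed

end
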